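(* Let $\mathscr V$ be a cosmos which has a dense autonomous generator, and assume that the full subcategory $\mathscr V^c\subseteq\mathscr V$ of objects with duals is essentially small. Let $T$ be a comonoid in $\mathscr V$. Then the counit $\nu\colon L(V^c_T)\to T$ of the Tannakian adjunction is an isomorphism if and only if the tautological natural transformation exhibits $T$, considered as a comodule over itself, as the colimit of the domain functor $D\colon \mathscr V^c_T/T\to \mathscr V_T$ (the diagram of Cauchy comodules over $T$).
   Context: A cosmos $\mathscr V$ is a complete and cocomplete symmetric monoidal closed category, with tensor product $\otimes$, unit $I$ and internal hom $[-,-]$. $\mathscr V^c$ is the full subcategory of objects $M$ having a dual $M^\vee$. A subcategory $\mathscr A\subseteq\mathscr C$ of an ordinary category is $\mathbf{Set}$-dense if for every $C\in\mathscr C$ the tautological natural transformation from the domain functor $D\colon \mathscr A/C\to\mathscr C$ to the constant functor at $C$ (whose component at $\varphi\colon A\to C$ is $\varphi$) exhibits $C$ as the colimit of $D$. A dense autonomous generator of $\mathscr V$ is an essentially small full subcategory $\mathscr X\subseteq\mathscr V$ which consists of objects with duals, is closed under the tensor product and under the formation of duals, and is $\mathbf{Set}$-dense in $\mathscr V$. For a comonoid $(T,\delta,\varepsilon)$ in $\mathscr V$, $\mathscr V_T$ is the category of (left) $T$-comodules $(M,\varrho\colon M\to T\otimes M)$; it is enriched in $\mathscr V$, the hom-object from $(M,\varrho)$ to $(M',\varrho')$ being the equalizer of the two evident morphisms $[M,M']\to[M,T\otimes M']$ (apply $T\otimes -$ and precompose with $\varrho$; postcompose with $\varrho'$). $T$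 is a comodule over itself via $\delta$. A Cauchy comodule is a comodule whose underlying object lies in $\mathscr V^c$; $\mathscr V^c_T\subseteq\mathscr V_T$ is the full subcategory of Cauchy comodules (essentially small; replace it by a small equivalent category where needed), and $V^c_T\colon\mathscr V^c_T\to\mathscr V^c$ is the forgetful $\mathscr V$-functor. $\mathscr V^c_T/T$ is the category of morphisms $\varphi\colon (M,\varrho)\to (T,\delta)$ in $\mathscr V_T$ with $(M,\varrho)$ a Cauchy comodule, and $D$ sends $\varphi$ to its domain. For a small $\mathscr V$-category $\mathscr A$ and a $\mathscr V$-functor $\omega\colon\mathscr A\to\mathscr V^c$ put $L(\omega)=\int^{A\in\mathscr A}\omega(A)\otimes\omega(A)^\vee$. The coevaluations $I\to\omega(A)^\vee\otimes\omega(A)$ induce a $\mathscr V$-natural transformation $\pi_A\colon\omega(A)\to L(\omega)\otimes\omega(A)$, and $L(\omega)$ has a unique comonoid structure for which every $(\omega(A),\pi_A)$ is an $L(\omega)$-comodule (comultiplication induced by the coevaluations, counit by the evaluations). The assignment $(\mathscr A,\omega)\mapsto L(\omega)$ is left adjoint to the functor from comonoids in $\mathscr V$ to small $\mathscr V$-categories over $\mathscr V^c$ (and strictly commuting triangles) sending $T$ to $(\mathscr V^c_T,V^c_T)$; this is the Tannakian adjunction. Its counit $\nu\colon L(V^c_T)\to T$ is the unique morphism with $(\nu\otimes M)\circ\pi_{(M,\varrho)}=\varrho$ for all Cauchy comodules $(M,\varrho)$. *)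

theory Defs
  imports Main
begin

unbundle cardinal_syntax

section \<open>Ordinary categories\<close>

record ('o, 'a) category =
  Ob :: "'o set"
  Ar :: "'a set"
  Dom :: "'a \<Rightarrow> 'o"
  Cod :: "'a \<Rightarrow> 'o"
  Idt :: "'o \<Rightarrow> 'a"  ("\<one>\<index>")
  Cmp :: "'a \<Rightarrow> 'a \<Rightarrow> 'a"  (infixl "\<cdot>\<index>" 55)

definition hom :: "('o, 'a, 'z) category_scheme \<Rightarrow> 'o \<Rightarrow> 'o \<Rightarrow> 'a set" where
  "hom C x y = {f \<in> Ar C. Dom C f = x \<and> Cod C f = y}"

locale category =
  fixes C :: "('o, 'a, 'z) category_scheme" (structure)
  assumes Dom_Ob: "f \<in> Ar C \<Longrightarrow> Dom C f \<in> Ob C"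
    and Cod_Ob: "f \<in> Ar C \<Longrightarrow> Cod C f \<in> Ob C"
    and Idt_hom: "x \<in> Ob C \<Longrightarrow> \<one> x \<in> hom C x x"
    and Cmp_hom: "f \<in> hom C x y \<Longrightarrow> g \<in> hom C y z \<Longrightarrow> g \<cdot> f \<in> hom C x z"
    and Idt_left: "f \<in> hom C x y \<Longrightarrow> \<one> y \<cdot> f = f"
    and Idt_right: "f \<in> hom C x y \<Longrightarrow> f \<cdot> \<one> x = f"
    and Cmp_assoc: "f \<in> hom C w x \<Longrightarrow> g \<in> hom C x y \<Longrightarrow> h \<in> hom C y z \<Longrightarrow>
      h \<cdot> (g \<cdot> f) = (h \<cdot> g) \<cdot> f"

definition inverse_arrows :: "('o, 'a, 'z) category_scheme \<Rightarrow> 'a \<Rightarrow> 'a \<Rightarrow> bool" where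
  "inverse_arrows C f g \<longleftrightarrow>
    f \<in> Ar C \<and> g \<in> hom C (Cod C f) (Dom C f) \<and>
    g \<cdot>\<^bsub>C\<^esub> f = \<one>\<^bsub>C\<^esub> (Dom C f) \<and> f \<cdot>\<^bsub>C\<^esub> g = \<one>\<^bsub>C\<^esub> (Cod C f)"

definition is_iso :: "('o, 'a, 'z) category_scheme \<Rightarrow> 'a \<Rightarrow> bool" where
  "is_iso C f \<longleftrightarrow> (\<exists>g. inverse_arrows C f g)"

definition inv_ar :: "('o, 'a, 'z) category_scheme \<Rightarrow> 'a \<Rightarrow> 'a" where
  "inv_ar C f = (THE g. inverse_arrows C f g)"

definition isomorphic :: "('o, 'a, 'z) category_scheme \<Rightarrow> 'o \<Rightarrow> 'o \<Rightarrow> bool" where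
  "isomorphic C x y \<longleftrightarrow> (\<exists>f \<in> hom C x y. is_iso C f)"

definition is_functor ::
  "('i, 'j, 'y) category_scheme \<Rightarrow> ('o, 'a, 'z) category_scheme \<Rightarrow>
   ('i \<Rightarrow> 'o) \<Rightarrow> ('j \<Rightarrow> 'a) \<Rightarrow> bool" where
  "is_functor J C Fo Fa \<longleftrightarrow>
    category J \<and> category C \<and>
    (\<forall>i \<in> Ob J. Fo i \<in> Ob C) \<and>
    (\<forall>u \<in> Ar J. Fa u \<in> hom C (Fo (Dom J u)) (Fo (Cod J u))) \<and>
    (\<forall>i \<in> Ob J. Fa (\<one>\<^bsub>J\<^esub> i) = \<one>\<^bsub>C\<^esub> (Fo i)) \<and>
    (\<forall>u \<in> Ar J. \<forall>v \<in> Ar J. Cod J u = Dom J v \<longrightarrow>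
       Fa (v \<cdot>\<^bsub>J\<^esub> u) = Fa v \<cdot>\<^bsub>C\<^esub> Fa u)"

definition is_cocone ::
  "('i, 'j, 'y) category_scheme \<Rightarrow> ('o, 'a, 'z) category_scheme \<Rightarrow>
   ('i \<Rightarrow> 'o) \<Rightarrow> ('j \<Rightarrow> 'a) \<Rightarrow> 'o \<Rightarrow> ('i \<Rightarrow> 'a) \<Rightarrow> bool" where
  "is_cocone J C Fo Fa c \<gamma> \<longleftrightarrow>
    c \<in> Ob C \<and> (\<forall>i \<in> Ob J. \<gamma> i \<in> hom C (Fo i) c) \<and>
    (\<forall>u \<in> Ar J. \<gamma> (Cod J u) \<cdot>\<^bsub>C\<^esub> Fa u = \<gamma> (Dom J u))"

definition is_colimit ::
  "('i, 'j, 'y) category_scheme \<Rightarrow> ('o, 'a, 'z) category_scheme \<Rightarrow>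
   ('i \<Rightarrow> 'o) \<Rightarrow> ('j \<Rightarrow> 'a) \<Rightarrow> 'o \<Rightarrow> ('i \<Rightarrow> 'a) \<Rightarrow> bool" where
  "is_colimit J C Fo Fa c \<gamma> \<longleftrightarrow>
    is_cocone J C Fo Fa c \<gamma> \<and>
    (\<forall>c' \<gamma>'. is_cocone J C Fo Fa c' \<gamma>' \<longrightarrow>
       (\<exists>!h. h \<in> hom C c c' \<and> (\<forall>i \<in> Ob J. h \<cdot>\<^bsub>C\<^esub> \<gamma> i = \<gamma>' i)))"

definition is_cone ::
  "('i, 'j, 'y) category_scheme \<Rightarrow> ('o, 'a, 'z) category_scheme \<Rightarrow>
   ('i \<Rightarrow> 'o) \<Rightarrow> ('j \<Rightarrow> 'a) \<Rightarrow> 'o \<Rightarrow> ('i \<Rightarrow> 'a) \<Rightarrow> bool" where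
  "is_cone J C Fo Fa c \<gamma> \<longleftrightarrow>
    c \<in> Ob C \<and> (\<forall>i \<in> Ob J. \<gamma> i \<in> hom C c (Fo i)) \<and>
    (\<forall>u \<in> Ar J. Fa u \<cdot>\<^bsub>C\<^esub> \<gamma> (Dom J u) = \<gamma> (Cod J u))"

definition is_limit ::
  "('i, 'j, 'y) category_scheme \<Rightarrow> ('o, 'a, 'z) category_scheme \<Rightarrow>
   ('i \<Rightarrow> 'o) \<Rightarrow> ('j \<Rightarrow> 'a) \<Rightarrow> 'o \<Rightarrow> ('i \<Rightarrow> 'a) \<Rightarrow> bool" where
  "is_limit J C Fo Fa c \<gamma> \<longleftrightarrow>
    is_cone J C Fo Fa c \<gamma> \<and>
    (\<forall>c' \<gamma>'. is_cone J C Fo Fa c' \<gamma>' \<longrightarrow>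
       (\<exists>!h. h \<in> hom C c' c \<and> (\<forall>i \<in> Ob J. \<gamma> i \<cdot>\<^bsub>C\<^esub> h = \<gamma>' i)))"

definition is_equalizer ::
  "('o, 'a, 'z) category_scheme \<Rightarrow> 'a \<Rightarrow> 'a \<Rightarrow> 'o \<Rightarrow> 'a \<Rightarrow> bool" where
  "is_equalizer C f g E e \<longleftrightarrow>
    e \<in> hom C E (Dom C f) \<and> f \<cdot>\<^bsub>C\<^esub> e = g \<cdot>\<^bsub>C\<^esub> e \<and>
    (\<forall>X h. h \<in> hom C X (Dom C f) \<and> f \<cdot>\<^bsub>C\<^esub> h = g \<cdot>\<^bsub>C\<^esub> h \<longrightarrow>
       (\<exists>!k. k \<in> hom C X E \<and> e \<cdot>\<^bsub>C\<^esub> k = h))"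


section \<open>Smallness\<close>

text \<open>
  HOL has no distinction between sets and classes. Smallness is therefore taken relative to a
  type \<open>'u\<close>: a set is small if its cardinality is strictly below \<open>\<kappa> = |'u|\<close>, where \<open>\<kappa>\<close> is an
  infinite regular cardinal. For \<open>\<kappa>\<close> strongly inaccessible the small sets are, up to bijection,
  the elements of a Grothendieck universe, which is the usual meaning of the word. The objects
  and arrows of a category form sets in types that are not related to \<open>'u\<close>, so they may be large.
\<close>

definition smallness_type :: "'u itself \<Rightarrow> bool" where
  "smallness_type U \<longleftrightarrow> infinite (UNIV :: 'u set) \<and> regularCard |UNIV :: 'u set|"

definition small :: "'u itself \<Rightarrow> 'x set \<Rightarrow> bool" where
  "small U X \<longleftrightarrow> |X| <o |UNIV :: 'u set|"

definition locally_small :: "'u itself \<Rightarrow> ('o, 'a, 'z) category_scheme \<Rightarrow> bool" where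
  "locally_small U C \<longleftrightarrow> (\<forall>x \<in> Ob C. \<forall>y \<in> Ob C. small U (hom C x y))"

text \<open>Every small category is isomorphic to one whose objects and arrows are elements of \<open>'u\<close>.\<close>

definition has_small_limits :: "'u itself \<Rightarrow> ('o, 'a, 'z) category_scheme \<Rightarrow> bool" where
  "has_small_limits U C \<longleftrightarrow>
    (\<forall>(J :: ('u, 'u) category) Fo Fa.
       small U (Ob J) \<and> small U (Ar J) \<and> is_functor J C Fo Fa \<longrightarrow>
       (\<exists>c \<gamma>. is_limit J C Fo Fa c \<gamma>))"

definition has_small_colimits :: "'u itself \<Rightarrow> ('o, 'a, 'z) category_scheme \<Rightarrow> bool" where
  "has_small_colimits U C \<longleftrightarrow>
    (\<forall>(J :: ('u, 'u) category) Fo Fa.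
       small U (Ob J) \<and> small U (Ar J) \<and> is_functor J C Fo Fa \<longrightarrow>
       (\<exists>c \<gamma>. is_colimit J C Fo Fa c \<gamma>))"

text \<open>
  Full subcategories are given by their sets of objects: \<open>S\<close> spans a full subcategory with a small
  set of objects which is equivalent to the full subcategory spanned by \<open>X\<close>.
\<close>

definition small_replacement ::
  "'u itself \<Rightarrow> ('o, 'a, 'z) category_scheme \<Rightarrow> 'o set \<Rightarrow> 'o set \<Rightarrow> bool" where
  "small_replacement U C X S \<longleftrightarrow>
    S \<subseteq> X \<and> small U S \<and> (\<forall>x \<in> X. \<exists>s \<in> S. isomorphic C x s)"

definition essentially_small ::
  "'u itself \<Rightarrow> ('o, 'a, 'z) category_scheme \<Rightarrow> 'o set \<Rightarrow> bool" where
  "essentially_small U C X \<longleftrightarrow>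
    X \<subseteq> Ob C \<and> (\<forall>x \<in> X. \<forall>y \<in> X. small U (hom C x y)) \<and> (\<exists>S. small_replacement U C X S)"


section \<open>Slices of full subcategories and density\<close>

text \<open>
  The category \<open>X/c\<close> for the full subcategory spanned by \<open>X\<close>: its objects are the arrows
  \<open>\<phi> : x \<rightarrow> c\<close> with \<open>x \<in> X\<close>, and \<open>(\<phi>, \<psi>, f)\<close> is the arrow \<open>f : \<phi> \<rightarrow> \<psi>\<close>.
\<close>

definition slice ::
  "('o, 'a, 'z) category_scheme \<Rightarrow> 'o set \<Rightarrow> 'o \<Rightarrow> ('a, 'a \<times> 'a \<times> 'a) category" where
  "slice C X c =
    \<lparr>Ob = {\<phi> \<in> Ar C. Dom C \<phi> \<in> X \<and> Cod C \<phi> = c},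
     Ar = {(\<phi>, \<psi>, f). \<phi> \<in> Ar C \<and> Dom C \<phi> \<in> X \<and> Cod C \<phi> = c \<and>
                      \<psi> \<in> Ar C \<and> Dom C \<psi> \<in> X \<and> Cod C \<psi> = c \<and>
                      f \<in> hom C (Dom C \<phi>) (Dom C \<psi>) \<and> \<psi> \<cdot>\<^bsub>C\<^esub> f = \<phi>},
     Dom = (\<lambda>(\<phi>, \<psi>, f). \<phi>),
     Cod = (\<lambda>(\<phi>, \<psi>, f). \<psi>),
     Idt = (\<lambda>\<phi>. (\<phi>, \<phi>, \<one>\<^bsub>C\<^esub> (Dom C \<phi>))),
     Cmp = (\<lambda>(\<psi>, \<chi>, g) (\<phi>, \<psi>', f). (\<phi>, \<chi>, g \<cdot>\<^bsub>C\<^esub> f))\<rparr>"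

text \<open>
  The tautological natural transformation, whose component at \<open>\<phi>\<close> is \<open>\<phi>\<close>, exhibits \<open>c\<close> as the
  colimit of the domain functor \<open>X/c \<rightarrow> C\<close>.
\<close>

definition tautological_colimit ::
  "('o, 'a, 'z) category_scheme \<Rightarrow> 'o set \<Rightarrow> 'o \<Rightarrow> bool" where
  "tautological_colimit C X c \<longleftrightarrow>
    is_colimit (slice C X c) C (\<lambda>\<phi>. Dom C \<phi>) (\<lambda>(\<phi>, \<psi>, f). f) c (\<lambda>\<phi>. \<phi>)"

definition Set_dense :: "('o, 'a, 'z) category_scheme \<Rightarrow> 'o set \<Rightarrow> bool" where
  "Set_dense C X \<longleftrightarrow> X \<subseteq> Ob C \<and> (\<forall>c \<in> Ob C. tautological_colimit C X c)"


section \<open>Symmetric monoidal closed categories\<close>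

record ('o, 'a) smc = "('o, 'a) category" +
  tns :: "'o \<Rightarrow> 'o \<Rightarrow> 'o"  (infixl "\<otimes>\<index>" 70)
  tnsa :: "'a \<Rightarrow> 'a \<Rightarrow> 'a"  (infixl "\<boxtimes>\<index>" 70)
  unt :: "'o"  ("\<I>\<index>")
  assc :: "'o \<Rightarrow> 'o \<Rightarrow> 'o \<Rightarrow> 'a"  ("\<a>\<index>")
  lunit :: "'o \<Rightarrow> 'a"  ("\<l>\<index>")
  runit :: "'o \<Rightarrow> 'a"  ("\<r>\<index>")
  symm :: "'o \<Rightarrow> 'o \<Rightarrow> 'a"  ("\<s>\<index>")
  ihom :: "'o \<Rightarrow> 'o \<Rightarrow> 'o"  (infixr "\<Rrightarrow>\<index>" 60)
  ieval :: "'o \<Rightarrow> 'o \<Rightarrow> 'a"  ("\<e>\<index>")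

text \<open>\<open>M \<Rrightarrow> N\<close> is the internal hom \<open>[M, N]\<close>, with evaluation \<open>\<e> M N : [M, N] \<otimes> M \<rightarrow> N\<close>.\<close>

locale symmetric_monoidal_closed = category V
  for V :: "('o, 'a, 'z) smc_scheme" (structure) +
  assumes tns_Ob: "x \<in> Ob V \<Longrightarrow> y \<in> Ob V \<Longrightarrow> x \<otimes> y \<in> Ob V"
    and unt_Ob: "\<I> \<in> Ob V"
    and tnsa_hom: "f \<in> hom V x y \<Longrightarrow> g \<in> hom V x' y' \<Longrightarrow> f \<boxtimes> g \<in> hom V (x \<otimes> x') (y \<otimes> y')"
    and tnsa_Idt: "x \<in> Ob V \<Longrightarrow> y \<in> Ob V \<Longrightarrow> \<one> x \<boxtimes> \<one> y = \<one> (x \<otimes> y)"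
    and tnsa_Cmp: "f \<in> hom V x y \<Longrightarrow> g \<in> hom V y z \<Longrightarrow> f' \<in> hom V x' y' \<Longrightarrow> g' \<in> hom V y' z' \<Longrightarrow>
      (g \<cdot> f) \<boxtimes> (g' \<cdot> f') = (g \<boxtimes> g') \<cdot> (f \<boxtimes> f')"
    and assc_hom: "x \<in> Ob V \<Longrightarrow> y \<in> Ob V \<Longrightarrow> z \<in> Ob V \<Longrightarrow>
      \<a> x y z \<in> hom V (x \<otimes> y \<otimes> z) (x \<otimes> (y \<otimes> z))"
    and assc_iso: "x \<in> Ob V \<Longrightarrow> y \<in> Ob V \<Longrightarrow> z \<in> Ob V \<Longrightarrow> is_iso V (\<a> x y z)"
    and assc_nat: "f \<in> hom V x x' \<Longrightarrow> g \<in> hom V y y' \<Longrightarrow> h \<in> hom V z z' \<Longrightarrow>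
      \<a> x' y' z' \<cdot> (f \<boxtimes> g \<boxtimes> h) = (f \<boxtimes> (g \<boxtimes> h)) \<cdot> \<a> x y z"
    and lunit_hom: "x \<in> Ob V \<Longrightarrow> \<l> x \<in> hom V (\<I> \<otimes> x) x"
    and lunit_iso: "x \<in> Ob V \<Longrightarrow> is_iso V (\<l> x)"
    and lunit_nat: "f \<in> hom V x y \<Longrightarrow> \<l> y \<cdot> (\<one> \<I> \<boxtimes> f) = f \<cdot> \<l> x"
    and runit_hom: "x \<in> Ob V \<Longrightarrow> \<r> x \<in> hom V (x \<otimes> \<I>) x"
    and runit_iso: "x \<in> Ob V \<Longrightarrow> is_iso V (\<r> x)"
    and runit_nat: "f \<in> hom V x y \<Longrightarrow> \<r> y \<cdot> (f \<boxtimes> \<one> \<I>) = f \<cdot> \<r> x"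
    and symm_hom: "x \<in> Ob V \<Longrightarrow> y \<in> Ob V \<Longrightarrow> \<s> x y \<in> hom V (x \<otimes> y) (y \<otimes> x)"
    and symm_nat: "f \<in> hom V x x' \<Longrightarrow> g \<in> hom V y y' \<Longrightarrow>
      \<s> x' y' \<cdot> (f \<boxtimes> g) = (g \<boxtimes> f) \<cdot> \<s> x y"
    and symm_invol: "x \<in> Ob V \<Longrightarrow> y \<in> Ob V \<Longrightarrow> \<s> y x \<cdot> \<s> x y = \<one> (x \<otimes> y)"
    and pentagon: "w \<in> Ob V \<Longrightarrow> x \<in> Ob V \<Longrightarrow> y \<in> Ob V \<Longrightarrow> z \<in> Ob V \<Longrightarrow>
      \<a> w x (y \<otimes> z) \<cdot> \<a> (w \<otimes> x) y z
        = (\<one> w \<boxtimes> \<a> x y z) \<cdot> \<a> w (x \<otimes> y) z \<cdot> (\<a> w x y \<boxtimes> \<one> z)"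
    and triangle: "x \<in> Ob V \<Longrightarrow> y \<in> Ob V \<Longrightarrow> (\<one> x \<boxtimes> \<l> y) \<cdot> \<a> x \<I> y = \<r> x \<boxtimes> \<one> y"
    and hexagon: "x \<in> Ob V \<Longrightarrow> y \<in> Ob V \<Longrightarrow> z \<in> Ob V \<Longrightarrow>
      \<a> y z x \<cdot> \<s> x (y \<otimes> z) \<cdot> \<a> x y z
        = (\<one> y \<boxtimes> \<s> x z) \<cdot> \<a> y x z \<cdot> (\<s> x y \<boxtimes> \<one> z)"
    and ihom_Ob: "x \<in> Ob V \<Longrightarrow> y \<in> Ob V \<Longrightarrow> x \<Rrightarrow> y \<in> Ob V"
    and ieval_hom: "x \<in> Ob V \<Longrightarrow> y \<in> Ob V \<Longrightarrow> \<e> x y \<in> hom V ((x \<Rrightarrow> y) \<otimes> x) y"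
    and closed: "x \<in> Ob V \<Longrightarrow> y \<in> Ob V \<Longrightarrow> z \<in> Ob V \<Longrightarrow> f \<in> hom V (z \<otimes> x) y \<Longrightarrow>
      \<exists>!g. g \<in> hom V z (x \<Rrightarrow> y) \<and> \<e> x y \<cdot> (g \<boxtimes> \<one> x) = f"

definition cosmos :: "'u itself \<Rightarrow> ('o, 'a, 'z) smc_scheme \<Rightarrow> bool" where
  "cosmos U V \<longleftrightarrow> symmetric_monoidal_closed V \<and> locally_small U V \<and>
    has_small_limits U V \<and> has_small_colimits U V"

record ('o, 'a) comon =
  cob :: 'o
  comult :: 'a
  counit :: 'a

text \<open>An enriched category over a monoidal category with objects \<open>'o\<close> and arrows \<open>'a\<close>;
  composition is \<open>vCmp A x y z : A(y, z) \<otimes> A(x, y) \<rightarrow> A(x, z)\<close>.\<close>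

record ('x, 'o, 'a) vcat =
  vOb :: "'x set"
  vHom :: "'x \<Rightarrow> 'x \<Rightarrow> 'o"
  vCmp :: "'x \<Rightarrow> 'x \<Rightarrow> 'x \<Rightarrow> 'a"
  vIdt :: "'x \<Rightarrow> 'a"

context
  fixes V :: "('o, 'a, 'z) smc_scheme" (structure)
begin

subsection \<open>The internal hom\<close>

definition curry_ar :: "'o \<Rightarrow> 'o \<Rightarrow> 'o \<Rightarrow> 'a \<Rightarrow> 'a" where
  "curry_ar X M N f = (THE g. g \<in> hom V X (M \<Rrightarrow> N) \<and> \<e> M N \<cdot> (g \<boxtimes> \<one> M) = f)"

definition ihom_cmp :: "'o \<Rightarrow> 'o \<Rightarrow> 'o \<Rightarrow> 'a" where
  "ihom_cmp M N P = curry_ar ((N \<Rrightarrow> P) \<otimes> (M \<Rrightarrow> N)) M P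
     (\<e> N P \<cdot> (\<one> (N \<Rrightarrow> P) \<boxtimes> \<e> M N) \<cdot> \<a> (N \<Rrightarrow> P) (M \<Rrightarrow> N) M)"

definition ihom_idt :: "'o \<Rightarrow> 'a" where
  "ihom_idt M = curry_ar \<I> M M (\<l> M)"

text \<open>\<open>[M, g] : [M, N] \<rightarrow> [M, P]\<close> for \<open>g : N \<rightarrow> P\<close>.\<close>

definition ihom_post :: "'o \<Rightarrow> 'a \<Rightarrow> 'a" where
  "ihom_post M g = curry_ar (M \<Rrightarrow> Dom V g) M (Cod V g) (g \<cdot> \<e> M (Dom V g))"

text \<open>\<open>[f, P] : [N, P] \<rightarrow> [M, P]\<close> for \<open>f : M \<rightarrow> N\<close>.\<close>

definition ihom_pre :: "'a \<Rightarrow> 'o \<Rightarrow> 'a" where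
  "ihom_pre f P = curry_ar (Cod V f \<Rrightarrow> P) (Dom V f) P
     (\<e> (Cod V f) P \<cdot> (\<one> (Cod V f \<Rrightarrow> P) \<boxtimes> f))"

text \<open>The action \<open>[M, N] \<rightarrow> [T \<otimes> M, T \<otimes> N]\<close> of \<open>T \<otimes> -\<close> on hom-objects.\<close>

definition ihom_tns :: "'o \<Rightarrow> 'o \<Rightarrow> 'o \<Rightarrow> 'a" where
  "ihom_tns T M N = curry_ar (M \<Rrightarrow> N) (T \<otimes> M) (T \<otimes> N)
     ((\<one> T \<boxtimes> \<e> M N) \<cdot> \<a> T (M \<Rrightarrow> N) M \<cdot> (\<s> (M \<Rrightarrow> N) T \<boxtimes> \<one> M)
        \<cdot> inv_ar V (\<a> (M \<Rrightarrow> N) T M))"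


subsection \<open>Duals\<close>

text \<open>In a symmetric monoidal category left and right duals agree, so only one kind is mentioned.\<close>

definition is_dual :: "'o \<Rightarrow> 'o \<Rightarrow> 'a \<Rightarrow> 'a \<Rightarrow> bool" where
  "is_dual M N \<eta> \<epsilon> \<longleftrightarrow>
    M \<in> Ob V \<and> N \<in> Ob V \<and> \<eta> \<in> hom V \<I> (N \<otimes> M) \<and> \<epsilon> \<in> hom V (M \<otimes> N) \<I> \<and>
    \<l> M \<cdot> (\<epsilon> \<boxtimes> \<one> M) \<cdot> inv_ar V (\<a> M N M) \<cdot> (\<one> M \<boxtimes> \<eta>) \<cdot> inv_ar V (\<r> M) = \<one> M \<and>
    \<r> N \<cdot> (\<one> N \<boxtimes> \<epsilon>) \<cdot> \<a> N M N \<cdot> (\<eta> \<boxtimes> \<one> N) \<cdot> inv_ar V (\<l> N) = \<one> N"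

definition dualizable :: "'o set" where
  "dualizable = {M. \<exists>N \<eta> \<epsilon>. is_dual M N \<eta> \<epsilon>}"

text \<open>A choice of duals for the objects of \<open>dualizable\<close>.\<close>

definition dual_data :: "'o \<Rightarrow> 'o \<times> 'a \<times> 'a" where
  "dual_data M = (SOME (N, \<eta>, \<epsilon>). is_dual M N \<eta> \<epsilon>)"

definition dual :: "'o \<Rightarrow> 'o" where
  "dual M = fst (dual_data M)"

definition coev :: "'o \<Rightarrow> 'a" where
  "coev M = fst (snd (dual_data M))"

definition evd :: "'o \<Rightarrow> 'a" where
  "evd M = snd (snd (dual_data M))"

text \<open>
  The contravariant action \<open>[M, N] \<otimes> N\<^sup>\<or> \<rightarrow> M\<^sup>\<or>\<close> of hom-objects on duals, the composite
  \<open>[M, N] \<otimes> N\<^sup>\<or> \<rightarrow> M\<^sup>\<or> \<otimes> (M \<otimes> [M, N] \<otimes> N\<^sup>\<or>) \<rightarrow> M\<^sup>\<or> \<otimes> (N \<otimes> N\<^sup>\<or>) \<rightarrow> M\<^sup>\<or>\<close>.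
\<close>

definition dual_act :: "'o \<Rightarrow> 'o \<Rightarrow> 'a" where
  "dual_act M N =
     \<r> (dual M) \<cdot> (\<one> (dual M) \<boxtimes> evd N)
     \<cdot> (\<one> (dual M) \<boxtimes> ((\<e> M N \<cdot> \<s> M (M \<Rrightarrow> N)) \<boxtimes> \<one> (dual N)))
     \<cdot> (\<one> (dual M) \<boxtimes> inv_ar V (\<a> M (M \<Rrightarrow> N) (dual N)))
     \<cdot> \<a> (dual M) M ((M \<Rrightarrow> N) \<otimes> dual N)
     \<cdot> (coev M \<boxtimes> \<one> ((M \<Rrightarrow> N) \<otimes> dual N))
     \<cdot> inv_ar V (\<l> ((M \<Rrightarrow> N) \<otimes> dual N))"

definition dense_autonomous_generator :: "'u itself \<Rightarrow> 'o set \<Rightarrow> bool" where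
  "dense_autonomous_generator U X \<longleftrightarrow>
    essentially_small U V X \<and> X \<subseteq> dualizable \<and>
    (\<forall>M \<in> X. \<forall>N \<in> X. M \<otimes> N \<in> X) \<and>
    (\<forall>M \<in> X. \<exists>N \<in> X. \<exists>\<eta> \<epsilon>. is_dual M N \<eta> \<epsilon>) \<and>
    Set_dense V X"


subsection \<open>Comonoids and comodules\<close>

definition comonoid :: "('o, 'a) comon \<Rightarrow> bool" where
  "comonoid T \<longleftrightarrow>
    cob T \<in> Ob V \<and> comult T \<in> hom V (cob T) (cob T \<otimes> cob T) \<and> counit T \<in> hom V (cob T) \<I> \<and>
    \<a> (cob T) (cob T) (cob T) \<cdot> (comult T \<boxtimes> \<one> (cob T)) \<cdot> comult T
      = (\<one> (cob T) \<boxtimes> comult T) \<cdot> comult T \<and>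
    \<l> (cob T) \<cdot> (counit T \<boxtimes> \<one> (cob T)) \<cdot> comult T = \<one> (cob T) \<and>
    \<r> (cob T) \<cdot> (\<one> (cob T) \<boxtimes> counit T) \<cdot> comult T = \<one> (cob T)"

definition comonoid_morphism :: "('o, 'a) comon \<Rightarrow> ('o, 'a) comon \<Rightarrow> 'a \<Rightarrow> bool" where
  "comonoid_morphism S T f \<longleftrightarrow>
    f \<in> hom V (cob S) (cob T) \<and>
    comult T \<cdot> f = (f \<boxtimes> f) \<cdot> comult S \<and> counit T \<cdot> f = counit S"

definition Comon :: "(('o, 'a) comon, ('o, 'a) comon \<times> ('o, 'a) comon \<times> 'a) category" where
  "Comon =
    \<lparr>Ob = {T. comonoid T},
     Ar = {(S, T, f). comonoid S \<and> comonoid T \<and> comonoid_morphism S T f},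
     Dom = (\<lambda>(S, T, f). S),
     Cod = (\<lambda>(S, T, f). T),
     Idt = (\<lambda>T. (T, T, \<one> (cob T))),
     Cmp = (\<lambda>(S, T, g) (R, S', f). (R, T, g \<cdot> f))\<rparr>"

definition comodule :: "('o, 'a) comon \<Rightarrow> 'o \<times> 'a \<Rightarrow> bool" where
  "comodule T = (\<lambda>(M, \<rho>).
    M \<in> Ob V \<and> \<rho> \<in> hom V M (cob T \<otimes> M) \<and>
    \<a> (cob T) (cob T) M \<cdot> (comult T \<boxtimes> \<one> M) \<cdot> \<rho> = (\<one> (cob T) \<boxtimes> \<rho>) \<cdot> \<rho> \<and>
    \<l> M \<cdot> (counit T \<boxtimes> \<one> M) \<cdot> \<rho> = \<one> M)"

definition comodule_morphism :: "('o, 'a) comon \<Rightarrow> 'o \<times> 'a \<Rightarrow> 'o \<times> 'a \<Rightarrow> 'a \<Rightarrow> bool" where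
  "comodule_morphism T = (\<lambda>(M, \<rho>) (M', \<rho>') f.
    f \<in> hom V M M' \<and> \<rho>' \<cdot> f = (\<one> (cob T) \<boxtimes> f) \<cdot> \<rho>)"

definition Comod ::
  "('o, 'a) comon \<Rightarrow> ('o \<times> 'a, ('o \<times> 'a) \<times> ('o \<times> 'a) \<times> 'a) category" where
  "Comod T =
    \<lparr>Ob = {m. comodule T m},
     Ar = {(m, n, f). comodule T m \<and> comodule T n \<and> comodule_morphism T m n f},
     Dom = (\<lambda>(m, n, f). m),
     Cod = (\<lambda>(m, n, f). n),
     Idt = (\<lambda>m. (m, m, \<one> (fst m))),
     Cmp = (\<lambda>(n, p, g) (m, n', f). (m, p, g \<cdot> f))\<rparr>"

definition cauchy_comodules :: "('o, 'a) comon \<Rightarrow> ('o \<times> 'a) set" where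
  "cauchy_comodules T = {m. comodule T m \<and> fst m \<in> dualizable}"


subsection \<open>Enriched categories, functors and coends\<close>

definition vcategory :: "('x, 'o, 'a) vcat \<Rightarrow> bool" where
  "vcategory A \<longleftrightarrow>
    (\<forall>x \<in> vOb A. \<forall>y \<in> vOb A. vHom A x y \<in> Ob V) \<and>
    (\<forall>x \<in> vOb A. \<forall>y \<in> vOb A. \<forall>z \<in> vOb A.
       vCmp A x y z \<in> hom V (vHom A y z \<otimes> vHom A x y) (vHom A x z)) \<and>
    (\<forall>x \<in> vOb A. vIdt A x \<in> hom V \<I> (vHom A x x)) \<and>
    (\<forall>w \<in> vOb A. \<forall>x \<in> vOb A. \<forall>y \<in> vOb A. \<forall>z \<in> vOb A.
       vCmp A w x z \<cdot> (vCmp A x y z \<boxtimes> \<one> (vHom A w x))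
       = vCmp A w y z \<cdot> (\<one> (vHom A y z) \<boxtimes> vCmp A w x y)
           \<cdot> \<a> (vHom A y z) (vHom A x y) (vHom A w x)) \<and>
    (\<forall>x \<in> vOb A. \<forall>y \<in> vOb A.
       vCmp A x y y \<cdot> (vIdt A y \<boxtimes> \<one> (vHom A x y)) = \<l> (vHom A x y) \<and>
       vCmp A x x y \<cdot> (\<one> (vHom A x y) \<boxtimes> vIdt A x) = \<r> (vHom A x y))"

definition vfunctor ::
  "('x, 'o, 'a) vcat \<Rightarrow> ('y, 'o, 'a) vcat \<Rightarrow> ('x \<Rightarrow> 'y) \<Rightarrow> ('x \<Rightarrow> 'x \<Rightarrow> 'a) \<Rightarrow> bool" where
  "vfunctor A B Fo Fh \<longleftrightarrow>
    vcategory A \<and> vcategory B \<and>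
    (\<forall>x \<in> vOb A. Fo x \<in> vOb B) \<and>
    (\<forall>x \<in> vOb A. \<forall>y \<in> vOb A. Fh x y \<in> hom V (vHom A x y) (vHom B (Fo x) (Fo y))) \<and>
    (\<forall>x \<in> vOb A. \<forall>y \<in> vOb A. \<forall>z \<in> vOb A.
       Fh x z \<cdot> vCmp A x y z = vCmp B (Fo x) (Fo y) (Fo z) \<cdot> (Fh y z \<boxtimes> Fh x y)) \<and>
    (\<forall>x \<in> vOb A. Fh x x \<cdot> vIdt A x = vIdt B (Fo x))"

text \<open>The full subcategory, enriched via the internal hom, of objects with duals.\<close>

definition Vc :: "('o, 'o, 'a) vcat" where
  "Vc = \<lparr>vOb = dualizable, vHom = ihom V, vCmp = ihom_cmp, vIdt = ihom_idt\<rparr>"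

text \<open>
  The coend of a two-variable functor, contravariant in the first and covariant in the second
  variable, with values \<open>H a b\<close>. Only its actions
  \<open>P a b : A(a, b) \<otimes> H b a \<rightarrow> H b b\<close> (covariant) and \<open>Q a b : A(a, b) \<otimes> H b a \<rightarrow> H a a\<close>
  (contravariant) enter: the coend is the coequalizer of the two induced morphisms
  from the coproduct of all \<open>A(a, b) \<otimes> H b a\<close> to the coproduct of all \<open>H a a\<close>.
\<close>

definition is_wedge ::
  "('x, 'o, 'a) vcat \<Rightarrow> ('x \<Rightarrow> 'x \<Rightarrow> 'o) \<Rightarrow> ('x \<Rightarrow> 'x \<Rightarrow> 'a) \<Rightarrow> ('x \<Rightarrow> 'x \<Rightarrow> 'a) \<Rightarrow>
   'o \<Rightarrow> ('x \<Rightarrow> 'a) \<Rightarrow> bool" where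
  "is_wedge A H P Q L \<iota> \<longleftrightarrow>
    L \<in> Ob V \<and> (\<forall>a \<in> vOb A. \<iota> a \<in> hom V (H a a) L) \<and>
    (\<forall>a \<in> vOb A. \<forall>b \<in> vOb A. \<iota> b \<cdot> P a b = \<iota> a \<cdot> Q a b)"

definition is_coend ::
  "('x, 'o, 'a) vcat \<Rightarrow> ('x \<Rightarrow> 'x \<Rightarrow> 'o) \<Rightarrow> ('x \<Rightarrow> 'x \<Rightarrow> 'a) \<Rightarrow> ('x \<Rightarrow> 'x \<Rightarrow> 'a) \<Rightarrow>
   'o \<Rightarrow> ('x \<Rightarrow> 'a) \<Rightarrow> bool" where
  "is_coend A H P Q L \<iota> \<longleftrightarrow>
    is_wedge A H P Q L \<iota> \<and>
    (\<forall>L' \<iota>'. is_wedge A H P Q L' \<iota>' \<longrightarrow>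
       (\<exists>!h. h \<in> hom V L L' \<and> (\<forall>a \<in> vOb A. h \<cdot> \<iota> a = \<iota>' a)))"


subsection \<open>The Tannakian adjunction\<close>

text \<open>
  The coend \<open>L(\<omega>)\<close> of \<open>\<omega>(a) \<otimes> \<omega>(b)\<^sup>\<or>\<close> for a functor \<open>\<omega> = (Wo, Wh)\<close> from \<open>A\<close> to \<open>Vc\<close>. The two
  actions on \<open>A(a, b) \<otimes> (\<omega>(a) \<otimes> \<omega>(b)\<^sup>\<or>)\<close>, into \<open>\<omega>(b) \<otimes> \<omega>(b)\<^sup>\<or>\<close> and \<open>\<omega>(a) \<otimes> \<omega>(a)\<^sup>\<or>\<close>, are:
\<close>

definition act_cov ::
  "('x, 'o, 'a) vcat \<Rightarrow> ('x \<Rightarrow> 'o) \<Rightarrow> ('x \<Rightarrow> 'x \<Rightarrow> 'a) \<Rightarrow> 'x \<Rightarrow> 'x \<Rightarrow> 'a" where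
  "act_cov A Wo Wh a b =
     ((\<e> (Wo a) (Wo b) \<cdot> (Wh a b \<boxtimes> \<one> (Wo a))) \<boxtimes> \<one> (dual (Wo b)))
     \<cdot> inv_ar V (\<a> (vHom A a b) (Wo a) (dual (Wo b)))"

definition act_con ::
  "('x, 'o, 'a) vcat \<Rightarrow> ('x \<Rightarrow> 'o) \<Rightarrow> ('x \<Rightarrow> 'x \<Rightarrow> 'a) \<Rightarrow> 'x \<Rightarrow> 'x \<Rightarrow> 'a" where
  "act_con A Wo Wh a b =
     (\<one> (Wo a) \<boxtimes> (dual_act (Wo a) (Wo b) \<cdot> (Wh a b \<boxtimes> \<one> (dual (Wo b)))))
     \<cdot> \<a> (Wo a) (vHom A a b) (dual (Wo b))
     \<cdot> (\<s> (vHom A a b) (Wo a) \<boxtimes> \<one> (dual (Wo b)))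
     \<cdot> inv_ar V (\<a> (vHom A a b) (Wo a) (dual (Wo b)))"

definition is_tannaka_coend ::
  "('x, 'o, 'a) vcat \<Rightarrow> ('x \<Rightarrow> 'o) \<Rightarrow> ('x \<Rightarrow> 'x \<Rightarrow> 'a) \<Rightarrow> 'o \<Rightarrow> ('x \<Rightarrow> 'a) \<Rightarrow> bool" where
  "is_tannaka_coend A Wo Wh =
     is_coend A (\<lambda>b a. Wo a \<otimes> dual (Wo b)) (act_cov A Wo Wh) (act_con A Wo Wh)"

text \<open>\<open>\<pi>\<^sub>a : \<omega>(a) \<rightarrow> L(\<omega>) \<otimes> \<omega>(a)\<close>, induced by the coevaluation.\<close>

definition tannaka_coaction :: "('x \<Rightarrow> 'o) \<Rightarrow> ('x \<Rightarrow> 'a) \<Rightarrow> 'x \<Rightarrow> 'a" where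
  "tannaka_coaction Wo \<iota> a =
     (\<iota> a \<boxtimes> \<one> (Wo a)) \<cdot> inv_ar V (\<a> (Wo a) (dual (Wo a)) (Wo a))
     \<cdot> (\<one> (Wo a) \<boxtimes> coev (Wo a)) \<cdot> inv_ar V (\<r> (Wo a))"

text \<open>
  \<open>(L, \<iota>)\<close> is the comonoid \<open>L(\<omega>)\<close> with its universal wedge. The comonoid structure is uniquely
  determined by the requirement that all \<open>(\<omega>(a), \<pi>\<^sub>a)\<close> be comodules.
\<close>

definition is_tannaka_comonoid ::
  "('x, 'o, 'a) vcat \<Rightarrow> ('x \<Rightarrow> 'o) \<Rightarrow> ('x \<Rightarrow> 'x \<Rightarrow> 'a) \<Rightarrow> ('o, 'a) comon \<Rightarrow> ('x \<Rightarrow> 'a) \<Rightarrow> bool"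
  where
  "is_tannaka_comonoid A Wo Wh L \<iota> \<longleftrightarrow>
     vfunctor A Vc Wo Wh \<and> is_tannaka_coend A Wo Wh (cob L) \<iota> \<and> comonoid L \<and>
     (\<forall>a \<in> vOb A. comodule L (Wo a, tannaka_coaction Wo \<iota> a))"

text \<open>
  \<open>(A, Wh)\<close> is the enriched category with object set \<open>S\<close> of comodules over \<open>T\<close>, together with the
  action of the forgetful functor (which is \<open>fst\<close> on objects) on hom-objects. The hom-object
  inclusions \<open>Wh x y\<close> are equalizers, hence monic, so composition and identities of \<open>A\<close> are
  uniquely determined by the requirement that \<open>(fst, Wh)\<close> be an enriched functor.
\<close>

definition is_comodule_vcat ::
  "('o, 'a) comon \<Rightarrow> ('o \<times> 'a) set \<Rightarrow> ('o \<times> 'a, 'o, 'a) vcat \<Rightarrow>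
   ('o \<times> 'a \<Rightarrow> 'o \<times> 'a \<Rightarrow> 'a) \<Rightarrow> bool" where
  "is_comodule_vcat T S A Wh \<longleftrightarrow>
     vOb A = S \<and> vfunctor A Vc fst Wh \<and>
     (\<forall>(M, \<rho>) \<in> S. \<forall>(M', \<rho>') \<in> S.
        is_equalizer V (ihom_pre \<rho> (cob T \<otimes> M') \<cdot> ihom_tns (cob T) M M') (ihom_post M \<rho>')
          (vHom A (M, \<rho>) (M', \<rho>')) (Wh (M, \<rho>) (M', \<rho>')))"

text \<open>
  The component at \<open>T\<close> of the counit, \<open>L\<close> being \<open>L(\<omega>)\<close> for the forgetful functor \<open>\<omega> = fst\<close>.
  The equation is the triangle identity of the adjunction at \<open>T\<close>: corestriction along \<open>\<nu>\<close> takes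
  \<open>(M, \<pi>)\<close>, the image of \<open>(M, \<rho>)\<close> under the unit, back to \<open>(M, \<rho>)\<close>. There is exactly one such \<open>\<nu>\<close>.
\<close>

definition is_tannaka_counit ::
  "('o, 'a) comon \<Rightarrow> ('o \<times> 'a) set \<Rightarrow> ('o, 'a) comon \<Rightarrow> ('o \<times> 'a \<Rightarrow> 'a) \<Rightarrow> 'a \<Rightarrow> bool" where
  "is_tannaka_counit T S L \<iota> \<nu> \<longleftrightarrow>
     comonoid_morphism L T \<nu> \<and>
     (\<forall>(M, \<rho>) \<in> S. (\<nu> \<boxtimes> \<one> M) \<cdot> tannaka_coaction fst \<iota> (M, \<rho>) = \<rho>)"

end

end

theory Submission
  imports Defs
begin

text \<open>
  Both sides of the equivalence say that \<open>T\<close> is universal for a kind of family of arrows out of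
  Cauchy comodules, and the proof identifies the two kinds of families.

  On the right stands a colimit of comodules. The forgetful functor to \<open>V\<close> has the right adjoint
  \<open>T \<otimes> -\<close>, so it preserves colimits; it also reflects them, because an arrow out of a colimit can be
  tested on the cocone for being a comodule morphism. Hence the tautological cocone is a colimit of
  comodules iff it is one in \<open>V\<close> (\<open>tautological_colimit_Comod_iff\<close>). As \<open>T\<close> is cofree on \<open>\<I>\<close>, a
  comodule morphism \<open>M \<rightarrow> T\<close> is the same thing as a functional \<open>g : M \<rightarrow> \<I>\<close> (\<open>coefficient_map\<close>). A
  cocone with vertex \<open>Z\<close> is therefore a family of arrows \<open>\<gamma>\<^sub>g : M \<rightarrow> Z\<close>, one for every functional on
  every Cauchy comodule \<open>M\<close>, which is compatible with comodule morphisms.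

  On the left stands the coend \<open>L\<close>, which is universal for families \<open>\<kappa>\<^sub>M : M \<otimes> M\<^sup>\<or> \<rightarrow> Z\<close> that are
  dinatural in the enriched sense. Transposing the parameters away turns enriched dinaturality into
  the equations \<open>dinatural_at\<close>, in which a comodule morphism \<open>u : M \<otimes> y \<rightarrow> N\<close> plays the role of an
  arrow from \<open>y\<close> to the hom-object, and a functional on \<open>N \<otimes> z\<close> that of an arrow \<open>z \<rightarrow> N\<^sup>\<or>\<close>
  (\<open>wedge_eq_iff_dinatural_at\<close>).

  A functional on \<open>M\<close> is a global element \<open>\<I> \<rightarrow> M\<^sup>\<or>\<close>, so inserting it into \<open>\<kappa>\<^sub>M\<close> turns a wedge into a
  cocone (\<open>cocone_of_wedge\<close>). A cocone seems to carry less information, since it sees only global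
  elements and ordinary morphisms. The dense generator makes up for this: \<open>M \<otimes> M\<^sup>\<or>\<close> is the colimit
  of the objects \<open>M \<otimes> x\<close> over all \<open>p : x \<rightarrow> M\<^sup>\<or>\<close> with \<open>x\<close> in the generator; each \<open>M \<otimes> x\<close> is again a
  Cauchy comodule, because \<open>x\<close> has a dual; and on it the generalized element \<open>p\<close> has become an
  honest functional. So a cocone determines a wedge (\<open>wedge_of_cocone\<close>), and a wedge is determined
  by its cocone (\<open>wedge_determined_by_functionals\<close>).

  Under this bijection, which is natural in \<open>Z\<close>, the wedge formed by the \<open>\<nu> \<cdot> \<iota> M\<close> corresponds to the
  tautological cocone. Hence \<open>T\<close> is the colimit iff \<open>T\<close> with this wedge is a coend, that is, iff the
  comparison \<open>\<nu>\<close> from the coend \<open>L\<close> is invertible.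
\<close>

section \<open>Calculating in categories and monoidal categories\<close>

context category
begin

text \<open>
  The simplifier decides whether composites make sense by computing domains and codomains, so
  membership in hom-sets is unfolded into statements on \<open>Dom\<close> and \<open>Cod\<close>. Composites are normalized
  by bracketing them to the left.
\<close>

lemma hom_iff: "f \<in> hom C x y \<longleftrightarrow> f \<in> Ar C \<and> Dom C f = x \<and> Cod C f = y"
  by (auto simp: hom_def)

lemma Ob_simps [simp]: "f \<in> Ar C \<Longrightarrow> Dom C f \<in> Ob C" "f \<in> Ar C \<Longrightarrow> Cod C f \<in> Ob C"
  by (auto intro: Dom_Ob Cod_Ob)

lemma Idt_simps [simp]:
  assumes "x \<in> Ob C"
  shows "\<one> x \<in> Ar C" "Dom C (\<one> x) = x" "Cod C (\<one> x) = x"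
  using Idt_hom[OF assms] by (auto simp: hom_def)

lemma Cmp_simps [simp]:
  assumes "f \<in> Ar C" "g \<in> Ar C" "Dom C g = Cod C f"
  shows "g \<cdot> f \<in> Ar C" "Dom C (g \<cdot> f) = Dom C f" "Cod C (g \<cdot> f) = Cod C g"
  using Cmp_hom[of f "Dom C f" "Cod C f" g "Cod C g"] assms by (auto simp: hom_def)

lemma Idt_Cmp [simp]:
  "f \<in> Ar C \<Longrightarrow> Cod C f = x \<Longrightarrow> \<one> x \<cdot> f = f"
  "f \<in> Ar C \<Longrightarrow> Dom C f = x \<Longrightarrow> f \<cdot> \<one> x = f"
  using Idt_left Idt_right by (auto simp: hom_def)

lemma assoc:
  assumes "f \<in> Ar C" "g \<in> Ar C" "h \<in> Ar C" "Dom C g = Cod C f" "Dom C h = Cod C g"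
  shows "h \<cdot> (g \<cdot> f) = h \<cdot> g \<cdot> f"
  using Cmp_assoc[of f "Dom C f" "Cod C f" g "Cod C g" h "Cod C h"] assms
  by (auto simp: hom_def)

lemma inverse_arrows_unique:
  assumes "inverse_arrows C f g" "inverse_arrows C f g'"
  shows "g = g'"
proof -
  note d = assms[unfolded inverse_arrows_def hom_def]
  have "g = g \<cdot> (f \<cdot> g')" using d by simp
  also have "\<dots> = g \<cdot> f \<cdot> g'" using d by (subst assoc) auto
  also have "\<dots> = g'" using d by simp
  finally show ?thesis .
qed

lemma inverse_arrows_inv_ar: "is_iso C f \<Longrightarrow> inverse_arrows C f (inv_ar C f)"
  unfolding is_iso_def inv_ar_def by (metis inverse_arrows_unique theI)

lemma inv_ar_simps:
  assumes "is_iso C f"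
  shows "inv_ar C f \<in> Ar C" "Dom C (inv_ar C f) = Cod C f" "Cod C (inv_ar C f) = Dom C f"
    "inv_ar C f \<cdot> f = \<one> (Dom C f)" "f \<cdot> inv_ar C f = \<one> (Cod C f)"
  using inverse_arrows_inv_ar[OF assms] by (auto simp: inverse_arrows_def hom_def)

lemma iso_Ar: "is_iso C f \<Longrightarrow> f \<in> Ar C"
  by (auto simp: is_iso_def inverse_arrows_def)

lemma iso_epi:
  assumes "is_iso C f" "g \<in> Ar C" "h \<in> Ar C" "Dom C g = Cod C f" "Dom C h = Cod C f"
    "g \<cdot> f = h \<cdot> f"
  shows "g = h"
proof -
  note [simp] = inv_ar_simps[OF assms(1)] iso_Ar[OF assms(1)]
  have "g = g \<cdot> f \<cdot> inv_ar C f" using assms(2-5) by (simp add: assoc[symmetric])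
  also have "\<dots> = h" using assms(2-5) by (simp add: assms(6)) (simp add: assoc[symmetric])
  finally show ?thesis .
qed

lemma iso_mono:
  assumes "is_iso C f" "g \<in> Ar C" "h \<in> Ar C" "Cod C g = Dom C f" "Cod C h = Dom C f"
    "f \<cdot> g = f \<cdot> h"
  shows "g = h"
proof -
  note [simp] = inv_ar_simps[OF assms(1)] iso_Ar[OF assms(1)]
  have "g = inv_ar C f \<cdot> (f \<cdot> g)" using assms(2-5) by (simp add: assoc)
  also have "\<dots> = h" using assms(2-5) by (simp add: assms(6)) (simp add: assoc)
  finally show ?thesis .
qed

end

context symmetric_monoidal_closed
begin

abbreviation assc' :: "'o \<Rightarrow> 'o \<Rightarrow> 'o \<Rightarrow> 'a" ("\<a>''") where "\<a>' x y z \<equiv> inv_ar V (\<a> x y z)"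
abbreviation lunit' :: "'o \<Rightarrow> 'a" ("\<l>''") where "\<l>' x \<equiv> inv_ar V (\<l> x)"
abbreviation runit' :: "'o \<Rightarrow> 'a" ("\<r>''") where "\<r>' x \<equiv> inv_ar V (\<r> x)"

lemmas tns_Ob [simp] unt_Ob [simp] ihom_Ob [simp] tnsa_Idt [simp]
lemmas isos [simp] = assc_iso lunit_iso runit_iso

lemma structure_simps [simp]:
  "x \<in> Ob V \<Longrightarrow> y \<in> Ob V \<Longrightarrow> z \<in> Ob V \<Longrightarrow> \<a> x y z \<in> Ar V"
  "x \<in> Ob V \<Longrightarrow> y \<in> Ob V \<Longrightarrow> z \<in> Ob V \<Longrightarrow> Dom V (\<a> x y z) = x \<otimes> y \<otimes> z"
  "x \<in> Ob V \<Longrightarrow> y \<in> Ob V \<Longrightarrow> z \<in> Ob V \<Longrightarrow> Cod V (\<a> x y z) = x \<otimes> (y \<otimes> z)"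
  "x \<in> Ob V \<Longrightarrow> \<l> x \<in> Ar V" "x \<in> Ob V \<Longrightarrow> Dom V (\<l> x) = \<I> \<otimes> x" "x \<in> Ob V \<Longrightarrow> Cod V (\<l> x) = x"
  "x \<in> Ob V \<Longrightarrow> \<r> x \<in> Ar V" "x \<in> Ob V \<Longrightarrow> Dom V (\<r> x) = x \<otimes> \<I>" "x \<in> Ob V \<Longrightarrow> Cod V (\<r> x) = x"
  "x \<in> Ob V \<Longrightarrow> y \<in> Ob V \<Longrightarrow> \<s> x y \<in> Ar V"
  "x \<in> Ob V \<Longrightarrow> y \<in> Ob V \<Longrightarrow> Dom V (\<s> x y) = x \<otimes> y"
  "x \<in> Ob V \<Longrightarrow> y \<in> Ob V \<Longrightarrow> Cod V (\<s> x y) = y \<otimes> x"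
  "x \<in> Ob V \<Longrightarrow> y \<in> Ob V \<Longrightarrow> \<e> x y \<in> Ar V"
  "x \<in> Ob V \<Longrightarrow> y \<in> Ob V \<Longrightarrow> Dom V (\<e> x y) = (x \<Rrightarrow> y) \<otimes> x"
  "x \<in> Ob V \<Longrightarrow> y \<in> Ob V \<Longrightarrow> Cod V (\<e> x y) = y"
  using assc_hom lunit_hom runit_hom symm_hom ieval_hom by (auto simp: hom_iff)

lemma tnsa_simps [simp]:
  assumes "f \<in> Ar V" "g \<in> Ar V"
  shows "f \<boxtimes> g \<in> Ar V" "Dom V (f \<boxtimes> g) = Dom V f \<otimes> Dom V g" "Cod V (f \<boxtimes> g) = Cod V f \<otimes> Cod V g"
  using tnsa_hom[of f "Dom V f" "Cod V f" g "Dom V g" "Cod V g"] assms by (auto simp: hom_iff)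

lemma inverse_simps [simp]:
  "x \<in> Ob V \<Longrightarrow> y \<in> Ob V \<Longrightarrow> z \<in> Ob V \<Longrightarrow> \<a>' x y z \<in> Ar V"
  "x \<in> Ob V \<Longrightarrow> y \<in> Ob V \<Longrightarrow> z \<in> Ob V \<Longrightarrow> Cod V (\<a>' x y z) = x \<otimes> y \<otimes> z"
  "x \<in> Ob V \<Longrightarrow> y \<in> Ob V \<Longrightarrow> z \<in> Ob V \<Longrightarrow> Dom V (\<a>' x y z) = x \<otimes> (y \<otimes> z)"
  "x \<in> Ob V \<Longrightarrow> \<l>' x \<in> Ar V" "x \<in> Ob V \<Longrightarrow> Cod V (\<l>' x) = \<I> \<otimes> x" "x \<in> Ob V \<Longrightarrow> Dom V (\<l>' x) = x"
  "x \<in> Ob V \<Longrightarrow> \<r>' x \<in> Ar V" "x \<in> Ob V \<Longrightarrow> Cod V (\<r>' x) = x \<otimes> \<I>" "x \<in> Ob V \<Longrightarrow> Dom V (\<r>' x) = x"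
  "x \<in> Ob V \<Longrightarrow> y \<in> Ob V \<Longrightarrow> z \<in> Ob V \<Longrightarrow> \<a>' x y z \<cdot> \<a> x y z = \<one> (x \<otimes> y \<otimes> z)"
  "x \<in> Ob V \<Longrightarrow> y \<in> Ob V \<Longrightarrow> z \<in> Ob V \<Longrightarrow> \<a> x y z \<cdot> \<a>' x y z = \<one> (x \<otimes> (y \<otimes> z))"
  "x \<in> Ob V \<Longrightarrow> \<l>' x \<cdot> \<l> x = \<one> (\<I> \<otimes> x)" "x \<in> Ob V \<Longrightarrow> \<l> x \<cdot> \<l>' x = \<one> x"
  "x \<in> Ob V \<Longrightarrow> \<r>' x \<cdot> \<r> x = \<one> (x \<otimes> \<I>)" "x \<in> Ob V \<Longrightarrow> \<r> x \<cdot> \<r>' x = \<one> x"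
  by (simp_all add: inv_ar_simps)

lemma symm_inverse [simp]: "x \<in> Ob V \<Longrightarrow> y \<in> Ob V \<Longrightarrow> \<s> y x \<cdot> \<s> x y = \<one> (x \<otimes> y)"
  by (rule symm_invol)

lemma cancel [simp]:
  assumes "h \<in> Ar V"
  shows
  "x \<in> Ob V \<Longrightarrow> y \<in> Ob V \<Longrightarrow> z \<in> Ob V \<Longrightarrow> Dom V h = x \<otimes> y \<otimes> z \<Longrightarrow> h \<cdot> \<a>' x y z \<cdot> \<a> x y z = h"
  "x \<in> Ob V \<Longrightarrow> y \<in> Ob V \<Longrightarrow> z \<in> Ob V \<Longrightarrow> Dom V h = x \<otimes> (y \<otimes> z) \<Longrightarrow> h \<cdot> \<a> x y z \<cdot> \<a>' x y z = h"
  "x \<in> Ob V \<Longrightarrow> Dom V h = \<I> \<otimes> x \<Longrightarrow> h \<cdot> \<l>' x \<cdot> \<l> x = h"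
  "x \<in> Ob V \<Longrightarrow> Dom V h = x \<Longrightarrow> h \<cdot> \<l> x \<cdot> \<l>' x = h"
  "x \<in> Ob V \<Longrightarrow> Dom V h = x \<otimes> \<I> \<Longrightarrow> h \<cdot> \<r>' x \<cdot> \<r> x = h"
  "x \<in> Ob V \<Longrightarrow> Dom V h = x \<Longrightarrow> h \<cdot> \<r> x \<cdot> \<r>' x = h"
  "x \<in> Ob V \<Longrightarrow> y \<in> Ob V \<Longrightarrow> Dom V h = x \<otimes> y \<Longrightarrow> h \<cdot> \<s> y x \<cdot> \<s> x y = h"
  using assms by (simp_all add: assoc[symmetric])

text \<open>
  Adjacent tensor products of arrows are always merged. As composites are bracketed to the left, a
  second form is needed for a pair that is preceded by further factors.
\<close>

lemma interchange [simp]: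
  assumes "f \<in> Ar V" "g \<in> Ar V" "f' \<in> Ar V" "g' \<in> Ar V" "Dom V g = Cod V f" "Dom V g' = Cod V f'"
  shows "(g \<boxtimes> g') \<cdot> (f \<boxtimes> f') = (g \<cdot> f) \<boxtimes> (g' \<cdot> f')"
  using tnsa_Cmp[of f "Dom V f" "Cod V f" g "Cod V g" f' "Dom V f'" "Cod V f'" g' "Cod V g'"] assms
  by (auto simp: hom_iff)

lemma interchange_after [simp]:
  assumes "f \<in> Ar V" "g \<in> Ar V" "f' \<in> Ar V" "g' \<in> Ar V" "Dom V g = Cod V f" "Dom V g' = Cod V f'"
    "h \<in> Ar V" "Dom V h = Cod V g \<otimes> Cod V g'"
  shows "h \<cdot> (g \<boxtimes> g') \<cdot> (f \<boxtimes> f') = h \<cdot> ((g \<cdot> f) \<boxtimes> (g' \<cdot> f'))"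
  using assms by (simp add: assoc[symmetric])

lemma assc_natural:
  assumes "f \<in> Ar V" "g \<in> Ar V" "h \<in> Ar V"
    "Cod V f = x'" "Cod V g = y'" "Cod V h = z'"
  shows "\<a> x' y' z' \<cdot> (f \<boxtimes> g \<boxtimes> h) = (f \<boxtimes> (g \<boxtimes> h)) \<cdot> \<a> (Dom V f) (Dom V g) (Dom V h)"
  using assc_nat[of f "Dom V f" "x'" g "Dom V g" "y'" h "Dom V h" "z'"] assms by (auto simp: hom_iff)

lemma assc'_natural:
  assumes "f \<in> Ar V" "g \<in> Ar V" "h \<in> Ar V"
    "Cod V f = x'" "Cod V g = y'" "Cod V h = z'"
  shows "\<a>' x' y' z' \<cdot> (f \<boxtimes> (g \<boxtimes> h)) = (f \<boxtimes> g \<boxtimes> h) \<cdot> \<a>' (Dom V f) (Dom V g) (Dom V h)"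
  by (rule iso_mono[of "\<a> x' y' z'"], use assms in \<open>auto simp: assoc assc_natural\<close>)

lemma lunit_natural:
  assumes "f \<in> Ar V" "Cod V f = y"
  shows "\<l> y \<cdot> (\<one> \<I> \<boxtimes> f) = f \<cdot> \<l> (Dom V f)"
  using lunit_nat[of f "Dom V f" y] assms by (auto simp: hom_iff)

lemma runit_natural:
  assumes "f \<in> Ar V" "Cod V f = y"
  shows "\<r> y \<cdot> (f \<boxtimes> \<one> \<I>) = f \<cdot> \<r> (Dom V f)"
  using runit_nat[of f "Dom V f" y] assms by (auto simp: hom_iff)

lemma lunit'_natural:
  assumes "f \<in> Ar V" "Cod V f = y"
  shows "\<l>' y \<cdot> f = (\<one> \<I> \<boxtimes> f) \<cdot> \<l>' (Dom V f)"
  by (rule iso_mono[of "\<l> y"], use assms in \<open>auto simp: assoc lunit_natural\<close>)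

lemma runit'_natural:
  assumes "f \<in> Ar V" "Cod V f = y"
  shows "\<r>' y \<cdot> f = (f \<boxtimes> \<one> \<I>) \<cdot> \<r>' (Dom V f)"
  by (rule iso_mono[of "\<r> y"], use assms in \<open>auto simp: assoc runit_natural\<close>)

lemma symm_natural:
  assumes "f \<in> Ar V" "g \<in> Ar V" "Cod V f = x'" "Cod V g = y'"
  shows "\<s> x' y' \<cdot> (f \<boxtimes> g) = (g \<boxtimes> f) \<cdot> \<s> (Dom V f) (Dom V g)"
  using symm_nat[of f "Dom V f" x' g "Dom V g" y'] assms by (auto simp: hom_iff)

lemma tnsa_unit_faithful:
  assumes [simp]: "f \<in> Ar V" "g \<in> Ar V" "Dom V f = Dom V g" "Cod V f = Cod V g"
  shows "f \<boxtimes> \<one> \<I> = g \<boxtimes> \<one> \<I> \<Longrightarrow> f = g" "\<one> \<I> \<boxtimes> f = \<one> \<I> \<boxtimes> g \<Longrightarrow> f = g"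
proof -
  assume "f \<boxtimes> \<one> \<I> = g \<boxtimes> \<one> \<I>"
  then have "f \<cdot> \<r> (Dom V g) = g \<cdot> \<r> (Dom V g)"
    using runit_natural[of f "Cod V g"] runit_natural[of g "Cod V g"] by simp
  then show "f = g" by (rule iso_epi[rotated -1]) simp_all
next
  assume "\<one> \<I> \<boxtimes> f = \<one> \<I> \<boxtimes> g"
  then have "f \<cdot> \<l> (Dom V g) = g \<cdot> \<l> (Dom V g)"
    using lunit_natural[of f "Cod V g"] lunit_natural[of g "Cod V g"] by simp
  then show "f = g" by (rule iso_epi[rotated -1]) simp_all
qed

lemma tnsa_iso [simp]:
  assumes "is_iso V f" "is_iso V g"
  shows "is_iso V (f \<boxtimes> g)"
  unfolding is_iso_def inverse_arrows_def
  by (rule exI[of _ "inv_ar V f \<boxtimes> inv_ar V g"])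
     (use assms in \<open>auto simp: inv_ar_simps iso_Ar hom_iff\<close>)

lemma Idt_iso [simp]: "x \<in> Ob V \<Longrightarrow> is_iso V (\<one> x)"
  unfolding is_iso_def inverse_arrows_def
  by (rule exI[of _ "\<one> x"]) (auto simp: hom_iff)

lemma triangle_simp: "x \<in> Ob V \<Longrightarrow> y \<in> Ob V \<Longrightarrow> \<r> x \<boxtimes> \<one> y = \<one> x \<boxtimes> \<l> y \<cdot> \<a> x \<I> y"
  by (rule triangle[symmetric])

lemma triangle_inv:
  assumes [simp]: "x \<in> Ob V" "y \<in> Ob V"
  shows "\<a>' x \<I> y \<cdot> \<one> x \<boxtimes> \<l>' y = \<r>' x \<boxtimes> \<one> y"
proof (rule iso_mono[of "\<r> x \<boxtimes> \<one> y"])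
  have "\<r> x \<boxtimes> \<one> y \<cdot> (\<a>' x \<I> y \<cdot> \<one> x \<boxtimes> \<l>' y)
    = \<one> x \<boxtimes> \<l> y \<cdot> \<one> x \<boxtimes> \<l>' y"
    by (simp add: assoc triangle_simp del: interchange)
  then show "\<r> x \<boxtimes> \<one> y \<cdot> (\<a>' x \<I> y \<cdot> \<one> x \<boxtimes> \<l>' y) = \<r> x \<boxtimes> \<one> y \<cdot> \<r>' x \<boxtimes> \<one> y"
    by simp
qed simp_all

text \<open>
  Two unit coherences that Mac Lane listed as axioms and Kelly derived from the pentagon and the
  triangle. Tensoring with the unit is faithful, so each may be checked after tensoring with \<open>\<I>\<close>;
  there it is the pentagon with two of its objects equal to \<open>\<I>\<close>, the triangle removing the units.
\<close>

lemma runit_tns: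
  assumes [simp]: "x \<in> Ob V" "y \<in> Ob V"
  shows "\<one> x \<boxtimes> \<r> y \<cdot> \<a> x y \<I> = \<r> (x \<otimes> y)"
proof (rule tnsa_unit_faithful(1))
  show "(\<one> x \<boxtimes> \<r> y \<cdot> \<a> x y \<I>) \<boxtimes> \<one> \<I> = \<r> (x \<otimes> y) \<boxtimes> \<one> \<I>"
  proof (rule iso_mono[of "\<a> x y \<I>"])
    have "\<a> x y \<I> \<cdot> ((\<one> x \<boxtimes> \<r> y \<cdot> \<a> x y \<I>) \<boxtimes> \<one> \<I>)
      = \<a> x y \<I> \<cdot> (\<one> x \<boxtimes> \<r> y \<boxtimes> \<one> \<I>) \<cdot> (\<a> x y \<I> \<boxtimes> \<one> \<I>)"
      by simp
    also have "\<dots> = \<one> x \<boxtimes> (\<one> y \<boxtimes> \<l> \<I> \<cdot> \<a> y \<I> \<I>) \<cdot> \<a> x (y \<otimes> \<I>) \<I> \<cdot> (\<a> x y \<I> \<boxtimes> \<one> \<I>)"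
      by (simp add: assc_natural triangle_simp)
    also have "\<dots> = \<one> x \<boxtimes> (\<one> y \<boxtimes> \<l> \<I>) \<cdot> (\<one> x \<boxtimes> \<a> y \<I> \<I> \<cdot> \<a> x (y \<otimes> \<I>) \<I> \<cdot> (\<a> x y \<I> \<boxtimes> \<one> \<I>))"
      by (simp add: assoc)
    also have "\<dots> = \<one> x \<boxtimes> (\<one> y \<boxtimes> \<l> \<I>) \<cdot> \<a> x y (\<I> \<otimes> \<I>) \<cdot> \<a> (x \<otimes> y) \<I> \<I>"
      by (simp add: pentagon[symmetric] assoc)
    also have "\<dots> = \<a> x y \<I> \<cdot> (\<one> x \<boxtimes> \<one> y \<boxtimes> \<l> \<I>) \<cdot> \<a> (x \<otimes> y) \<I> \<I>"
      by (subst assc_natural) simp_all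
    also have "\<dots> = \<a> x y \<I> \<cdot> (\<r> (x \<otimes> y) \<boxtimes> \<one> \<I>)"
      by (simp add: triangle_simp assoc)
    finally show "\<a> x y \<I> \<cdot> ((\<one> x \<boxtimes> \<r> y \<cdot> \<a> x y \<I>) \<boxtimes> \<one> \<I>) = \<a> x y \<I> \<cdot> (\<r> (x \<otimes> y) \<boxtimes> \<one> \<I>)" .
  qed simp_all
qed simp_all

lemma lunit_tns:
  assumes [simp]: "x \<in> Ob V" "y \<in> Ob V"
  shows "\<l> (x \<otimes> y) \<cdot> \<a> \<I> x y = \<l> x \<boxtimes> \<one> y"
proof (rule tnsa_unit_faithful(2))
  show "\<one> \<I> \<boxtimes> (\<l> (x \<otimes> y) \<cdot> \<a> \<I> x y) = \<one> \<I> \<boxtimes> (\<l> x \<boxtimes> \<one> y)"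
  proof (rule iso_epi[of "\<a> \<I> (\<I> \<otimes> x) y"], rule_tac [6] iso_epi[of "\<a> \<I> \<I> x \<boxtimes> \<one> y"])
    have "\<one> \<I> \<boxtimes> (\<l> (x \<otimes> y) \<cdot> \<a> \<I> x y) \<cdot> \<a> \<I> (\<I> \<otimes> x) y \<cdot> (\<a> \<I> \<I> x \<boxtimes> \<one> y)
      = \<one> \<I> \<boxtimes> \<l> (x \<otimes> y) \<cdot> (\<one> \<I> \<boxtimes> \<a> \<I> x y \<cdot> \<a> \<I> (\<I> \<otimes> x) y \<cdot> (\<a> \<I> \<I> x \<boxtimes> \<one> y))"
      by (simp add: assoc)
    also have "\<dots> = (\<one> \<I> \<boxtimes> \<l> (x \<otimes> y) \<cdot> \<a> \<I> \<I> (x \<otimes> y)) \<cdot> \<a> (\<I> \<otimes> \<I>) x y"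
      by (simp add: pentagon[symmetric] assoc)
    also have "\<dots> = (\<r> \<I> \<boxtimes> (\<one> x \<boxtimes> \<one> y)) \<cdot> \<a> (\<I> \<otimes> \<I>) x y"
      by (simp add: triangle_simp)
    also have "\<dots> = \<a> \<I> x y \<cdot> ((\<r> \<I> \<boxtimes> \<one> x) \<boxtimes> \<one> y)"
      by (subst assc_natural) simp_all
    also have "\<dots> = \<a> \<I> x y \<cdot> ((\<one> \<I> \<boxtimes> \<l> x) \<boxtimes> \<one> y) \<cdot> (\<a> \<I> \<I> x \<boxtimes> \<one> y)"
      by (simp add: triangle_simp)
    also have "\<dots> = (\<one> \<I> \<boxtimes> (\<l> x \<boxtimes> \<one> y)) \<cdot> \<a> \<I> (\<I> \<otimes> x) y \<cdot> (\<a> \<I> \<I> x \<boxtimes> \<one> y)"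
      by (subst assc_natural) simp_all
    finally show "\<one> \<I> \<boxtimes> (\<l> (x \<otimes> y) \<cdot> \<a> \<I> x y) \<cdot> \<a> \<I> (\<I> \<otimes> x) y \<cdot> (\<a> \<I> \<I> x \<boxtimes> \<one> y)
      = \<one> \<I> \<boxtimes> (\<l> x \<boxtimes> \<one> y) \<cdot> \<a> \<I> (\<I> \<otimes> x) y \<cdot> (\<a> \<I> \<I> x \<boxtimes> \<one> y)" .
  qed simp_all
qed simp_all

lemma lunit_unit: "\<l> \<I> = \<r> \<I>"
proof (rule tnsa_unit_faithful(1))
  have "\<l> (\<I> \<otimes> \<I>) = \<one> \<I> \<boxtimes> \<l> \<I>"
    by (rule iso_mono[of "\<l> \<I>"]) (simp_all add: lunit_natural)
  then show "\<l> \<I> \<boxtimes> \<one> \<I> = \<r> \<I> \<boxtimes> \<one> \<I>"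
    by (simp add: triangle_simp lunit_tns[symmetric])
qed simp_all

text \<open>
  Naturality squares whose corners are read off from the arrows; instantiating these leaves no
  schematic objects behind.
\<close>

lemmas assc_at = assc_natural[OF _ _ _ refl refl refl]
lemmas assc'_at = assc'_natural[OF _ _ _ refl refl refl]
lemmas lunit'_at = lunit'_natural[OF _ refl]
lemmas symm_at = symm_natural[OF _ _ refl refl]

lemma pentagon_inv1:
  assumes [simp]: "w \<in> Ob V" "x \<in> Ob V" "y \<in> Ob V" "z \<in> Ob V"
  shows "\<a>' w x (y \<otimes> z) \<cdot> \<one> w \<boxtimes> \<a> x y z = \<a> (w \<otimes> x) y z \<cdot> \<a>' w x y \<boxtimes> \<one> z \<cdot> \<a>' w (x \<otimes> y) z"
  by (rule iso_mono[of "\<a> w x (y \<otimes> z)"]) (simp_all add: assoc pentagon)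

lemma pentagon_inv2:
  assumes [simp]: "w \<in> Ob V" "x \<in> Ob V" "y \<in> Ob V" "z \<in> Ob V"
  shows "\<one> w \<boxtimes> \<a>' x y z \<cdot> \<a> w x (y \<otimes> z) = \<a> w (x \<otimes> y) z \<cdot> \<a> w x y \<boxtimes> \<one> z \<cdot> \<a>' (w \<otimes> x) y z"
proof (rule iso_epi[of "\<a> (w \<otimes> x) y z"])
  have "\<one> w \<boxtimes> \<a>' x y z \<cdot> \<a> w x (y \<otimes> z) \<cdot> \<a> (w \<otimes> x) y z
    = \<one> w \<boxtimes> \<a>' x y z \<cdot> (\<a> w x (y \<otimes> z) \<cdot> \<a> (w \<otimes> x) y z)" by (simp add: assoc)
  also have "\<dots> = \<a> w (x \<otimes> y) z \<cdot> \<a> w x y \<boxtimes> \<one> z" unfolding pentagon[OF assms] by (simp add: assoc)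
  finally show "\<one> w \<boxtimes> \<a>' x y z \<cdot> \<a> w x (y \<otimes> z) \<cdot> \<a> (w \<otimes> x) y z =
    \<a> w (x \<otimes> y) z \<cdot> \<a> w x y \<boxtimes> \<one> z \<cdot> \<a>' (w \<otimes> x) y z \<cdot> \<a> (w \<otimes> x) y z" by simp
qed simp_all

lemma lunit_tns_inv:
  assumes [simp]: "x \<in> Ob V" "y \<in> Ob V"
  shows "\<a>' \<I> x y \<cdot> \<l>' (x \<otimes> y) = \<l>' x \<boxtimes> \<one> y"
proof (rule iso_mono[of "\<l> x \<boxtimes> \<one> y"])
  have "\<l> x \<boxtimes> \<one> y \<cdot> (\<a>' \<I> x y \<cdot> \<l>' (x \<otimes> y)) = \<one> (x \<otimes> y)"
    by (simp add: assoc lunit_tns[symmetric])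
  then show "\<l> x \<boxtimes> \<one> y \<cdot> (\<a>' \<I> x y \<cdot> \<l>' (x \<otimes> y)) = \<l> x \<boxtimes> \<one> y \<cdot> \<l>' x \<boxtimes> \<one> y" by simp
qed simp_all

lemma runit_tns_inv:
  assumes [simp]: "x \<in> Ob V" "y \<in> Ob V"
  shows "\<r> (x \<otimes> y) \<cdot> \<a>' x y \<I> = \<one> x \<boxtimes> \<r> y"
  by (simp add: runit_tns[symmetric])

section \<open>Duals and the bijections they induce\<close>

text \<open>
  For a dual \<open>N\<close> of \<open>M\<close> the functor \<open>M \<otimes> -\<close> is left adjoint to \<open>N \<otimes> -\<close>. The two directions of the
  bijection between arrows \<open>z \<rightarrow> N \<otimes> w\<close> and \<open>M \<otimes> z \<rightarrow> w\<close>: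
\<close>

definition bend :: "'o \<Rightarrow> 'o \<Rightarrow> 'a \<Rightarrow> 'o \<Rightarrow> 'a \<Rightarrow> 'a" where
  "bend M N \<epsilon> w f = \<l> w \<cdot> \<epsilon> \<boxtimes> \<one> w \<cdot> \<a>' M N w \<cdot> \<one> M \<boxtimes> f"

definition unbend :: "'o \<Rightarrow> 'o \<Rightarrow> 'a \<Rightarrow> 'o \<Rightarrow> 'a \<Rightarrow> 'a" where
  "unbend M N \<eta> z g = \<one> N \<boxtimes> g \<cdot> \<a> N M z \<cdot> \<eta> \<boxtimes> \<one> z \<cdot> \<l>' z"

lemma unbend_simps [simp]:
  assumes "g \<in> Ar V" "Dom V g = M \<otimes> z" "\<eta> \<in> Ar V" "Dom V \<eta> = \<I>" "Cod V \<eta> = N \<otimes> M"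
    "M \<in> Ob V" "N \<in> Ob V" "z \<in> Ob V"
  shows "unbend M N \<eta> z g \<in> Ar V" "Dom V (unbend M N \<eta> z g) = z"
    "Cod V (unbend M N \<eta> z g) = N \<otimes> Cod V g"
  using assms by (simp_all add: unbend_def)

lemma bend_simps [simp]:
  assumes "f \<in> Ar V" "Cod V f = N \<otimes> w" "\<epsilon> \<in> Ar V" "Cod V \<epsilon> = \<I>" "Dom V \<epsilon> = M \<otimes> N"
    "M \<in> Ob V" "N \<in> Ob V" "w \<in> Ob V"
  shows "bend M N \<epsilon> w f \<in> Ar V" "Dom V (bend M N \<epsilon> w f) = M \<otimes> Dom V f"
    "Cod V (bend M N \<epsilon> w f) = w"
  using assms by (simp_all add: bend_def)

lemma bend_natural:
  assumes [simp]: "\<epsilon> \<in> Ar V" "Cod V \<epsilon> = \<I>" "Dom V \<epsilon> = M \<otimes> N" "M \<in> Ob V" "N \<in> Ob V"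
    "f \<in> Ar V" "Cod V f = N \<otimes> Dom V g" "g \<in> Ar V"
  shows "bend M N \<epsilon> (Cod V g) (\<one> N \<boxtimes> g \<cdot> f) = g \<cdot> bend M N \<epsilon> (Dom V g) f"
proof -
  let ?v = "Dom V g" and ?w = "Cod V g"
  have "bend M N \<epsilon> ?w (\<one> N \<boxtimes> g \<cdot> f)
    = \<l> ?w \<cdot> \<epsilon> \<boxtimes> \<one> ?w \<cdot> (\<a>' M N ?w \<cdot> \<one> M \<boxtimes> (\<one> N \<boxtimes> g)) \<cdot> \<one> M \<boxtimes> f"
    by (simp add: bend_def assoc)
  also have "\<dots> = (\<l> ?w \<cdot> (\<one> \<I> \<boxtimes> g)) \<cdot> \<epsilon> \<boxtimes> \<one> ?v \<cdot> \<a>' M N ?v \<cdot> \<one> M \<boxtimes> f"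
    by (simp add: assc'_natural assoc)
  also have "\<dots> = g \<cdot> bend M N \<epsilon> ?v f"
    by (simp add: lunit_natural) (simp add: bend_def assoc)
  finally show ?thesis .
qed

text \<open>
  Stated from the first triangle identity alone, so that \<open>dualizableI\<close> can use it to establish the
  second one.
\<close>

lemma bend_coevaluation:
  assumes [simp]: "M \<in> Ob V" "N \<in> Ob V" "\<eta> \<in> Ar V" "Dom V \<eta> = \<I>" "Cod V \<eta> = N \<otimes> M"
      "\<epsilon> \<in> Ar V" "Dom V \<epsilon> = M \<otimes> N" "Cod V \<epsilon> = \<I>" "z \<in> Ob V"
    and zigzag: "\<l> M \<cdot> \<epsilon> \<boxtimes> \<one> M \<cdot> \<a>' M N M \<cdot> \<one> M \<boxtimes> \<eta> \<cdot> \<r>' M = \<one> M"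
  shows "bend M N \<epsilon> (M \<otimes> z) (\<a> N M z \<cdot> \<eta> \<boxtimes> \<one> z \<cdot> \<l>' z) = \<one> (M \<otimes> z)"
proof -
  have "bend M N \<epsilon> (M \<otimes> z) (\<a> N M z \<cdot> \<eta> \<boxtimes> \<one> z \<cdot> \<l>' z)
    = \<l> (M \<otimes> z) \<cdot> \<epsilon> \<boxtimes> \<one> (M \<otimes> z) \<cdot> (\<a>' M N (M \<otimes> z) \<cdot> \<one> M \<boxtimes> \<a> N M z) \<cdot> \<one> M \<boxtimes> (\<eta> \<boxtimes> \<one> z \<cdot> \<l>' z)"
    by (simp add: bend_def assoc)
  also have "\<dots> = \<l> (M \<otimes> z) \<cdot> (\<epsilon> \<boxtimes> (\<one> M \<boxtimes> \<one> z) \<cdot> \<a> (M \<otimes> N) M z) \<cdot> \<a>' M N M \<boxtimes> \<one> z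
      \<cdot> (\<a>' M (N \<otimes> M) z \<cdot> \<one> M \<boxtimes> (\<eta> \<boxtimes> \<one> z)) \<cdot> \<one> M \<boxtimes> \<l>' z"
    by (subst pentagon_inv1) (simp_all add: assoc)
  also have "\<dots> = (\<l> (M \<otimes> z) \<cdot> \<a> \<I> M z) \<cdot> (\<epsilon> \<boxtimes> \<one> M) \<boxtimes> \<one> z \<cdot> \<a>' M N M \<boxtimes> \<one> z
      \<cdot> (\<one> M \<boxtimes> \<eta>) \<boxtimes> \<one> z \<cdot> (\<a>' M \<I> z \<cdot> \<one> M \<boxtimes> \<l>' z)"
    by (subst assc'_natural, simp_all, subst assc_at[of \<epsilon> "\<one> M" "\<one> z", simplified, symmetric])
       (simp_all add: assoc)
  also have "\<dots> = (\<l> M \<cdot> \<epsilon> \<boxtimes> \<one> M \<cdot> \<a>' M N M \<cdot> \<one> M \<boxtimes> \<eta> \<cdot> \<r>' M) \<boxtimes> \<one> z"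
    by (subst lunit_tns, simp, simp, subst triangle_inv) simp_all
  also have "\<dots> = \<one> (M \<otimes> z)" by (simp add: zigzag)
  finally show ?thesis .
qed

context
  fixes M N \<eta> \<epsilon>
  assumes dual: "is_dual V M N \<eta> \<epsilon>"
begin

lemma dual_simps:
  "M \<in> Ob V" "N \<in> Ob V" "\<eta> \<in> Ar V" "Dom V \<eta> = \<I>" "Cod V \<eta> = N \<otimes> M"
  "\<epsilon> \<in> Ar V" "Dom V \<epsilon> = M \<otimes> N" "Cod V \<epsilon> = \<I>"
  using dual by (auto simp: is_dual_def hom_iff)

lemma zigzag1: "\<l> M \<cdot> \<epsilon> \<boxtimes> \<one> M \<cdot> \<a>' M N M \<cdot> \<one> M \<boxtimes> \<eta> \<cdot> \<r>' M = \<one> M"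
  using dual by (auto simp: is_dual_def)

lemma zigzag2: "\<r> N \<cdot> \<one> N \<boxtimes> \<epsilon> \<cdot> \<a> N M N \<cdot> \<eta> \<boxtimes> \<one> N \<cdot> \<l>' N = \<one> N"
  using dual by (auto simp: is_dual_def)

lemma bend_unbend:
  assumes [simp]: "g \<in> Ar V" "Dom V g = M \<otimes> z" "z \<in> Ob V"
  shows "bend M N \<epsilon> (Cod V g) (unbend M N \<eta> z g) = g"
proof -
  note [simp] = dual_simps
  \<comment> \<open>By naturality the case of an identity \<open>g\<close> suffices.\<close>
  have K: "bend M N \<epsilon> (M \<otimes> z) (\<a> N M z \<cdot> \<eta> \<boxtimes> \<one> z \<cdot> \<l>' z) = \<one> (M \<otimes> z)"
    by (rule bend_coevaluation) (simp_all add: zigzag1)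
  have "bend M N \<epsilon> (Cod V g) (unbend M N \<eta> z g)
    = bend M N \<epsilon> (Cod V g) (\<one> N \<boxtimes> g \<cdot> (\<a> N M z \<cdot> \<eta> \<boxtimes> \<one> z \<cdot> \<l>' z))"
    by (simp add: unbend_def assoc)
  also have "\<dots> = g"
    by (subst bend_natural) (simp_all add: K)
  finally show ?thesis .
qed

lemma unbend_bend:
  assumes [simp]: "f \<in> Ar V" "Cod V f = N \<otimes> w" "w \<in> Ob V"
  shows "unbend M N \<eta> (Dom V f) (bend M N \<epsilon> w f) = f"
proof -
  note [simp] = dual_simps
  let ?z = "Dom V f"
  have "unbend M N \<eta> ?z (bend M N \<epsilon> w f)
    = \<one> N \<boxtimes> (\<l> w \<cdot> \<epsilon> \<boxtimes> \<one> w \<cdot> \<a>' M N w) \<cdot> (\<one> N \<boxtimes> (\<one> M \<boxtimes> f) \<cdot> \<a> N M ?z) \<cdot> \<eta> \<boxtimes> \<one> ?z \<cdot> \<l>' ?z"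
    by (simp add: unbend_def bend_def assoc)
  also have "\<dots> = \<one> N \<boxtimes> (\<l> w \<cdot> \<epsilon> \<boxtimes> \<one> w \<cdot> \<a>' M N w) \<cdot> \<a> N M (N \<otimes> w) \<cdot> \<eta> \<boxtimes> \<one> (N \<otimes> w) \<cdot> (\<one> \<I> \<boxtimes> f \<cdot> \<l>' ?z)"
    by (subst assc_at[of "\<one> N" "\<one> M" f, simplified, symmetric]) (simp_all add: assoc)
  also have "\<dots> = \<one> N \<boxtimes> \<l> w \<cdot> \<one> N \<boxtimes> (\<epsilon> \<boxtimes> \<one> w) \<cdot> (\<one> N \<boxtimes> \<a>' M N w \<cdot> \<a> N M (N \<otimes> w))
       \<cdot> \<eta> \<boxtimes> \<one> (N \<otimes> w) \<cdot> \<l>' (N \<otimes> w) \<cdot> f"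
    by (subst lunit'_at[of f, simplified, symmetric]) (simp_all add: assoc)
  also have "\<dots> = \<one> N \<boxtimes> \<l> w \<cdot> (\<one> N \<boxtimes> (\<epsilon> \<boxtimes> \<one> w) \<cdot> \<a> N (M \<otimes> N) w) \<cdot> \<a> N M N \<boxtimes> \<one> w
      \<cdot> (\<a>' (N \<otimes> M) N w \<cdot> \<eta> \<boxtimes> (\<one> N \<boxtimes> \<one> w)) \<cdot> \<l>' (N \<otimes> w) \<cdot> f"
    unfolding pentagon_inv2[OF dual_simps(2,1,2) assms(3)] by (simp add: assoc)
  also have "\<dots> = (\<one> N \<boxtimes> \<l> w \<cdot> \<a> N \<I> w) \<cdot> (\<one> N \<boxtimes> \<epsilon>) \<boxtimes> \<one> w \<cdot> \<a> N M N \<boxtimes> \<one> w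
      \<cdot> (\<eta> \<boxtimes> \<one> N) \<boxtimes> \<one> w \<cdot> (\<a>' \<I> N w \<cdot> \<l>' (N \<otimes> w)) \<cdot> f"
    by (subst assc'_natural, simp_all, subst assc_at[of "\<one> N" \<epsilon> "\<one> w", simplified, symmetric])
       (simp_all add: assoc)
  also have "\<dots> = (\<r> N \<cdot> \<one> N \<boxtimes> \<epsilon> \<cdot> \<a> N M N \<cdot> \<eta> \<boxtimes> \<one> N \<cdot> \<l>' N) \<boxtimes> \<one> w \<cdot> f"
    unfolding triangle[OF dual_simps(2) assms(3)] lunit_tns_inv[OF dual_simps(2) assms(3)]
    by simp
  also have "\<dots> = f" by (simp add: zigzag2)
  finally show ?thesis .
qed

end

lemma bend_runit':
  assumes [simp]: "M \<in> Ob V" "N \<in> Ob V" "\<epsilon> \<in> Ar V" "Dom V \<epsilon> = M \<otimes> N" "Cod V \<epsilon> = \<I>"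
    and p [simp]: "p \<in> Ar V" "Cod V p = N"
  shows "bend M N \<epsilon> \<I> (\<r>' N \<cdot> p) = \<epsilon> \<cdot> \<one> M \<boxtimes> p"
proof -
  have "bend M N \<epsilon> \<I> (\<r>' N \<cdot> p) = (\<r> \<I> \<cdot> \<epsilon> \<boxtimes> \<one> \<I>) \<cdot> \<a>' M N \<I> \<cdot> \<one> M \<boxtimes> (\<r>' N \<cdot> p)"
    by (simp add: bend_def lunit_unit)
  also have "\<dots> = \<epsilon> \<cdot> (\<r> (M \<otimes> N) \<cdot> \<a>' M N \<I>) \<cdot> \<one> M \<boxtimes> (\<r>' N \<cdot> p)"
    by (simp add: runit_natural assoc)
  also have "\<dots> = \<epsilon> \<cdot> \<one> M \<boxtimes> p"
    by (simp add: runit_tns_inv assoc)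
  finally show ?thesis .
qed

text \<open>
  Duality from a universal property. The counit \<open>\<epsilon>\<close> alone defines \<open>bend\<close>; an \<open>\<eta>\<close> that bends to the
  right unit satisfies the first triangle identity, and after bending, the second identity becomes
  \<open>\<epsilon> = \<epsilon>\<close>, so injectivity of bending finishes. This avoids a direct verification of the triangle
  identities for composite duals.
\<close>

lemma dualizableI:
  assumes [simp]: "M \<in> Ob V" "N \<in> Ob V" "\<epsilon> \<in> Ar V" "Dom V \<epsilon> = M \<otimes> N" "Cod V \<epsilon> = \<I>"
      "\<eta> \<in> Ar V" "Dom V \<eta> = \<I>" "Cod V \<eta> = N \<otimes> M"
    and coev: "bend M N \<epsilon> M \<eta> = \<r> M"
    and inj: "\<And>f g. f \<in> hom V N (N \<otimes> \<I>) \<Longrightarrow> g \<in> hom V N (N \<otimes> \<I>) \<Longrightarrow>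
      bend M N \<epsilon> \<I> f = bend M N \<epsilon> \<I> g \<Longrightarrow> f = g"
  shows "M \<in> dualizable V"
proof -
  have zigzag: "\<l> M \<cdot> \<epsilon> \<boxtimes> \<one> M \<cdot> \<a>' M N M \<cdot> \<one> M \<boxtimes> \<eta> \<cdot> \<r>' M = \<one> M"
    using coev by (simp add: bend_def)
  let ?f = "\<a> N M N \<cdot> \<eta> \<boxtimes> \<one> N \<cdot> \<l>' N"
  have "bend M N \<epsilon> \<I> (\<one> N \<boxtimes> \<epsilon> \<cdot> ?f) = \<epsilon> \<cdot> bend M N \<epsilon> (M \<otimes> N) ?f"
    using bend_natural[of \<epsilon> M N ?f \<epsilon>] by simp
  also have "\<dots> = \<epsilon>" using zigzag by (simp add: bend_coevaluation)
  also have "\<dots> = bend M N \<epsilon> \<I> (\<r>' N)" using bend_runit'[of M N \<epsilon> "\<one> N"] by simp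
  finally have "\<one> N \<boxtimes> \<epsilon> \<cdot> ?f = \<r>' N" by (rule inj[rotated -1]) (simp_all add: hom_iff)
  then have "\<r> N \<cdot> (\<one> N \<boxtimes> \<epsilon> \<cdot> ?f) = \<one> N" by simp
  then have "is_dual V M N \<eta> \<epsilon>"
    unfolding is_dual_def using zigzag by (simp add: hom_iff assoc)
  then show ?thesis by (auto simp: dualizable_def)
qed

text \<open>
  The dual is \<open>Z\<^sup>\<or> \<otimes> M\<^sup>\<or>\<close>, because adjunctions compose.
\<close>

lemma dualizable_tns:
  assumes "M \<in> dualizable V" "Z \<in> dualizable V"
  shows "M \<otimes> Z \<in> dualizable V"
proof -
  obtain M' \<eta> \<epsilon> Z' \<zeta> \<xi> where dM: "is_dual V M M' \<eta> \<epsilon>" and dZ: "is_dual V Z Z' \<zeta> \<xi>"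
    using assms by (auto simp: dualizable_def)
  note [simp] = dual_simps[OF dM] dual_simps[OF dZ]
  let ?N = "Z' \<otimes> M'"
  define X where "X = \<l> M' \<cdot> \<xi> \<boxtimes> \<one> M' \<cdot> \<a>' Z Z' M'"
  have X [simp]: "X \<in> Ar V" "Dom V X = Z \<otimes> ?N" "Cod V X = M'" by (simp_all add: X_def)
  define \<theta> where "\<theta> = \<epsilon> \<cdot> \<one> M \<boxtimes> X \<cdot> \<a> M Z ?N"
  have \<theta> [simp]: "\<theta> \<in> Ar V" "Dom V \<theta> = M \<otimes> Z \<otimes> ?N" "Cod V \<theta> = \<I>" by (simp_all add: \<theta>_def)
  \<comment> \<open>Bending around \<open>M \<otimes> Z\<close> is bending around \<open>Z\<close> and then around \<open>M\<close>.\<close>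
  have bend: "bend (M \<otimes> Z) ?N \<theta> w f = bend M M' \<epsilon> w (bend Z Z' \<xi> (M' \<otimes> w) (\<a> Z' M' w \<cdot> f)) \<cdot> \<a> M Z y"
    if f [simp]: "f \<in> Ar V" "Dom V f = y" "Cod V f = ?N \<otimes> w" and w [simp]: "w \<in> Ob V" for f y w
  proof -
    have [simp]: "y \<in> Ob V" using Ob_simps(1)[OF f(1)] unfolding f(2) .
    have "bend Z Z' \<xi> (M' \<otimes> w) (\<a> Z' M' w \<cdot> f)
      = \<l> (M' \<otimes> w) \<cdot> \<xi> \<boxtimes> \<one> (M' \<otimes> w) \<cdot> (\<a>' Z Z' (M' \<otimes> w) \<cdot> \<one> Z \<boxtimes> \<a> Z' M' w) \<cdot> \<one> Z \<boxtimes> f"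
      by (simp add: bend_def assoc)
    also have "\<dots> = \<l> (M' \<otimes> w) \<cdot> (\<xi> \<boxtimes> \<one> (M' \<otimes> w) \<cdot> \<a> (Z \<otimes> Z') M' w)
        \<cdot> \<a>' Z Z' M' \<boxtimes> \<one> w \<cdot> \<a>' Z ?N w \<cdot> \<one> Z \<boxtimes> f"
      by (subst pentagon_inv1) (simp_all add: assoc)
    also have "\<dots> = (\<l> (M' \<otimes> w) \<cdot> \<a> \<I> M' w) \<cdot> (\<xi> \<boxtimes> \<one> M') \<boxtimes> \<one> w
        \<cdot> \<a>' Z Z' M' \<boxtimes> \<one> w \<cdot> \<a>' Z ?N w \<cdot> \<one> Z \<boxtimes> f"
      by (subst assc_at[of \<xi> "\<one> M'" "\<one> w", simplified, symmetric]) (simp_all add: assoc)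
    also have "\<dots> = X \<boxtimes> \<one> w \<cdot> \<a>' Z ?N w \<cdot> \<one> Z \<boxtimes> f"
      by (subst lunit_tns) (simp_all add: X_def)
    finally have "bend M M' \<epsilon> w (bend Z Z' \<xi> (M' \<otimes> w) (\<a> Z' M' w \<cdot> f)) \<cdot> \<a> M Z y
      = \<l> w \<cdot> \<epsilon> \<boxtimes> \<one> w \<cdot> (\<a>' M M' w \<cdot> \<one> M \<boxtimes> (X \<boxtimes> \<one> w))
         \<cdot> \<one> M \<boxtimes> \<a>' Z ?N w \<cdot> (\<one> M \<boxtimes> (\<one> Z \<boxtimes> f) \<cdot> \<a> M Z y)"
      by (simp add: bend_def assoc)
    also have "\<dots> = \<l> w \<cdot> \<epsilon> \<boxtimes> \<one> w \<cdot> (\<one> M \<boxtimes> X) \<boxtimes> \<one> w \<cdot> \<a>' M (Z \<otimes> ?N) w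
         \<cdot> (\<one> M \<boxtimes> \<a>' Z ?N w \<cdot> \<a> M Z (?N \<otimes> w)) \<cdot> \<one> (M \<otimes> Z) \<boxtimes> f"
      by (subst assc_at[of "\<one> M" "\<one> Z" f, simplified, symmetric], subst assc'_at[of "\<one> M" X "\<one> w", simplified])
         (simp_all add: assoc)
    also have "\<dots> = bend (M \<otimes> Z) ?N \<theta> w f"
      by (subst pentagon_inv2) (simp_all add: assoc bend_def \<theta>_def)
    finally show ?thesis by simp
  qed
  \<comment> \<open>The unit is obtained by unbending the right unit twice.\<close>
  let ?\<eta> = "\<a>' Z' M' (M \<otimes> Z) \<cdot> unbend Z Z' \<zeta> \<I> (unbend M M' \<eta> (Z \<otimes> \<I>) (\<r> (M \<otimes> Z) \<cdot> \<a>' M Z \<I>))"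
  have 1: "bend M M' \<epsilon> (M \<otimes> Z) (unbend M M' \<eta> (Z \<otimes> \<I>) (\<r> (M \<otimes> Z) \<cdot> \<a>' M Z \<I>)) = \<r> (M \<otimes> Z) \<cdot> \<a>' M Z \<I>"
    using bend_unbend[OF dM, of "\<r> (M \<otimes> Z) \<cdot> \<a>' M Z \<I>" "Z \<otimes> \<I>"] by simp
  have 2: "bend Z Z' \<xi> (M' \<otimes> (M \<otimes> Z)) (unbend Z Z' \<zeta> \<I> (unbend M M' \<eta> (Z \<otimes> \<I>) (\<r> (M \<otimes> Z) \<cdot> \<a>' M Z \<I>)))
     = unbend M M' \<eta> (Z \<otimes> \<I>) (\<r> (M \<otimes> Z) \<cdot> \<a>' M Z \<I>)"
    using bend_unbend[OF dZ, of "unbend M M' \<eta> (Z \<otimes> \<I>) (\<r> (M \<otimes> Z) \<cdot> \<a>' M Z \<I>)" "\<I>"] by simp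
  show ?thesis
  proof (rule dualizableI[of _ ?N \<theta> ?\<eta>])
    show "bend (M \<otimes> Z) ?N \<theta> (M \<otimes> Z) ?\<eta> = \<r> (M \<otimes> Z)"
      by (subst bend[of _ \<I>]) (simp_all add: assoc 1 2)
  next
    fix f g assume h: "f \<in> hom V ?N (?N \<otimes> \<I>)" "g \<in> hom V ?N (?N \<otimes> \<I>)"
      and eq: "bend (M \<otimes> Z) ?N \<theta> \<I> f = bend (M \<otimes> Z) ?N \<theta> \<I> g"
    note [simp] = h[unfolded hom_iff]
    let ?b = "\<lambda>f. bend Z Z' \<xi> (M' \<otimes> \<I>) (\<a> Z' M' \<I> \<cdot> f)"
    have "bend M M' \<epsilon> \<I> (?b f) \<cdot> \<a> M Z ?N = bend M M' \<epsilon> \<I> (?b g) \<cdot> \<a> M Z ?N"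
      using eq by (simp add: bend[of _ ?N])
    then have "bend M M' \<epsilon> \<I> (?b f) = bend M M' \<epsilon> \<I> (?b g)"
      by (rule iso_epi[rotated -1]) simp_all
    then have "?b f = ?b g"
      using unbend_bend[OF dM, of "?b f" \<I>] unbend_bend[OF dM, of "?b g" \<I>] by simp
    then have "\<a> Z' M' \<I> \<cdot> f = \<a> Z' M' \<I> \<cdot> g"
      using unbend_bend[OF dZ, of "\<a> Z' M' \<I> \<cdot> f" "M' \<otimes> \<I>"] unbend_bend[OF dZ, of "\<a> Z' M' \<I> \<cdot> g" "M' \<otimes> \<I>"]
      by simp
    then show "f = g" by (rule iso_mono[rotated -1]) simp_all
  qed (simp_all)
qed

lemma is_dual_dual:
  assumes "M \<in> dualizable V"
  shows "is_dual V M (dual V M) (coev V M) (evd V M)"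
proof -
  obtain N \<eta> \<epsilon> where "is_dual V M N \<eta> \<epsilon>" using assms by (auto simp: dualizable_def)
  then have "case dual_data V M of (N, \<eta>, \<epsilon>) \<Rightarrow> is_dual V M N \<eta> \<epsilon>"
    unfolding dual_data_def
    using someI[where P = "\<lambda>(N, \<eta>, \<epsilon>). is_dual V M N \<eta> \<epsilon>" and x = "(N, \<eta>, \<epsilon>)"] by simp
  then show ?thesis by (auto simp: dual_def coev_def evd_def split: prod.splits)
qed

text \<open>
  The arrow \<open>z \<rightarrow> M\<^sup>\<or>\<close> that corresponds to the pairing \<open>q : M \<otimes> z \<rightarrow> \<I>\<close>.
\<close>

definition transpose :: "'o \<Rightarrow> 'o \<Rightarrow> 'a \<Rightarrow> 'a" where
  "transpose M z q = \<r> (dual V M) \<cdot> unbend M (dual V M) (coev V M) z q"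

context
  fixes M
  assumes M: "M \<in> dualizable V"
begin

lemmas dual_data_simps = dual_simps[OF is_dual_dual[OF M]]

lemma transpose_simps [simp]:
  assumes "q \<in> Ar V" "Dom V q = M \<otimes> z" "Cod V q = \<I>" "z \<in> Ob V"
  shows "transpose M z q \<in> Ar V" "Dom V (transpose M z q) = z" "Cod V (transpose M z q) = dual V M"
  using assms dual_data_simps by (simp_all add: transpose_def)

lemma evd_transpose:
  assumes [simp]: "q \<in> Ar V" "Dom V q = M \<otimes> z" "Cod V q = \<I>" "z \<in> Ob V"
  shows "evd V M \<cdot> \<one> M \<boxtimes> transpose M z q = q"
proof -
  note [simp] = dual_data_simps
  let ?u = "unbend M (dual V M) (coev V M) z q"
  have "evd V M \<cdot> \<one> M \<boxtimes> transpose M z q = bend M (dual V M) (evd V M) \<I> (\<r>' (dual V M) \<cdot> (\<r> (dual V M) \<cdot> ?u))"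
    by (subst bend_runit') (simp_all add: transpose_def)
  also have "\<dots> = bend M (dual V M) (evd V M) (Cod V q) ?u"
    by (simp add: assoc)
  also have "\<dots> = q" by (rule bend_unbend[OF is_dual_dual[OF M]]) simp_all
  finally show ?thesis .
qed

lemma transpose_evd:
  assumes [simp]: "p \<in> Ar V" "Cod V p = dual V M"
  shows "transpose M (Dom V p) (evd V M \<cdot> \<one> M \<boxtimes> p) = p"
  using unbend_bend[OF is_dual_dual[OF M], of "\<r>' (dual V M) \<cdot> p" \<I>] dual_data_simps
  by (simp add: transpose_def bend_runit' assoc)

lemma transpose_natural:
  assumes [simp]: "q \<in> Ar V" "Dom V q = M \<otimes> z" "Cod V q = \<I>" "f \<in> Ar V" "Cod V f = z" "Dom V f = y"
  shows "transpose M z q \<cdot> f = transpose M y (q \<cdot> \<one> M \<boxtimes> f)"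
proof -
  note [simp] = dual_data_simps
  have z [simp]: "z \<in> Ob V" using Ob_simps(2)[of f] by simp
  have "evd V M \<cdot> \<one> M \<boxtimes> (transpose M z q \<cdot> f) = evd V M \<cdot> \<one> M \<boxtimes> transpose M z q \<cdot> \<one> M \<boxtimes> f"
    by simp
  also have "\<dots> = q \<cdot> \<one> M \<boxtimes> f" by (subst evd_transpose) simp_all
  finally show ?thesis using transpose_evd[of "transpose M z q \<cdot> f"] by simp
qed

end

text \<open>
  The contravariant action on duals is adjoint to evaluating at an argument and pairing the result.
  All later calculations with it use only this universal description.
\<close>

lemma dual_act_eq_transpose:
  assumes M: "M \<in> dualizable V" and N: "N \<in> dualizable V"
  shows "dual_act V M N = transpose M ((M \<Rrightarrow> N) \<otimes> dual V N)
    (evd V N \<cdot> (\<e> M N \<cdot> \<s> M (M \<Rrightarrow> N)) \<boxtimes> \<one> (dual V N) \<cdot> \<a>' M (M \<Rrightarrow> N) (dual V N))"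
proof -
  note [simp] = dual_data_simps[OF M] dual_data_simps[OF N]
  show ?thesis by (simp add: dual_act_def transpose_def unbend_def assoc)
qed

section \<open>Comodules\<close>

lemma comodule_iff:
  "comodule V T m \<longleftrightarrow> fst m \<in> Ob V \<and> snd m \<in> hom V (fst m) (cob T \<otimes> fst m) \<and>
    \<a> (cob T) (cob T) (fst m) \<cdot> comult T \<boxtimes> \<one> (fst m) \<cdot> snd m = \<one> (cob T) \<boxtimes> snd m \<cdot> snd m \<and>
    \<l> (fst m) \<cdot> counit T \<boxtimes> \<one> (fst m) \<cdot> snd m = \<one> (fst m)"
  by (simp add: comodule_def case_prod_beta)

lemma comodule_morphism_iff:
  "comodule_morphism V T m n f \<longleftrightarrow>
    f \<in> hom V (fst m) (fst n) \<and> snd n \<cdot> f = \<one> (cob T) \<boxtimes> f \<cdot> snd m"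
  by (simp add: comodule_morphism_def case_prod_beta)

lemma comodule_simps:
  assumes "comodule V T m"
  shows "fst m \<in> Ob V" "snd m \<in> Ar V" "Dom V (snd m) = fst m" "Cod V (snd m) = cob T \<otimes> fst m"
  using assms by (auto simp: comodule_iff hom_iff)

lemma comodule_morphism_simps:
  assumes "comodule_morphism V T m n f"
  shows "f \<in> Ar V" "Dom V f = fst m" "Cod V f = fst n" "snd n \<cdot> f = \<one> (cob T) \<boxtimes> f \<cdot> snd m"
  using assms by (auto simp: comodule_morphism_iff hom_iff)

text \<open>
  The coaction on the left factor makes \<open>M \<otimes> z\<close> a comodule for every object \<open>z\<close>. Taking \<open>z\<close> on the
  right keeps the symmetry out of the coaction. For \<open>m = (T, \<delta>)\<close> this is the cofree comodule on \<open>z\<close>.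
\<close>

definition comod_tns :: "('o, 'a) comon \<Rightarrow> 'o \<times> 'a \<Rightarrow> 'o \<Rightarrow> 'o \<times> 'a" where
  "comod_tns T m z = (fst m \<otimes> z, \<a> (cob T) (fst m) z \<cdot> snd m \<boxtimes> \<one> z)"

context
  fixes T
  assumes T: "comonoid V T"
begin

lemma comonoid_simps [simp]:
  "cob T \<in> Ob V" "comult T \<in> Ar V" "Dom V (comult T) = cob T" "Cod V (comult T) = cob T \<otimes> cob T"
  "counit T \<in> Ar V" "Dom V (counit T) = cob T" "Cod V (counit T) = \<I>"
  using T by (auto simp: comonoid_def hom_iff)

lemma comodule_self: "comodule V T (cob T, comult T)"
  using T by (simp add: comodule_def comonoid_def)

lemma comodule_tns:
  assumes m: "comodule V T m" and [simp]: "z \<in> Ob V"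
  shows "comodule V T (comod_tns T m z)"
proof -
  let ?C = "cob T" and ?M = "fst m" and ?\<rho> = "snd m"
  note [simp] = comodule_simps[OF m]
  note c = m[unfolded comodule_iff, THEN conjunct2, THEN conjunct2]
  have "\<a> ?C ?C (?M \<otimes> z) \<cdot> comult T \<boxtimes> \<one> (?M \<otimes> z) \<cdot> (\<a> ?C ?M z \<cdot> ?\<rho> \<boxtimes> \<one> z)
    = \<a> ?C ?C (?M \<otimes> z) \<cdot> (comult T \<boxtimes> \<one> (?M \<otimes> z) \<cdot> \<a> ?C ?M z) \<cdot> ?\<rho> \<boxtimes> \<one> z"
    by (simp add: assoc)
  also have "\<dots> = (\<a> ?C ?C (?M \<otimes> z) \<cdot> \<a> (?C \<otimes> ?C) ?M z) \<cdot> (comult T \<boxtimes> \<one> ?M \<cdot> ?\<rho>) \<boxtimes> \<one> z"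
    by (subst assc_at[of "comult T" "\<one> ?M" "\<one> z", simplified, symmetric]) (simp_all add: assoc)
  also have "\<dots> = \<one> ?C \<boxtimes> \<a> ?C ?M z \<cdot> \<a> ?C (?C \<otimes> ?M) z
      \<cdot> (\<a> ?C ?C ?M \<cdot> comult T \<boxtimes> \<one> ?M \<cdot> ?\<rho>) \<boxtimes> \<one> z"
    by (subst pentagon) (simp_all add: assoc)
  also have "\<dots> = \<one> ?C \<boxtimes> \<a> ?C ?M z \<cdot> (\<a> ?C (?C \<otimes> ?M) z \<cdot> \<one> ?C \<boxtimes> ?\<rho> \<boxtimes> \<one> z) \<cdot> ?\<rho> \<boxtimes> \<one> z"
    by (subst conjunct1[OF c]) (simp add: assoc)
  also have "\<dots> = \<one> ?C \<boxtimes> (\<a> ?C ?M z \<cdot> ?\<rho> \<boxtimes> \<one> z) \<cdot> (\<a> ?C ?M z \<cdot> ?\<rho> \<boxtimes> \<one> z)"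
    by (simp add: assc_natural assoc)
  finally have 1: "\<a> ?C ?C (?M \<otimes> z) \<cdot> comult T \<boxtimes> \<one> (?M \<otimes> z) \<cdot> (\<a> ?C ?M z \<cdot> ?\<rho> \<boxtimes> \<one> z)
    = \<one> ?C \<boxtimes> (\<a> ?C ?M z \<cdot> ?\<rho> \<boxtimes> \<one> z) \<cdot> (\<a> ?C ?M z \<cdot> ?\<rho> \<boxtimes> \<one> z)" .
  have "\<l> (?M \<otimes> z) \<cdot> counit T \<boxtimes> \<one> (?M \<otimes> z) \<cdot> (\<a> ?C ?M z \<cdot> ?\<rho> \<boxtimes> \<one> z)
    = \<l> (?M \<otimes> z) \<cdot> (counit T \<boxtimes> \<one> (?M \<otimes> z) \<cdot> \<a> ?C ?M z) \<cdot> ?\<rho> \<boxtimes> \<one> z"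
    by (simp add: assoc)
  also have "\<dots> = (\<l> (?M \<otimes> z) \<cdot> \<a> \<I> ?M z) \<cdot> (counit T \<boxtimes> \<one> ?M \<cdot> ?\<rho>) \<boxtimes> \<one> z"
    by (subst assc_at[of "counit T" "\<one> ?M" "\<one> z", simplified, symmetric]) (simp_all add: assoc)
  also have "\<dots> = (\<l> ?M \<cdot> counit T \<boxtimes> \<one> ?M \<cdot> ?\<rho>) \<boxtimes> \<one> z"
    by (subst lunit_tns) (simp_all add: assoc)
  also have "\<dots> = \<one> (?M \<otimes> z)" by (subst conjunct2[OF c]) simp
  finally show ?thesis using 1 by (simp add: comodule_iff comod_tns_def hom_iff)
qed

lemma comodule_morphism_Idt: "comodule V T m \<Longrightarrow> comodule_morphism V T m m (\<one> (fst m))"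
  by (simp add: comodule_simps comodule_morphism_iff hom_iff)

lemma comodule_morphism_Cmp:
  assumes m: "comodule V T m" and n: "comodule V T n" and p: "comodule V T p"
    and f: "comodule_morphism V T m n f" and g: "comodule_morphism V T n p g"
  shows "comodule_morphism V T m p (g \<cdot> f)"
proof -
  note [simp] = comodule_simps[OF m] comodule_simps[OF n] comodule_simps[OF p]
    comodule_morphism_simps(1-3)[OF f] comodule_morphism_simps(1-3)[OF g]
  have "snd p \<cdot> (g \<cdot> f) = snd p \<cdot> g \<cdot> f" by (simp add: assoc)
  also have "\<dots> = \<one> (cob T) \<boxtimes> g \<cdot> (snd n \<cdot> f)"
    by (subst comodule_morphism_simps(4)[OF g]) (simp add: assoc)
  also have "\<dots> = \<one> (cob T) \<boxtimes> (g \<cdot> f) \<cdot> snd m"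
    by (subst comodule_morphism_simps(4)[OF f]) (simp add: assoc)
  finally show ?thesis by (simp add: comodule_morphism_iff hom_iff)
qed

lemma comodule_morphism_tns:
  assumes m: "comodule V T m" and n: "comodule V T n"
    and f: "comodule_morphism V T m n f" and g: "g \<in> hom V z w"
  shows "comodule_morphism V T (comod_tns T m z) (comod_tns T n w) (f \<boxtimes> g)"
proof -
  note [simp] = comodule_simps[OF m] comodule_simps[OF n] comodule_morphism_simps(1-3)[OF f]
    g[unfolded hom_iff]
  have [simp]: "z \<in> Ob V" "w \<in> Ob V" using Ob_simps[of g] by simp_all
  have "\<a> (cob T) (fst n) w \<cdot> snd n \<boxtimes> \<one> w \<cdot> f \<boxtimes> g = \<a> (cob T) (fst n) w \<cdot> (snd n \<cdot> f) \<boxtimes> g"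
    by simp
  also have "\<dots> = (\<a> (cob T) (fst n) w \<cdot> \<one> (cob T) \<boxtimes> f \<boxtimes> g) \<cdot> snd m \<boxtimes> \<one> z"
    by (subst comodule_morphism_simps(4)[OF f]) simp
  also have "\<dots> = \<one> (cob T) \<boxtimes> (f \<boxtimes> g) \<cdot> (\<a> (cob T) (fst m) z \<cdot> snd m \<boxtimes> \<one> z)"
    by (simp add: assc_natural assoc)
  finally show ?thesis by (simp add: comodule_morphism_iff hom_iff comod_tns_def)
qed

lemma comodule_morphism_assc:
  assumes m: "comodule V T m" and [simp]: "y \<in> Ob V" "z \<in> Ob V"
  shows "comodule_morphism V T (comod_tns T (comod_tns T m y) z) (comod_tns T m (y \<otimes> z)) (\<a> (fst m) y z)"
proof -
  note [simp] = comodule_simps[OF m]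
  let ?C = "cob T" and ?M = "fst m"
  have "\<a> ?C ?M (y \<otimes> z) \<cdot> (snd m \<boxtimes> \<one> (y \<otimes> z) \<cdot> \<a> ?M y z)
    = \<a> ?C ?M (y \<otimes> z) \<cdot> \<a> (?C \<otimes> ?M) y z \<cdot> snd m \<boxtimes> \<one> y \<boxtimes> \<one> z"
    by (subst assc_at[of "snd m" "\<one> y" "\<one> z", simplified, symmetric]) (simp_all add: assoc)
  also have "\<dots> = \<one> ?C \<boxtimes> \<a> ?M y z \<cdot> (\<a> ?C (?M \<otimes> y) z \<cdot> (\<a> ?C ?M y \<cdot> snd m \<boxtimes> \<one> y) \<boxtimes> \<one> z)"
    by (subst pentagon) (simp_all add: assoc)
  finally show ?thesis by (simp add: comodule_morphism_iff hom_iff comod_tns_def assoc)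
qed

lemma comodule_morphism_runit:
  assumes m: "comodule V T m"
  shows "comodule_morphism V T (comod_tns T m \<I>) m (\<r> (fst m))"
proof -
  note [simp] = comodule_simps[OF m]
  have "snd m \<cdot> \<r> (fst m) = \<r> (cob T \<otimes> fst m) \<cdot> snd m \<boxtimes> \<one> \<I>"
    by (simp add: runit_natural)
  also have "\<dots> = \<one> (cob T) \<boxtimes> \<r> (fst m) \<cdot> (\<a> (cob T) (fst m) \<I> \<cdot> snd m \<boxtimes> \<one> \<I>)"
    by (subst runit_tns[symmetric]) (simp_all add: assoc)
  finally show ?thesis by (simp add: comodule_morphism_iff hom_iff comod_tns_def)
qed

text \<open>
  The next two lemmas are the universal property of the cofree comodule \<open>T \<otimes> Z\<close>: arrows \<open>g : M \<rightarrow> Z\<close>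
  extend to comodule morphisms \<open>M \<rightarrow> T \<otimes> Z\<close>, and the counit of \<open>T\<close> recovers \<open>g\<close>.
\<close>

lemma cofree_morphism:
  assumes m: "comodule V T m" and g: "g \<in> hom V (fst m) Z"
  shows "comodule_morphism V T m (comod_tns T (cob T, comult T) Z) (\<one> (cob T) \<boxtimes> g \<cdot> snd m)"
proof -
  let ?C = "cob T" and ?M = "fst m"
  note [simp] = comodule_simps[OF m] g[unfolded hom_iff]
  have [simp]: "Z \<in> Ob V" using Ob_simps(2)[of g] by simp
  note c = m[unfolded comodule_iff, THEN conjunct2, THEN conjunct2]
  have "\<a> ?C ?C Z \<cdot> comult T \<boxtimes> \<one> Z \<cdot> (\<one> ?C \<boxtimes> g \<cdot> snd m)
    = (\<a> ?C ?C Z \<cdot> \<one> (?C \<otimes> ?C) \<boxtimes> g) \<cdot> comult T \<boxtimes> \<one> ?M \<cdot> snd m"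
    by (simp add: assoc)
  also have "\<dots> = \<one> ?C \<boxtimes> (\<one> ?C \<boxtimes> g) \<cdot> (\<a> ?C ?C ?M \<cdot> comult T \<boxtimes> \<one> ?M \<cdot> snd m)"
    by (subst assc_at[of "\<one> ?C" "\<one> ?C" g, simplified]) (simp_all add: assoc)
  also have "\<dots> = \<one> ?C \<boxtimes> (\<one> ?C \<boxtimes> g \<cdot> snd m) \<cdot> snd m"
    by (subst conjunct1[OF c]) (simp add: assoc)
  finally show ?thesis by (simp add: comodule_morphism_iff hom_iff comod_tns_def)
qed

lemma counit_cofree:
  assumes m: "comodule V T m" and g: "g \<in> hom V (fst m) Z"
  shows "\<l> Z \<cdot> counit T \<boxtimes> \<one> Z \<cdot> (\<one> (cob T) \<boxtimes> g \<cdot> snd m) = g"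
proof -
  let ?C = "cob T" and ?M = "fst m"
  note [simp] = comodule_simps[OF m] g[unfolded hom_iff]
  have [simp]: "Z \<in> Ob V" using Ob_simps(2)[of g] by simp
  note c = m[unfolded comodule_iff, THEN conjunct2, THEN conjunct2]
  have "\<l> Z \<cdot> counit T \<boxtimes> \<one> Z \<cdot> (\<one> (cob T) \<boxtimes> g \<cdot> snd m)
    = (\<l> Z \<cdot> \<one> \<I> \<boxtimes> g) \<cdot> counit T \<boxtimes> \<one> ?M \<cdot> snd m"
    by (simp add: assoc)
  also have "\<dots> = g \<cdot> (\<l> ?M \<cdot> counit T \<boxtimes> \<one> ?M \<cdot> snd m)"
    by (simp add: lunit_natural) (simp add: assoc)
  also have "\<dots> = g" by (subst conjunct2[OF c]) simp
  finally show ?thesis .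
qed

end

section \<open>Hom-objects between comodules\<close>

lemma curry_ar:
  assumes "f \<in> hom V (z \<otimes> x) y" "x \<in> Ob V" "z \<in> Ob V"
  shows "curry_ar V z x y f \<in> hom V z (x \<Rrightarrow> y)" "\<e> x y \<cdot> curry_ar V z x y f \<boxtimes> \<one> x = f"
proof -
  have "y \<in> Ob V" using assms(1) Ob_simps(2)[of f] by (simp add: hom_iff)
  then have "\<exists>!g. g \<in> hom V z (x \<Rrightarrow> y) \<and> \<e> x y \<cdot> g \<boxtimes> \<one> x = f"
    using assms by (intro closed) auto
  from theI'[OF this]
  show "curry_ar V z x y f \<in> hom V z (x \<Rrightarrow> y)" "\<e> x y \<cdot> curry_ar V z x y f \<boxtimes> \<one> x = f"
    by (simp_all add: curry_ar_def)
qed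

lemma curry_simps [simp]:
  assumes "f \<in> Ar V" "Dom V f = z \<otimes> x" "Cod V f = y" "x \<in> Ob V" "z \<in> Ob V"
  shows "curry_ar V z x y f \<in> Ar V" "Dom V (curry_ar V z x y f) = z"
    "Cod V (curry_ar V z x y f) = x \<Rrightarrow> y" "\<e> x y \<cdot> curry_ar V z x y f \<boxtimes> \<one> x = f"
  using curry_ar[of f z x y] assms by (auto simp: hom_iff)

lemma curry_Cmp:
  assumes [simp]: "f \<in> Ar V" "Dom V f = z \<otimes> x" "Cod V f = y" "x \<in> Ob V" "z \<in> Ob V"
    and [simp]: "k \<in> Ar V" "Cod V k = z"
  shows "\<e> x y \<cdot> (curry_ar V z x y f \<cdot> k) \<boxtimes> \<one> x = f \<cdot> k \<boxtimes> \<one> x"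
proof -
  have [simp]: "y \<in> Ob V" using Ob_simps(2)[of f] by simp
  have "\<e> x y \<cdot> (curry_ar V z x y f \<cdot> k) \<boxtimes> \<one> x = \<e> x y \<cdot> curry_ar V z x y f \<boxtimes> \<one> x \<cdot> k \<boxtimes> \<one> x"
    by (simp del: curry_simps(4))
  also have "\<dots> = f \<cdot> k \<boxtimes> \<one> x" by (subst curry_simps(4)) simp_all
  finally show ?thesis .
qed

lemma uncurry_inject:
  assumes [simp]: "g \<in> Ar V" "Dom V g = z" "Cod V g = x \<Rrightarrow> y" "h \<in> Ar V" "Dom V h = z" "Cod V h = x \<Rrightarrow> y"
    "x \<in> Ob V" "y \<in> Ob V"
    and "\<e> x y \<cdot> g \<boxtimes> \<one> x = \<e> x y \<cdot> h \<boxtimes> \<one> x"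
  shows "g = h"
proof -
  have "z \<in> Ob V" using Ob_simps(1)[of g] by simp
  then have "\<exists>!g. g \<in> hom V z (x \<Rrightarrow> y) \<and> \<e> x y \<cdot> g \<boxtimes> \<one> x = \<e> x y \<cdot> h \<boxtimes> \<one> x"
    by (intro closed) (simp_all add: hom_iff)
  moreover have "g \<in> hom V z (x \<Rrightarrow> y)" "h \<in> hom V z (x \<Rrightarrow> y)" by (simp_all add: hom_iff)
  ultimately show ?thesis using assms(9) by blast
qed

text \<open>
  The hexagon solved for the composite that occurs when \<open>ihom_tns\<close>, which moves the hom-object past
  \<open>T\<close>, meets the coaction on \<open>M \<otimes> y\<close>.
\<close>

lemma hexagon_symm:
  assumes [simp]: "x \<in> Ob V" "y \<in> Ob V" "z \<in> Ob V"
  shows "\<a> y x z \<cdot> \<s> x y \<boxtimes> \<one> z \<cdot> \<a>' x y z \<cdot> \<s> (y \<otimes> z) x = \<one> y \<boxtimes> \<s> z x \<cdot> \<a> y z x"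
proof -
  have "\<one> y \<boxtimes> \<s> z x \<cdot> \<a> y z x
    = \<one> y \<boxtimes> \<s> z x \<cdot> (\<a> y z x \<cdot> \<s> x (y \<otimes> z) \<cdot> \<a> x y z) \<cdot> \<a>' x y z \<cdot> \<s> (y \<otimes> z) x"
    by (simp add: assoc)
  also have "\<dots> = \<a> y x z \<cdot> \<s> x y \<boxtimes> \<one> z \<cdot> \<a>' x y z \<cdot> \<s> (y \<otimes> z) x"
    unfolding hexagon[OF assms] by (simp add: assoc)
  finally show ?thesis by simp
qed

text \<open>
  The equalizer that defines the hom-object of comodules represents comodule morphisms with a
  parameter: \<open>k : y \<rightarrow> [M, N]\<close> equalizes the two arrows iff its transpose \<open>M \<otimes> y \<rightarrow> N\<close> is a comodule
  morphism. Both composites are compared after uncurrying, where the symmetries that \<open>ihom_tns\<close>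
  introduces cancel against the one in the transpose by the hexagon.
\<close>

lemma equalizes_iff_comodule_morphism:
  assumes T: "comonoid V T" and m: "comodule V T m" and n: "comodule V T n"
    and k: "k \<in> hom V y (fst m \<Rrightarrow> fst n)"
  shows "ihom_pre V (snd m) (cob T \<otimes> fst n) \<cdot> ihom_tns V (cob T) (fst m) (fst n) \<cdot> k
      = ihom_post V (fst m) (snd n) \<cdot> k
    \<longleftrightarrow> comodule_morphism V T (comod_tns T m y) n (\<e> (fst m) (fst n) \<cdot> k \<boxtimes> \<one> (fst m) \<cdot> \<s> (fst m) y)"
proof -
  let ?C = "cob T" and ?M = "fst m" and ?N = "fst n" and ?\<rho> = "snd m" and ?\<sigma> = "snd n"
  note [simp] = comonoid_simps[OF T] comodule_simps[OF m] comodule_simps[OF n] k[unfolded hom_iff]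
  have y [simp]: "y \<in> Ob V" using Ob_simps(1)[of k] by simp
  let ?H = "?M \<Rrightarrow> ?N"
  let ?u = "\<e> ?M ?N \<cdot> k \<boxtimes> \<one> ?M \<cdot> \<s> ?M y"
  define tn where "tn = ihom_tns V ?C ?M ?N"
  let ?t = "\<one> ?C \<boxtimes> \<e> ?M ?N \<cdot> \<a> ?C ?H ?M \<cdot> \<s> ?H ?C \<boxtimes> \<one> ?M \<cdot> \<a>' ?H ?C ?M"
  have tn [simp]: "tn \<in> Ar V" "Dom V tn = ?H" "Cod V tn = ?C \<otimes> ?M \<Rrightarrow> ?C \<otimes> ?N"
    by (simp_all add: tn_def ihom_tns_def)
  have tnk: "\<e> (?C \<otimes> ?M) (?C \<otimes> ?N) \<cdot> (tn \<cdot> k) \<boxtimes> \<one> (?C \<otimes> ?M)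
    = \<one> ?C \<boxtimes> (\<e> ?M ?N \<cdot> k \<boxtimes> \<one> ?M) \<cdot> \<a> ?C y ?M \<cdot> \<s> y ?C \<boxtimes> \<one> ?M \<cdot> \<a>' y ?C ?M"
  proof -
    have "\<e> (?C \<otimes> ?M) (?C \<otimes> ?N) \<cdot> (tn \<cdot> k) \<boxtimes> \<one> (?C \<otimes> ?M) = ?t \<cdot> k \<boxtimes> \<one> (?C \<otimes> ?M)"
      unfolding tn_def ihom_tns_def by (rule curry_Cmp) simp_all
    also have "\<dots> = \<one> ?C \<boxtimes> \<e> ?M ?N \<cdot> \<a> ?C ?H ?M \<cdot> \<s> ?H ?C \<boxtimes> \<one> ?M \<cdot> (\<a>' ?H ?C ?M \<cdot> k \<boxtimes> (\<one> (?C \<otimes> ?M)))"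
      by (simp add: assoc)
    also have "\<dots> = \<one> ?C \<boxtimes> \<e> ?M ?N \<cdot> \<a> ?C ?H ?M \<cdot> (\<s> ?H ?C \<cdot> k \<boxtimes> \<one> ?C) \<boxtimes> \<one> ?M \<cdot> \<a>' y ?C ?M"
      by (subst assc'_at[of k "\<one> ?C" "\<one> ?M", simplified]) (simp_all add: assoc)
    also have "\<dots> = \<one> ?C \<boxtimes> \<e> ?M ?N \<cdot> (\<a> ?C ?H ?M \<cdot> (\<one> ?C \<boxtimes> k \<boxtimes> \<one> ?M)) \<cdot> \<s> y ?C \<boxtimes> \<one> ?M \<cdot> \<a>' y ?C ?M"
      by (simp add: symm_natural assoc)
    also have "\<dots> = \<one> ?C \<boxtimes> (\<e> ?M ?N \<cdot> k \<boxtimes> \<one> ?M) \<cdot> \<a> ?C y ?M \<cdot> \<s> y ?C \<boxtimes> \<one> ?M \<cdot> \<a>' y ?C ?M"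
      by (simp add: assc_natural assoc)
    finally show ?thesis .
  qed
  have pre: "\<e> ?M (?C \<otimes> ?N) \<cdot> (ihom_pre V ?\<rho> (?C \<otimes> ?N) \<cdot> tn \<cdot> k) \<boxtimes> \<one> ?M
    = \<e> (?C \<otimes> ?M) (?C \<otimes> ?N) \<cdot> (tn \<cdot> k) \<boxtimes> \<one> (?C \<otimes> ?M) \<cdot> \<one> y \<boxtimes> ?\<rho>"
  proof -
    let ?p = "\<e> (?C \<otimes> ?M) (?C \<otimes> ?N) \<cdot> \<one> (?C \<otimes> ?M \<Rrightarrow> ?C \<otimes> ?N) \<boxtimes> ?\<rho>"
    have "\<e> ?M (?C \<otimes> ?N) \<cdot> (ihom_pre V ?\<rho> (?C \<otimes> ?N) \<cdot> (tn \<cdot> k)) \<boxtimes> \<one> ?M = ?p \<cdot> (tn \<cdot> k) \<boxtimes> \<one> ?M"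
      unfolding ihom_pre_def using curry_Cmp[of ?p "?C \<otimes> ?M \<Rrightarrow> ?C \<otimes> ?N" ?M "?C \<otimes> ?N" "tn \<cdot> k"] by simp
    then show ?thesis by (simp add: assoc ihom_pre_def)
  qed
  have post: "\<e> ?M (?C \<otimes> ?N) \<cdot> (ihom_post V ?M ?\<sigma> \<cdot> k) \<boxtimes> \<one> ?M = ?\<sigma> \<cdot> (\<e> ?M ?N \<cdot> k \<boxtimes> \<one> ?M)"
    unfolding ihom_post_def
    using curry_Cmp[of "?\<sigma> \<cdot> \<e> ?M ?N" ?H ?M "?C \<otimes> ?N" k] by (simp add: assoc)
  let ?L = "ihom_pre V ?\<rho> (?C \<otimes> ?N) \<cdot> tn \<cdot> k" and ?R = "ihom_post V ?M ?\<sigma> \<cdot> k"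
  have LR [simp]: "?L \<in> Ar V" "Dom V ?L = y" "Cod V ?L = ?M \<Rrightarrow> ?C \<otimes> ?N"
      "?R \<in> Ar V" "Dom V ?R = y" "Cod V ?R = ?M \<Rrightarrow> ?C \<otimes> ?N"
    by (simp_all add: ihom_pre_def ihom_post_def)
  let ?l = "\<e> ?M (?C \<otimes> ?N) \<cdot> ?L \<boxtimes> \<one> ?M" and ?r = "\<e> ?M (?C \<otimes> ?N) \<cdot> ?R \<boxtimes> \<one> ?M"
  have "?L = ?R \<longleftrightarrow> ?l = ?r"
    using uncurry_inject[of ?L y ?M "?C \<otimes> ?N" ?R] LR by auto
  also have "\<dots> \<longleftrightarrow> ?l \<cdot> \<s> ?M y = ?r \<cdot> \<s> ?M y"
  proof
    assume "?l \<cdot> \<s> ?M y = ?r \<cdot> \<s> ?M y"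
    then have "?l \<cdot> \<s> ?M y \<cdot> \<s> y ?M = ?r \<cdot> \<s> ?M y \<cdot> \<s> y ?M" by (rule arg_cong)
    then show "?l = ?r" using LR by (simp del: Cmp_simps add: Cmp_simps(1-3))
  qed simp
  also have "?l \<cdot> \<s> ?M y = \<one> ?C \<boxtimes> ?u \<cdot> snd (comod_tns T m y)"
  proof -
    have "?l \<cdot> \<s> ?M y = \<one> ?C \<boxtimes> (\<e> ?M ?N \<cdot> k \<boxtimes> \<one> ?M) \<cdot> \<a> ?C y ?M \<cdot> \<s> y ?C \<boxtimes> \<one> ?M \<cdot> \<a>' y ?C ?M
        \<cdot> (\<one> y \<boxtimes> ?\<rho> \<cdot> \<s> ?M y)"
      unfolding pre tnk by (simp add: assoc)
    also have "\<dots> = \<one> ?C \<boxtimes> (\<e> ?M ?N \<cdot> k \<boxtimes> \<one> ?M) \<cdot> (\<a> ?C y ?M \<cdot> \<s> y ?C \<boxtimes> \<one> ?M \<cdot> \<a>' y ?C ?M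
        \<cdot> \<s> (?C \<otimes> ?M) y) \<cdot> ?\<rho> \<boxtimes> \<one> y"
      by (subst symm_at[of ?\<rho> "\<one> y", simplified, symmetric]) (simp_all add: assoc)
    also have "\<dots> = \<one> ?C \<boxtimes> ?u \<cdot> snd (comod_tns T m y)"
      by (subst hexagon_symm) (simp_all add: assoc comod_tns_def)
    finally show ?thesis .
  qed
  also have "?r \<cdot> \<s> ?M y = ?\<sigma> \<cdot> ?u"
    unfolding post by (simp add: assoc)
  finally show ?thesis
    by (auto simp: comodule_morphism_iff hom_iff comod_tns_def tn_def)
qed

end

context category
begin

section \<open>Tautological colimits and density\<close>

definition slice_cocone :: "'o set \<Rightarrow> 'o \<Rightarrow> 'o \<Rightarrow> ('a \<Rightarrow> 'a) \<Rightarrow> bool" where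
  "slice_cocone X c d \<gamma> \<longleftrightarrow> d \<in> Ob C \<and>
    (\<forall>\<phi>. \<phi> \<in> Ar C \<longrightarrow> Dom C \<phi> \<in> X \<longrightarrow> Cod C \<phi> = c \<longrightarrow> \<gamma> \<phi> \<in> hom C (Dom C \<phi>) d) \<and>
    (\<forall>\<phi> f. \<phi> \<in> Ar C \<longrightarrow> Dom C \<phi> \<in> X \<longrightarrow> Cod C \<phi> = c \<longrightarrow> f \<in> Ar C \<longrightarrow> Dom C f \<in> X \<longrightarrow>
       Cod C f = Dom C \<phi> \<longrightarrow> \<gamma> (\<phi> \<cdot> f) = \<gamma> \<phi> \<cdot> f)"

lemma slice_coconeD:
  assumes "slice_cocone X c d \<gamma>"
  shows "d \<in> Ob C"
    and "\<phi> \<in> Ar C \<Longrightarrow> Dom C \<phi> \<in> X \<Longrightarrow> Cod C \<phi> = c \<Longrightarrow> \<gamma> \<phi> \<in> hom C (Dom C \<phi>) d"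
    and "\<phi> \<in> Ar C \<Longrightarrow> Dom C \<phi> \<in> X \<Longrightarrow> Cod C \<phi> = c \<Longrightarrow> f \<in> Ar C \<Longrightarrow> Dom C f \<in> X \<Longrightarrow>
      Cod C f = Dom C \<phi> \<Longrightarrow> \<gamma> (\<phi> \<cdot> f) = \<gamma> \<phi> \<cdot> f"
  using assms unfolding slice_cocone_def by blast+

text \<open>
  An arrow \<open>f\<close> of the slice from \<open>\<phi>'\<close> to \<open>\<phi>\<close> forces \<open>\<phi>' = \<phi> \<cdot> f\<close>, which is why the source need not be
  quantified over in \<open>slice_cocone\<close>.
\<close>

lemma is_cocone_slice:
  "is_cocone (slice C X c) C (\<lambda>\<phi>. Dom C \<phi>) (\<lambda>(\<phi>, \<psi>, f). f) d \<gamma> \<longleftrightarrow> slice_cocone X c d \<gamma>"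
  unfolding is_cocone_def slice_cocone_def slice_def hom_def
  by (auto simp del: Cmp_simps) (metis Cmp_simps)+

lemma tautological_colimit_iff:
  assumes c: "c \<in> Ob C"
  shows "tautological_colimit C X c \<longleftrightarrow>
    (\<forall>d \<gamma>. slice_cocone X c d \<gamma> \<longrightarrow>
      (\<exists>!h. h \<in> hom C c d \<and> (\<forall>\<phi>. \<phi> \<in> Ar C \<longrightarrow> Dom C \<phi> \<in> X \<longrightarrow> Cod C \<phi> = c \<longrightarrow> h \<cdot> \<phi> = \<gamma> \<phi>)))"
proof -
  have "slice_cocone X c c (\<lambda>\<phi>. \<phi>)" using c by (auto simp: slice_cocone_def hom_def)
  moreover have "Ob (slice C X c) = {\<phi> \<in> Ar C. Dom C \<phi> \<in> X \<and> Cod C \<phi> = c}" by (simp add: slice_def)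
  ultimately show ?thesis
    unfolding tautological_colimit_def is_colimit_def is_cocone_slice by (simp add: imp_conjL)
qed

end

context symmetric_monoidal_closed
begin

context
  fixes X
  assumes X: "Set_dense V X"
begin

lemma dense_unique:
  assumes f: "f \<in> hom V c d" and g: "g \<in> hom V c d"
    and eq: "\<And>p. p \<in> Ar V \<Longrightarrow> Dom V p \<in> X \<Longrightarrow> Cod V p = c \<Longrightarrow> f \<cdot> p = g \<cdot> p"
  shows "f = g"
proof -
  note [simp] = f[unfolded hom_iff] g[unfolded hom_iff]
  have c: "c \<in> Ob V" "d \<in> Ob V" using Ob_simps[of f] by simp_all
  have "slice_cocone X c d (\<lambda>p. f \<cdot> p)"
    using c by (simp add: slice_cocone_def hom_iff assoc)
  then have "\<exists>!h. h \<in> hom V c d \<and> (\<forall>p. p \<in> Ar V \<longrightarrow> Dom V p \<in> X \<longrightarrow> Cod V p = c \<longrightarrow> h \<cdot> p = f \<cdot> p)"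
    using X c tautological_colimit_iff[of c X] by (simp add: Set_dense_def)
  then show ?thesis using f g eq by metis
qed

lemma dense_extend:
  assumes "c \<in> Ob V" "slice_cocone X c d \<gamma>"
  obtains h where "h \<in> hom V c d" "\<And>p. p \<in> Ar V \<Longrightarrow> Dom V p \<in> X \<Longrightarrow> Cod V p = c \<Longrightarrow> h \<cdot> p = \<gamma> p"
  using X assms tautological_colimit_iff[of c X] unfolding Set_dense_def by metis

text \<open>
  Since \<open>V\<close> is closed, tensoring with \<open>M\<close> preserves the colimits that present objects by the dense
  subcategory. The following lemmas say this in terms of elements.
\<close>

lemma dense_unique_right:
  assumes f: "f \<in> hom V (c \<otimes> M) d" and g: "g \<in> hom V (c \<otimes> M) d"
    and [simp]: "c \<in> Ob V" "M \<in> Ob V"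
    and eq: "\<And>p. p \<in> Ar V \<Longrightarrow> Dom V p \<in> X \<Longrightarrow> Cod V p = c \<Longrightarrow> f \<cdot> p \<boxtimes> \<one> M = g \<cdot> p \<boxtimes> \<one> M"
  shows "f = g"
proof -
  note [simp] = f[unfolded hom_iff] g[unfolded hom_iff]
  have d [simp]: "d \<in> Ob V" using Ob_simps(2)[of f] by simp
  have "curry_ar V c M d f = curry_ar V c M d g"
  proof (rule dense_unique)
    fix p assume [simp]: "p \<in> Ar V" "Cod V p = c" "Dom V p \<in> X"
    show "curry_ar V c M d f \<cdot> p = curry_ar V c M d g \<cdot> p"
      by (rule uncurry_inject[of _ "Dom V p" M d]) (simp_all add: curry_Cmp eq)
  qed (simp_all add: hom_iff)
  then have "\<e> M d \<cdot> curry_ar V c M d f \<boxtimes> \<one> M = \<e> M d \<cdot> curry_ar V c M d g \<boxtimes> \<one> M"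
    by (rule arg_cong)
  then show ?thesis by simp
qed

lemma dense_unique_left:
  assumes f: "f \<in> hom V (M \<otimes> c) d" and g: "g \<in> hom V (M \<otimes> c) d"
    and [simp]: "c \<in> Ob V" "M \<in> Ob V"
    and eq: "\<And>p. p \<in> Ar V \<Longrightarrow> Dom V p \<in> X \<Longrightarrow> Cod V p = c \<Longrightarrow> f \<cdot> \<one> M \<boxtimes> p = g \<cdot> \<one> M \<boxtimes> p"
  shows "f = g"
proof -
  note [simp] = f[unfolded hom_iff] g[unfolded hom_iff]
  have "f \<cdot> \<s> c M = g \<cdot> \<s> c M"
  proof (rule dense_unique_right)
    fix p assume p [simp]: "p \<in> Ar V" "Cod V p = c" and "Dom V p \<in> X"
    then have "f \<cdot> \<one> M \<boxtimes> p \<cdot> \<s> (Dom V p) M = g \<cdot> \<one> M \<boxtimes> p \<cdot> \<s> (Dom V p) M"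
      by (simp only: eq)
    moreover have "k \<cdot> \<one> M \<boxtimes> p \<cdot> \<s> (Dom V p) M = k \<cdot> \<s> c M \<cdot> p \<boxtimes> \<one> M"
      if "k \<in> Ar V" "Dom V k = M \<otimes> c" for k
      using that by (simp add: assoc[symmetric] symm_natural)
    ultimately show "f \<cdot> \<s> c M \<cdot> p \<boxtimes> \<one> M = g \<cdot> \<s> c M \<cdot> p \<boxtimes> \<one> M" by simp
  qed (simp_all add: hom_iff)
  then have "f \<cdot> \<s> c M \<cdot> \<s> M c = g \<cdot> \<s> c M \<cdot> \<s> M c" by (rule arg_cong)
  then show ?thesis by simp
qed

lemma dense_extend_left:
  assumes [simp]: "c \<in> Ob V" "M \<in> Ob V" "d \<in> Ob V"
    and \<gamma>: "\<And>p. p \<in> Ar V \<Longrightarrow> Dom V p \<in> X \<Longrightarrow> Cod V p = c \<Longrightarrow> \<gamma> p \<in> hom V (M \<otimes> Dom V p) d"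
    and nat: "\<And>p f. p \<in> Ar V \<Longrightarrow> Dom V p \<in> X \<Longrightarrow> Cod V p = c \<Longrightarrow> f \<in> Ar V \<Longrightarrow> Dom V f \<in> X \<Longrightarrow>
      Cod V f = Dom V p \<Longrightarrow> \<gamma> (p \<cdot> f) = \<gamma> p \<cdot> \<one> M \<boxtimes> f"
  obtains h where "h \<in> hom V (M \<otimes> c) d"
    "\<And>p. p \<in> Ar V \<Longrightarrow> Dom V p \<in> X \<Longrightarrow> Cod V p = c \<Longrightarrow> h \<cdot> \<one> M \<boxtimes> p = \<gamma> p"
proof -
  note \<gamma>' = \<gamma>[unfolded hom_iff, THEN conjunct1] \<gamma>[unfolded hom_iff, THEN conjunct2, THEN conjunct1]
    \<gamma>[unfolded hom_iff, THEN conjunct2, THEN conjunct2]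
  let ?\<gamma> = "\<lambda>p. curry_ar V (Dom V p) M d (\<gamma> p \<cdot> \<s> (Dom V p) M)"
  have co: "slice_cocone X c (M \<Rrightarrow> d) ?\<gamma>"
    unfolding slice_cocone_def
  proof (intro conjI allI impI)
    fix p f assume [simp]: "p \<in> Ar V" "Dom V p \<in> X" "Cod V p = c" "f \<in> Ar V" "Dom V f \<in> X" "Cod V f = Dom V p"
    have eq: "\<gamma> p \<cdot> \<one> M \<boxtimes> f \<cdot> \<s> (Dom V f) M = \<gamma> p \<cdot> \<s> (Dom V p) M \<cdot> f \<boxtimes> \<one> M"
      by (simp add: \<gamma>' assoc[symmetric] symm_natural)
    show "?\<gamma> (p \<cdot> f) = ?\<gamma> p \<cdot> f"
      by (rule uncurry_inject[of _ "Dom V f" M d]) (simp_all add: \<gamma>' curry_Cmp nat eq)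
  qed (simp_all add: \<gamma>' hom_iff)
  obtain k where k: "k \<in> hom V c (M \<Rrightarrow> d)"
    and kp: "\<And>p. p \<in> Ar V \<Longrightarrow> Dom V p \<in> X \<Longrightarrow> Cod V p = c \<Longrightarrow> k \<cdot> p = ?\<gamma> p"
    by (rule dense_extend[OF assms(1) co]) (rule that)
  note [simp] = k[unfolded hom_iff]
  show thesis
  proof
    show "\<e> M d \<cdot> k \<boxtimes> \<one> M \<cdot> \<s> M c \<in> hom V (M \<otimes> c) d" by (simp add: hom_iff)
    fix p assume p [simp]: "p \<in> Ar V" "Dom V p \<in> X" "Cod V p = c"
    have "\<e> M d \<cdot> k \<boxtimes> \<one> M \<cdot> \<s> M c \<cdot> \<one> M \<boxtimes> p = \<e> M d \<cdot> k \<boxtimes> \<one> M \<cdot> (\<s> M c \<cdot> \<one> M \<boxtimes> p)"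
      by (simp add: assoc)
    also have "\<dots> = \<e> M d \<cdot> (k \<cdot> p) \<boxtimes> \<one> M \<cdot> \<s> M (Dom V p)"
      by (simp add: symm_natural) (simp add: assoc)
    also have "\<dots> = \<gamma> p" by (simp add: kp \<gamma>')
    finally show "\<e> M d \<cdot> k \<boxtimes> \<one> M \<cdot> \<s> M c \<cdot> \<one> M \<boxtimes> p = \<gamma> p" .
  qed
qed

end

section \<open>Colimits of comodules and colimits of underlying objects\<close>

lemma Comod_simps [simp]:
  "Ob (Comod V T) = {m. comodule V T m}" "Dom (Comod V T) t = fst t" "Cod (Comod V T) t = fst (snd t)"
  "t \<in> Ar (Comod V T) \<longleftrightarrow> comodule V T (fst t) \<and> comodule V T (fst (snd t)) \<and>
    comodule_morphism V T (fst t) (fst (snd t)) (snd (snd t))"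
  "Cmp (Comod V T) u t = (fst t, fst (snd u), snd (snd u) \<cdot> snd (snd t))"
  "Idt (Comod V T) m = (m, m, \<one> (fst m))"
  by (auto simp: Comod_def case_prod_beta)

lemma category_Comod:
  assumes T: "comonoid V T"
  shows "category (Comod V T)"
proof -
  have s: "f \<in> Ar V \<and> Dom V f = fst m \<and> Cod V f = fst n" if "comodule_morphism V T m n f" for m n f
    using comodule_morphism_simps[OF that] by simp
  show ?thesis
  proof unfold_locales
    fix f g x y z assume "f \<in> hom (Comod V T) x y" "g \<in> hom (Comod V T) y z"
    then show "Cmp (Comod V T) g f \<in> hom (Comod V T) x z"
      using comodule_morphism_Cmp[OF T, of x y z "snd (snd f)" "snd (snd g)"] by (auto simp: hom_def)
  qed (auto simp: hom_def assoc dest!: s intro!: comodule_morphism_Idt[OF T])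
qed

text \<open>
  Cocones in \<open>V\<close>, rather than in \<open>Comod V T\<close>, on the diagram of Cauchy comodules over \<open>T\<close>.
\<close>

definition cauchy_cocone :: "('o, 'a) comon \<Rightarrow> 'o \<Rightarrow> ('o \<times> 'a \<Rightarrow> 'a \<Rightarrow> 'a) \<Rightarrow> bool" where
  "cauchy_cocone T Z \<gamma> \<longleftrightarrow> Z \<in> Ob V \<and>
    (\<forall>m \<phi>. m \<in> cauchy_comodules V T \<longrightarrow> comodule_morphism V T m (cob T, comult T) \<phi> \<longrightarrow>
       \<gamma> m \<phi> \<in> hom V (fst m) Z) \<and>
    (\<forall>m n \<phi> f. m \<in> cauchy_comodules V T \<longrightarrow> n \<in> cauchy_comodules V T \<longrightarrow>
       comodule_morphism V T n (cob T, comult T) \<phi> \<longrightarrow> comodule_morphism V T m n f \<longrightarrow>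
       \<gamma> m (\<phi> \<cdot> f) = \<gamma> n \<phi> \<cdot> f)"

lemma cauchy_coconeI:
  assumes "Z \<in> Ob V"
    and "\<And>m \<phi>. m \<in> cauchy_comodules V T \<Longrightarrow> comodule_morphism V T m (cob T, comult T) \<phi> \<Longrightarrow>
      \<gamma> m \<phi> \<in> hom V (fst m) Z"
    and "\<And>m n \<phi> f. m \<in> cauchy_comodules V T \<Longrightarrow> n \<in> cauchy_comodules V T \<Longrightarrow>
      comodule_morphism V T n (cob T, comult T) \<phi> \<Longrightarrow> comodule_morphism V T m n f \<Longrightarrow>
      \<gamma> m (\<phi> \<cdot> f) = \<gamma> n \<phi> \<cdot> f"
  shows "cauchy_cocone T Z \<gamma>"
  using assms unfolding cauchy_cocone_def by blast

lemma cauchy_coconeD: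
  assumes "cauchy_cocone T Z \<gamma>"
  shows "Z \<in> Ob V"
    and "m \<in> cauchy_comodules V T \<Longrightarrow> comodule_morphism V T m (cob T, comult T) \<phi> \<Longrightarrow>
      \<gamma> m \<phi> \<in> hom V (fst m) Z"
    and "m \<in> cauchy_comodules V T \<Longrightarrow> n \<in> cauchy_comodules V T \<Longrightarrow>
      comodule_morphism V T n (cob T, comult T) \<phi> \<Longrightarrow> comodule_morphism V T m n f \<Longrightarrow>
      \<gamma> m (\<phi> \<cdot> f) = \<gamma> n \<phi> \<cdot> f"
  using assms unfolding cauchy_cocone_def by blast+

definition factors_cocone :: "('o, 'a) comon \<Rightarrow> 'o \<Rightarrow> ('o \<times> 'a \<Rightarrow> 'a \<Rightarrow> 'a) \<Rightarrow> 'a \<Rightarrow> bool" where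
  "factors_cocone T Z \<gamma> h \<longleftrightarrow> h \<in> hom V (cob T) Z \<and>
    (\<forall>m \<phi>. m \<in> cauchy_comodules V T \<longrightarrow> comodule_morphism V T m (cob T, comult T) \<phi> \<longrightarrow> h \<cdot> \<phi> = \<gamma> m \<phi>)"

lemma factors_coconeI:
  assumes "h \<in> hom V (cob T) Z"
    and "\<And>m \<phi>. m \<in> cauchy_comodules V T \<Longrightarrow> comodule_morphism V T m (cob T, comult T) \<phi> \<Longrightarrow>
      h \<cdot> \<phi> = \<gamma> m \<phi>"
  shows "factors_cocone T Z \<gamma> h"
  using assms unfolding factors_cocone_def by blast

lemma factors_coconeD:
  assumes "factors_cocone T Z \<gamma> h"
  shows "h \<in> hom V (cob T) Z"
    and "m \<in> cauchy_comodules V T \<Longrightarrow> comodule_morphism V T m (cob T, comult T) \<phi> \<Longrightarrow> h \<cdot> \<phi> = \<gamma> m \<phi>"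
  using assms unfolding factors_cocone_def by blast+

text \<open>
  From left to right, a cocone with vertex \<open>Z\<close> in \<open>V\<close> extends to a cocone of comodules with the cofree
  vertex \<open>T \<otimes> Z\<close>. From right to left, the arrow out of \<open>T\<close> that is induced in \<open>V\<close> by a cocone of
  comodules is a comodule morphism, since the equation to be checked may be tested on the cocone.
\<close>

lemma tautological_colimit_Comod_iff:
  assumes T: "comonoid V T"
  shows "tautological_colimit (Comod V T) (cauchy_comodules V T) (cob T, comult T) \<longleftrightarrow>
    (\<forall>Z \<gamma>. cauchy_cocone T Z \<gamma> \<longrightarrow> (\<exists>!h. factors_cocone T Z \<gamma> h))"
proof -
  let ?T = "(cob T, comult T)" and ?X = "cauchy_comodules V T"
  interpret K: category "Comod V T" by (rule category_Comod[OF T])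
  note [simp] = comonoid_simps[OF T]
  have selfcom: "comodule V T ?T" by (rule comodule_self[OF T])
  have X: "comodule V T m" if "m \<in> ?X" for m using that by (simp add: cauchy_comodules_def)
  show ?thesis
  proof (subst K.tautological_colimit_iff, use selfcom in simp, intro iffI allI impI)
    fix Z \<gamma>
    assume colim: "\<forall>d \<gamma>. K.slice_cocone ?X ?T d \<gamma> \<longrightarrow>
      (\<exists>!h. h \<in> hom (Comod V T) ?T d \<and> (\<forall>\<phi>. \<phi> \<in> Ar (Comod V T) \<longrightarrow> Dom (Comod V T) \<phi> \<in> ?X \<longrightarrow>
         Cod (Comod V T) \<phi> = ?T \<longrightarrow> Cmp (Comod V T) h \<phi> = \<gamma> \<phi>))"
      and co: "cauchy_cocone T Z \<gamma>"
    have Z [simp]: "Z \<in> Ob V" by (rule cauchy_coconeD(1)[OF co])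
    have g: "\<gamma> m \<phi> \<in> Ar V" "Dom V (\<gamma> m \<phi>) = fst m" "Cod V (\<gamma> m \<phi>) = Z"
      if "m \<in> ?X" "comodule_morphism V T m ?T \<phi>" for m \<phi>
      using cauchy_coconeD(2)[OF co that] by (simp_all add: hom_iff)
    define D where "D = comod_tns T ?T Z"
    have D: "comodule V T D" unfolding D_def by (rule comodule_tns[OF T selfcom Z])
    \<comment> \<open>Cofree extension of arrows into \<open>Z\<close>.\<close>
    define cf where "cf = (\<lambda>(m :: 'o \<times> 'a) g. \<one> (cob T) \<boxtimes> g \<cdot> snd m)"
    have cf: "comodule_morphism V T m D (cf m g)" "\<l> Z \<cdot> counit T \<boxtimes> \<one> Z \<cdot> cf m g = g"
      if "comodule V T m" "g \<in> hom V (fst m) Z" for m g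
      unfolding cf_def D_def using cofree_morphism[OF T that] counit_cofree[OF T that] by simp_all
    have cf_nat: "cf n g \<cdot> f = cf m (g \<cdot> f)"
      if "comodule V T m" "comodule V T n" "comodule_morphism V T m n f" "g \<in> hom V (fst n) Z" for m n g f
    proof -
      note [simp] = comodule_simps[OF that(1)] comodule_simps[OF that(2)]
        comodule_morphism_simps(1-3)[OF that(3)] that(4)[unfolded hom_iff]
      have "cf n g \<cdot> f = \<one> (cob T) \<boxtimes> g \<cdot> (snd n \<cdot> f)" by (simp add: cf_def assoc)
      also have "\<dots> = cf m (g \<cdot> f)"
        by (subst comodule_morphism_simps(4)[OF that(3)]) (simp add: cf_def assoc)
      finally show ?thesis .
    qed
    let ?\<gamma> = "\<lambda>t. (fst t, D, cf (fst t) (\<gamma> (fst t) (snd (snd t))))"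
    have "K.slice_cocone ?X ?T D ?\<gamma>"
      unfolding K.slice_cocone_def
    proof (intro conjI allI impI)
      fix t assume t: "t \<in> Ar (Comod V T)" "Dom (Comod V T) t \<in> ?X" "Cod (Comod V T) t = ?T"
      then show "?\<gamma> t \<in> hom (Comod V T) (Dom (Comod V T) t) D"
        by (auto simp: hom_def D intro!: cf g)
    next
      fix t u assume t: "t \<in> Ar (Comod V T)" "Dom (Comod V T) t \<in> ?X" "Cod (Comod V T) t = ?T"
        "u \<in> Ar (Comod V T)" "Dom (Comod V T) u \<in> ?X" "Cod (Comod V T) u = Dom (Comod V T) t"
      have "\<gamma> (fst u) (snd (snd t) \<cdot> snd (snd u)) = \<gamma> (fst t) (snd (snd t)) \<cdot> snd (snd u)"
        by (rule cauchy_coconeD(3)[OF co]) (use t in simp_all)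
      moreover have "cf (fst t) (\<gamma> (fst t) (snd (snd t))) \<cdot> snd (snd u)
          = cf (fst u) (\<gamma> (fst t) (snd (snd t)) \<cdot> snd (snd u))"
        by (rule cf_nat) (use t in \<open>auto simp: hom_iff g\<close>)
      ultimately show "?\<gamma> (Cmp (Comod V T) t u) = Cmp (Comod V T) (?\<gamma> t) u" by simp
    qed (use D in simp)
    with colim have "\<exists>!h. h \<in> hom (Comod V T) ?T D \<and> (\<forall>\<phi>. \<phi> \<in> Ar (Comod V T) \<longrightarrow> Dom (Comod V T) \<phi> \<in> ?X \<longrightarrow>
      Cod (Comod V T) \<phi> = ?T \<longrightarrow> Cmp (Comod V T) h \<phi> = ?\<gamma> \<phi>)" by blast
    then obtain h where Ph: "h \<in> hom (Comod V T) ?T D \<and> (\<forall>\<phi>. \<phi> \<in> Ar (Comod V T) \<longrightarrow> Dom (Comod V T) \<phi> \<in> ?X \<longrightarrow>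
      Cod (Comod V T) \<phi> = ?T \<longrightarrow> Cmp (Comod V T) h \<phi> = ?\<gamma> \<phi>)"
      and uniq: "\<forall>h'. h' \<in> hom (Comod V T) ?T D \<and> (\<forall>\<phi>. \<phi> \<in> Ar (Comod V T) \<longrightarrow> Dom (Comod V T) \<phi> \<in> ?X \<longrightarrow>
      Cod (Comod V T) \<phi> = ?T \<longrightarrow> Cmp (Comod V T) h' \<phi> = ?\<gamma> \<phi>) \<longrightarrow> h' = h"
      by (rule ex1E)
    have h: "h \<in> hom (Comod V T) ?T D" using Ph by blast
    have hf: "Cmp (Comod V T) h \<phi> = ?\<gamma> \<phi>"
      if "\<phi> \<in> Ar (Comod V T)" "Dom (Comod V T) \<phi> \<in> ?X" "Cod (Comod V T) \<phi> = ?T" for \<phi>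
      using Ph that by blast
    define k where "k = snd (snd h)"
    have hk: "h = (?T, D, k)" and k: "comodule_morphism V T ?T D k"
      using h by (cases h; auto simp: k_def hom_def)+
    note [simp] = comodule_morphism_simps(1-3)[OF k]
    have kf: "k \<cdot> \<phi> = cf m (\<gamma> m \<phi>)" if "m \<in> ?X" "comodule_morphism V T m ?T \<phi>" for m \<phi>
      using hf[of "(m, ?T, \<phi>)"] that X selfcom by (simp add: hk)
    show "\<exists>!h. factors_cocone T Z \<gamma> h"
    proof (intro ex1I[of _ "\<l> Z \<cdot> counit T \<boxtimes> \<one> Z \<cdot> k"])
      have [simp]: "fst D = cob T \<otimes> Z" by (simp add: D_def comod_tns_def)
      show "factors_cocone T Z \<gamma> (\<l> Z \<cdot> counit T \<boxtimes> \<one> Z \<cdot> k)"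
      proof (rule factors_coconeI)
        fix m \<phi> assume m: "m \<in> ?X" "comodule_morphism V T m ?T \<phi>"
        note [simp] = comodule_morphism_simps(1-3)[OF m(2)]
        have "\<l> Z \<cdot> counit T \<boxtimes> \<one> Z \<cdot> k \<cdot> \<phi> = \<l> Z \<cdot> counit T \<boxtimes> \<one> Z \<cdot> (k \<cdot> \<phi>)"
          by (simp add: assoc)
        then show "\<l> Z \<cdot> counit T \<boxtimes> \<one> Z \<cdot> k \<cdot> \<phi> = \<gamma> m \<phi>"
          using m X by (simp add: kf cf hom_iff g)
      qed (simp add: hom_iff)
      fix h' assume h': "factors_cocone T Z \<gamma> h'"
      then have h'_hom: "h' \<in> hom V (fst ?T) Z" using factors_coconeD(1)[OF h'] by simp
      have "(?T, D, cf ?T h') = h"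
      proof (rule uniq[rule_format])
        have eq: "cf ?T h' \<cdot> snd (snd t) = cf (fst t) (\<gamma> (fst t) (snd (snd t)))"
          if "t \<in> Ar (Comod V T)" "Dom (Comod V T) t \<in> ?X" "Cod (Comod V T) t = ?T" for t
          using that factors_coconeD(2)[OF h', of "fst t" "snd (snd t)"]
            cf_nat[of "fst t" ?T "snd (snd t)" h'] selfcom h'_hom
          by simp
        show "(?T, D, cf ?T h') \<in> hom (Comod V T) ?T D \<and> (\<forall>\<phi>. \<phi> \<in> Ar (Comod V T) \<longrightarrow> Dom (Comod V T) \<phi> \<in> ?X \<longrightarrow>
         Cod (Comod V T) \<phi> = ?T \<longrightarrow> Cmp (Comod V T) (?T, D, cf ?T h') \<phi> = ?\<gamma> \<phi>)"
        proof (intro conjI allI impI)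
          show "(?T, D, cf ?T h') \<in> hom (Comod V T) ?T D"
            using cf(1)[OF selfcom h'_hom] D selfcom by (simp add: hom_def)
          fix t assume "t \<in> Ar (Comod V T)" "Dom (Comod V T) t \<in> ?X" "Cod (Comod V T) t = ?T"
          from eq[OF this] show "Cmp (Comod V T) (?T, D, cf ?T h') t = ?\<gamma> t" by simp
        qed
      qed
      then have "cf ?T h' = k" by (simp add: hk)
      then show "h' = \<l> Z \<cdot> counit T \<boxtimes> \<one> Z \<cdot> k" using cf(2)[OF selfcom h'_hom] by simp
    qed
  next
    fix d \<gamma>
    assume colim: "\<forall>Z \<gamma>. cauchy_cocone T Z \<gamma> \<longrightarrow> (\<exists>!h. factors_cocone T Z \<gamma> h)"
      and co: "K.slice_cocone ?X ?T d \<gamma>"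
    have d: "comodule V T d" using co by (simp add: K.slice_cocone_def)
    note [simp] = comodule_simps[OF d]
    define g where "g = (\<lambda>m \<phi>. snd (snd (\<gamma> (m, ?T, \<phi>))))"
    have \<gamma>: "\<gamma> (m, ?T, \<phi>) = (m, d, g m \<phi>)" and g: "comodule_morphism V T m d (g m \<phi>)"
      if "m \<in> ?X" "comodule_morphism V T m ?T \<phi>" for m \<phi>
    proof -
      have "\<gamma> (m, ?T, \<phi>) \<in> hom (Comod V T) m d"
        using K.slice_coconeD(2)[OF co, of "(m, ?T, \<phi>)"] that X selfcom by simp
      then show "\<gamma> (m, ?T, \<phi>) = (m, d, g m \<phi>)" "comodule_morphism V T m d (g m \<phi>)"
        by (cases "\<gamma> (m, ?T, \<phi>)"; auto simp: g_def hom_def)+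
    qed
    have nat: "g m (\<phi> \<cdot> f) = g n \<phi> \<cdot> f"
      if "m \<in> ?X" "n \<in> ?X" "comodule_morphism V T n ?T \<phi>" "comodule_morphism V T m n f" for m n \<phi> f
    proof -
      have "\<gamma> (Cmp (Comod V T) (n, ?T, \<phi>) (m, n, f)) = Cmp (Comod V T) (\<gamma> (n, ?T, \<phi>)) (m, n, f)"
        by (rule K.slice_coconeD(3)[OF co]) (use that X selfcom in simp_all)
      then show ?thesis using that by (simp add: g_def)
    qed
    have co1: "cauchy_cocone T (fst d) g"
      by (rule cauchy_coconeI) (simp_all add: nat hom_iff comodule_morphism_simps(1-3)[OF g])
    then obtain h where h: "factors_cocone T (fst d) g h"
      and uniq: "\<And>h'. factors_cocone T (fst d) g h' \<Longrightarrow> h' = h"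
      using colim by blast
    have [simp]: "h \<in> Ar V" "Dom V h = cob T" "Cod V h = fst d"
      using factors_coconeD(1)[OF h] by (simp_all add: hom_iff)
    have hg: "h \<cdot> \<phi> = g m \<phi>" if "m \<in> ?X" "comodule_morphism V T m ?T \<phi>" for m \<phi>
      by (rule factors_coconeD(2)[OF h that])
    let ?g = "\<lambda>m \<phi>. snd d \<cdot> g m \<phi>"
    have "cauchy_cocone T (cob T \<otimes> fst d) ?g"
      by (rule cauchy_coconeI)
        (simp_all add: nat hom_iff comodule_morphism_simps(1-3)[OF g] comodule_morphism_simps(1-3) assoc)
    moreover have "factors_cocone T (cob T \<otimes> fst d) ?g (snd d \<cdot> h)"
    proof (rule factors_coconeI)
      fix m \<phi> assume m: "m \<in> ?X" "comodule_morphism V T m ?T \<phi>"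
      note [simp] = comodule_morphism_simps(1-3)[OF m(2)]
      show "snd d \<cdot> h \<cdot> \<phi> = snd d \<cdot> g m \<phi>" using hg[OF m] by (simp add: assoc[symmetric])
    qed (simp add: hom_iff)
    moreover have "factors_cocone T (cob T \<otimes> fst d) ?g (\<one> (cob T) \<boxtimes> h \<cdot> comult T)"
    proof (rule factors_coconeI)
      fix m \<phi> assume m: "m \<in> ?X" "comodule_morphism V T m ?T \<phi>"
      note [simp] = comodule_morphism_simps(1-3)[OF m(2)] comodule_simps[OF X[OF m(1)]]
      have "\<one> (cob T) \<boxtimes> h \<cdot> comult T \<cdot> \<phi> = \<one> (cob T) \<boxtimes> h \<cdot> (comult T \<cdot> \<phi>)" by (simp add: assoc)
      also have "\<dots> = \<one> (cob T) \<boxtimes> (h \<cdot> \<phi>) \<cdot> snd m"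
        using comodule_morphism_simps(4)[OF m(2)] by (simp add: assoc)
      also have "\<dots> = snd d \<cdot> g m \<phi>"
        using comodule_morphism_simps(4)[OF g[OF m]] by (simp add: hg[OF m])
      finally show "\<one> (cob T) \<boxtimes> h \<cdot> comult T \<cdot> \<phi> = snd d \<cdot> g m \<phi>" .
    qed (simp add: hom_iff)
    ultimately have "snd d \<cdot> h = \<one> (cob T) \<boxtimes> h \<cdot> comult T" using colim by blast
    then have hmor: "comodule_morphism V T ?T d h" by (simp add: comodule_morphism_iff hom_iff)
    show "\<exists>!h. h \<in> hom (Comod V T) ?T d \<and> (\<forall>\<phi>. \<phi> \<in> Ar (Comod V T) \<longrightarrow> Dom (Comod V T) \<phi> \<in> ?X \<longrightarrow>
         Cod (Comod V T) \<phi> = ?T \<longrightarrow> Cmp (Comod V T) h \<phi> = \<gamma> \<phi>)"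
    proof (intro ex1I[of _ "(?T, d, h)"] conjI allI impI)
      show "(?T, d, h) \<in> hom (Comod V T) ?T d" using selfcom d hmor by (simp add: hom_def)
      fix t assume t: "t \<in> Ar (Comod V T)" "Dom (Comod V T) t \<in> ?X" "Cod (Comod V T) t = ?T"
      then have "t = (fst t, ?T, snd (snd t))" by (cases t) auto
      then show "Cmp (Comod V T) (?T, d, h) t = \<gamma> t"
        using \<gamma>[of "fst t" "snd (snd t)"] t hg[of "fst t" "snd (snd t)"] by simp
    next
      fix k assume k: "k \<in> hom (Comod V T) ?T d \<and> (\<forall>\<phi>. \<phi> \<in> Ar (Comod V T) \<longrightarrow> Dom (Comod V T) \<phi> \<in> ?X \<longrightarrow>
         Cod (Comod V T) \<phi> = ?T \<longrightarrow> Cmp (Comod V T) k \<phi> = \<gamma> \<phi>)"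
      have "factors_cocone T (fst d) g (snd (snd k))"
      proof (rule factors_coconeI)
        show "snd (snd k) \<in> hom V (cob T) (fst d)"
          using k comodule_morphism_simps[of T ?T d "snd (snd k)"] by (auto simp: hom_def)
        fix m \<phi> assume m: "m \<in> ?X" "comodule_morphism V T m ?T \<phi>"
        have "Cmp (Comod V T) k (m, ?T, \<phi>) = \<gamma> (m, ?T, \<phi>)"
          by (rule k[THEN conjunct2, rule_format]) (use m X selfcom in simp_all)
        then show "snd (snd k) \<cdot> \<phi> = g m \<phi>" using \<gamma>[OF m] by simp
      qed
      then have "snd (snd k) = h" by (rule uniq)
      then show "k = (?T, d, h)" using k by (cases k) (auto simp: hom_def)
    qed
  qed
qed

text \<open>
  The inverse in \<open>V\<close> of a comonoid morphism is automatically a comonoid morphism.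
\<close>

lemma is_iso_Comon_iff:
  assumes L: "comonoid V L" and T: "comonoid V T" and \<nu>: "comonoid_morphism V L T \<nu>"
  shows "is_iso (Comon V) (L, T, \<nu>) \<longleftrightarrow>
    (\<exists>\<mu>. \<mu> \<in> hom V (cob T) (cob L) \<and> \<mu> \<cdot> \<nu> = \<one> (cob L) \<and> \<nu> \<cdot> \<mu> = \<one> (cob T))" (is "?iso \<longleftrightarrow> ?inv")
proof
  assume ?iso
  then obtain t where "inverse_arrows (Comon V) (L, T, \<nu>) t" by (auto simp: is_iso_def)
  then show ?inv
    by (auto simp: inverse_arrows_def Comon_def hom_def comonoid_morphism_def case_prod_beta)
next
  assume ?inv
  then obtain \<mu> where \<mu>: "\<mu> \<in> hom V (cob T) (cob L)" and inv: "\<mu> \<cdot> \<nu> = \<one> (cob L)" "\<nu> \<cdot> \<mu> = \<one> (cob T)" by blast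
  note [simp] = comonoid_simps[OF L] comonoid_simps[OF T] \<mu>[unfolded hom_iff]
  have [simp]: "\<nu> \<in> Ar V" "Dom V \<nu> = cob L" "Cod V \<nu> = cob T"
    using \<nu> by (auto simp: comonoid_morphism_def hom_iff)
  have "comult L \<cdot> \<mu> = (\<mu> \<cdot> \<nu>) \<boxtimes> (\<mu> \<cdot> \<nu>) \<cdot> comult L \<cdot> \<mu>" by (simp add: inv)
  also have "\<dots> = \<mu> \<boxtimes> \<mu> \<cdot> (\<nu> \<boxtimes> \<nu> \<cdot> comult L) \<cdot> \<mu>" by (simp add: assoc)
  also have "\<nu> \<boxtimes> \<nu> \<cdot> comult L = comult T \<cdot> \<nu>" using \<nu> by (simp add: comonoid_morphism_def)
  also have "\<mu> \<boxtimes> \<mu> \<cdot> (comult T \<cdot> \<nu>) \<cdot> \<mu> = \<mu> \<boxtimes> \<mu> \<cdot> comult T \<cdot> (\<nu> \<cdot> \<mu>)" by (simp add: assoc)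
  finally have 1: "comult L \<cdot> \<mu> = \<mu> \<boxtimes> \<mu> \<cdot> comult T" by (simp add: inv)
  have "counit L \<cdot> \<mu> = counit T \<cdot> \<nu> \<cdot> \<mu>" using \<nu> by (simp add: comonoid_morphism_def)
  also have "\<dots> = counit T" using inv by (simp add: assoc[symmetric])
  finally have "comonoid_morphism V T L \<mu>" using 1 by (simp add: comonoid_morphism_def hom_iff)
  then have "inverse_arrows (Comon V) (L, T, \<nu>) (T, L, \<mu>)"
    using L T \<nu> inv by (simp add: inverse_arrows_def Comon_def hom_def)
  then show ?iso by (auto simp: is_iso_def)
qed

section \<open>Enriched dinaturality in terms of comodule morphisms\<close>

lemma ihom_simps:
  assumes [simp]: "comonoid V T" and m: "comodule V T m" and n: "comodule V T n"
  shows "ihom_tns V (cob T) (fst m) (fst n) \<in> Ar V"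
    "Dom V (ihom_tns V (cob T) (fst m) (fst n)) = fst m \<Rrightarrow> fst n"
    "Cod V (ihom_tns V (cob T) (fst m) (fst n)) = cob T \<otimes> fst m \<Rrightarrow> cob T \<otimes> fst n"
    "ihom_pre V (snd m) (cob T \<otimes> fst n) \<in> Ar V"
    "Dom V (ihom_pre V (snd m) (cob T \<otimes> fst n)) = cob T \<otimes> fst m \<Rrightarrow> cob T \<otimes> fst n"
    "Cod V (ihom_pre V (snd m) (cob T \<otimes> fst n)) = fst m \<Rrightarrow> cob T \<otimes> fst n"
    "ihom_post V (fst m) (snd n) \<in> Ar V"
    "Dom V (ihom_post V (fst m) (snd n)) = fst m \<Rrightarrow> fst n"
    "Cod V (ihom_post V (fst m) (snd n)) = fst m \<Rrightarrow> cob T \<otimes> fst n"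
  using comodule_simps[OF m] comodule_simps[OF n]
  by (simp_all add: ihom_tns_def ihom_pre_def ihom_post_def)

end

text \<open>
  The enriched category of Cauchy comodules, restricted to a set \<open>S\<close> of them.
\<close>

locale comodule_enrichment = symmetric_monoidal_closed V
  for V :: "('o, 'a, 'z) smc_scheme" (structure) +
  fixes T :: "('o, 'a) comon" and S :: "('o \<times> 'a) set" and A :: "('o \<times> 'a, 'o, 'a) vcat"
    and Wh :: "'o \<times> 'a \<Rightarrow> 'o \<times> 'a \<Rightarrow> 'a"
  assumes T: "comonoid V T" and S: "S \<subseteq> cauchy_comodules V T"
    and A: "is_comodule_vcat V T S A Wh"
begin

lemma vOb_A: "vOb A = S"
  using A by (simp add: is_comodule_vcat_def)

lemma S_simps:
  assumes "m \<in> S"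
  shows "comodule V T m" "fst m \<in> dualizable V"
  using assms S by (auto simp: cauchy_comodules_def)

lemma hom_object_simps:
  assumes "m \<in> S" "n \<in> S"
  shows "vHom A m n \<in> Ob V" "Wh m n \<in> Ar V" "Dom V (Wh m n) = vHom A m n"
    "Cod V (Wh m n) = fst m \<Rrightarrow> fst n"
proof -
  have "vfunctor V A (Vc V) fst Wh" using A by (simp add: is_comodule_vcat_def)
  then show "vHom A m n \<in> Ob V" "Wh m n \<in> Ar V" "Dom V (Wh m n) = vHom A m n"
    "Cod V (Wh m n) = fst m \<Rrightarrow> fst n"
    using assms unfolding vfunctor_def vcategory_def vOb_A by (auto simp: hom_iff Vc_def)
qed

lemma hom_object_equalizer:
  assumes "m \<in> S" "n \<in> S"
  shows "is_equalizer V (ihom_pre V (snd m) (cob T \<otimes> fst n) \<cdot> ihom_tns V (cob T) (fst m) (fst n))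
    (ihom_post V (fst m) (snd n)) (vHom A m n) (Wh m n)"
  using A assms by (cases m, cases n) (fastforce simp: is_comodule_vcat_def)

text \<open>
  Arrows \<open>y \<rightarrow> A(M, N)\<close> are the same as comodule morphisms \<open>M \<otimes> y \<rightarrow> N\<close>: each of the following two
  lemmas is one direction.
\<close>

lemma hom_object_morphism:
  assumes m: "m \<in> S" and n: "n \<in> S" and j: "j \<in> hom V y (vHom A m n)"
  shows "comodule_morphism V T (comod_tns T m y) n (\<e> (fst m) (fst n) \<cdot> (Wh m n \<cdot> j) \<boxtimes> \<one> (fst m) \<cdot> \<s> (fst m) y)"
proof -
  note [simp] = S_simps(1)[OF m] S_simps(1)[OF n] hom_object_simps[OF m n] j[unfolded hom_iff]
    ihom_simps[OF T S_simps(1)[OF m] S_simps(1)[OF n]]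
  let ?f = "ihom_pre V (snd m) (cob T \<otimes> fst n) \<cdot> ihom_tns V (cob T) (fst m) (fst n)"
    and ?g = "ihom_post V (fst m) (snd n)"
  have "?f \<cdot> Wh m n = ?g \<cdot> Wh m n"
    using hom_object_equalizer[OF m n] by (simp add: is_equalizer_def)
  then have "?f \<cdot> Wh m n \<cdot> j = ?g \<cdot> Wh m n \<cdot> j" by simp
  then have "?f \<cdot> (Wh m n \<cdot> j) = ?g \<cdot> (Wh m n \<cdot> j)" by (simp add: assoc)
  then show ?thesis
    by (subst equalizes_iff_comodule_morphism[symmetric]) (simp_all add: T hom_iff)
qed

lemma hom_object_lift:
  assumes m: "m \<in> S" and n: "n \<in> S" and [simp]: "y \<in> Ob V"
    and u: "comodule_morphism V T (comod_tns T m y) n u"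
  obtains j where "j \<in> hom V y (vHom A m n)"
    "\<e> (fst m) (fst n) \<cdot> (Wh m n \<cdot> j) \<boxtimes> \<one> (fst m) \<cdot> \<s> (fst m) y = u"
proof -
  let ?M = "fst m" and ?N = "fst n"
  note [simp] = S_simps(1)[OF m] S_simps(1)[OF n] hom_object_simps[OF m n]
    comodule_simps[OF S_simps(1)[OF m]] comodule_simps[OF S_simps(1)[OF n]]
    ihom_simps[OF T S_simps(1)[OF m] S_simps(1)[OF n]]
  have [simp]: "u \<in> Ar V" "Dom V u = ?M \<otimes> y" "Cod V u = ?N"
    using comodule_morphism_simps[OF u] by (simp_all add: comod_tns_def)
  let ?f = "ihom_pre V (snd m) (cob T \<otimes> fst n) \<cdot> ihom_tns V (cob T) (fst m) (fst n)"
    and ?g = "ihom_post V (fst m) (snd n)"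
  define k where "k = curry_ar V y ?M ?N (u \<cdot> \<s> y ?M)"
  have k: "k \<in> hom V y (?M \<Rrightarrow> ?N)" by (simp add: k_def hom_iff)
  have ku: "\<e> ?M ?N \<cdot> k \<boxtimes> \<one> ?M \<cdot> \<s> ?M y = u" by (simp add: k_def)
  have "?f \<cdot> k = ?g \<cdot> k"
    using equalizes_iff_comodule_morphism[OF T S_simps(1)[OF m] S_simps(1)[OF n] k] u ku by simp
  moreover have "k \<in> hom V y (Dom V ?f)" using k by simp
  ultimately have "\<exists>!j. j \<in> hom V y (vHom A m n) \<and> Wh m n \<cdot> j = k"
    using hom_object_equalizer[OF m n] unfolding is_equalizer_def by blast
  then obtain j where "j \<in> hom V y (vHom A m n)" "Wh m n \<cdot> j = k" by blast
  then show thesis using ku that by blast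
qed

text \<open>
  Evaluating the two actions on generalized elements: \<open>j : y \<rightarrow> A(M, N)\<close>, which corresponds to
  \<open>u : M \<otimes> y \<rightarrow> N\<close>, and an arrow into \<open>N\<^sup>\<or>\<close>. The covariant action applies \<open>u\<close>; the contravariant one
  precomposes the pairing \<open>q\<close> with \<open>u\<close>. Both leave behind the same invertible factor, which only
  reorders \<open>y\<close>, \<open>M\<close> and \<open>z\<close>.
\<close>

lemma act_cov_apply:
  assumes m: "m \<in> S" and n: "n \<in> S" and j: "j \<in> hom V y (vHom A m n)"
    and t: "t \<in> hom V z (dual V (fst n))"
    and u: "u = \<e> (fst m) (fst n) \<cdot> (Wh m n \<cdot> j) \<boxtimes> \<one> (fst m) \<cdot> \<s> (fst m) y"
  shows "act_cov V A fst Wh m n \<cdot> j \<boxtimes> (\<one> (fst m) \<boxtimes> t)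
    = \<one> (fst n) \<boxtimes> t \<cdot> u \<boxtimes> \<one> z \<cdot> (\<s> y (fst m) \<boxtimes> \<one> z \<cdot> \<a>' y (fst m) z)"
proof -
  let ?M = "fst m" and ?N = "fst n" and ?H = "vHom A m n"
  note [simp] = S_simps(1)[OF m] S_simps(1)[OF n] hom_object_simps[OF m n]
    comodule_simps[OF S_simps(1)[OF m]] comodule_simps[OF S_simps(1)[OF n]]
    dual_data_simps[OF S_simps(2)[OF n]] j[unfolded hom_iff] t[unfolded hom_iff]
  have [simp]: "y \<in> Ob V" "z \<in> Ob V" using Ob_simps(1)[of j] Ob_simps(1)[of t] by simp_all
  have "act_cov V A fst Wh m n \<cdot> j \<boxtimes> (\<one> ?M \<boxtimes> t)
    = (\<e> ?M ?N \<cdot> Wh m n \<boxtimes> \<one> ?M) \<boxtimes> \<one> (dual V ?N) \<cdot> (\<a>' ?H ?M (dual V ?N) \<cdot> j \<boxtimes> (\<one> ?M \<boxtimes> t))"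
    by (simp add: act_cov_def assoc)
  also have "\<dots> = (\<e> ?M ?N \<cdot> (Wh m n \<cdot> j) \<boxtimes> \<one> ?M) \<boxtimes> t \<cdot> \<a>' y ?M z"
    by (simp add: assc'_natural) (simp add: assoc)
  also have "\<dots> = \<one> ?N \<boxtimes> t \<cdot> u \<boxtimes> \<one> z \<cdot> (\<s> y ?M \<boxtimes> \<one> z \<cdot> \<a>' y ?M z)"
    by (simp add: u assoc)
  finally show ?thesis .
qed

lemma act_con_apply:
  assumes m: "m \<in> S" and n: "n \<in> S" and j: "j \<in> hom V y (vHom A m n)"
    and q: "q \<in> hom V (fst n \<otimes> z) \<I>" and z [simp]: "z \<in> Ob V"
    and u: "u = \<e> (fst m) (fst n) \<cdot> (Wh m n \<cdot> j) \<boxtimes> \<one> (fst m) \<cdot> \<s> (fst m) y"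
  shows "act_con V A fst Wh m n \<cdot> j \<boxtimes> (\<one> (fst m) \<boxtimes> transpose (fst n) z q)
    = \<one> (fst m) \<boxtimes> transpose (fst m) (y \<otimes> z) (q \<cdot> u \<boxtimes> \<one> z \<cdot> \<a>' (fst m) y z) \<cdot> \<a> (fst m) y z
        \<cdot> (\<s> y (fst m) \<boxtimes> \<one> z \<cdot> \<a>' y (fst m) z)"
proof -
  let ?M = "fst m" and ?N = "fst n" and ?H = "vHom A m n" and ?N' = "dual V (fst n)"
  note M = S_simps(2)[OF m] and N = S_simps(2)[OF n]
  note [simp] = S_simps(1)[OF m] S_simps(1)[OF n] hom_object_simps[OF m n]
    comodule_simps[OF S_simps(1)[OF m]] comodule_simps[OF S_simps(1)[OF n]]
    dual_data_simps[OF M] dual_data_simps[OF N] j[unfolded hom_iff] q[unfolded hom_iff]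
    transpose_simps[OF M] transpose_simps[OF N]
  define t where "t = transpose ?N z q"
  define w where "w = Wh m n \<cdot> j"
  have t [simp]: "t \<in> Ar V" "Dom V t = z" "Cod V t = ?N'" by (simp_all add: t_def)
  have y [simp]: "y \<in> Ob V" using Ob_simps(1)[of j] by simp
  have w [simp]: "w \<in> Ar V" "Dom V w = y" "Cod V w = ?M \<Rrightarrow> ?N" by (simp_all add: w_def)
  have u' [simp]: "u \<in> Ar V" "Dom V u = ?M \<otimes> y" "Cod V u = ?N" by (simp_all add: u)
  define E where "E = evd V ?N \<cdot> (\<e> ?M ?N \<cdot> \<s> ?M (?M \<Rrightarrow> ?N)) \<boxtimes> \<one> ?N' \<cdot> \<a>' ?M (?M \<Rrightarrow> ?N) ?N'"
  have E [simp]: "E \<in> Ar V" "Dom V E = ?M \<otimes> ((?M \<Rrightarrow> ?N) \<otimes> ?N')" "Cod V E = \<I>"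
    by (simp_all add: E_def)
  have da: "dual_act V ?M ?N = transpose ?M ((?M \<Rrightarrow> ?N) \<otimes> ?N') E"
    unfolding E_def by (rule dual_act_eq_transpose[OF M N])
  have "E \<cdot> \<one> ?M \<boxtimes> (w \<boxtimes> t)
    = evd V ?N \<cdot> (\<e> ?M ?N \<cdot> \<s> ?M (?M \<Rrightarrow> ?N)) \<boxtimes> \<one> ?N' \<cdot> (\<a>' ?M (?M \<Rrightarrow> ?N) ?N' \<cdot> \<one> ?M \<boxtimes> (w \<boxtimes> t))"
    by (simp add: E_def assoc)
  also have "\<dots> = evd V ?N \<cdot> (\<e> ?M ?N \<cdot> (\<s> ?M (?M \<Rrightarrow> ?N) \<cdot> \<one> ?M \<boxtimes> w)) \<boxtimes> t \<cdot> \<a>' ?M y z"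
    by (simp add: assc'_natural) (simp add: assoc)
  also have "\<dots> = evd V ?N \<cdot> u \<boxtimes> t \<cdot> \<a>' ?M y z"
    by (simp add: symm_natural) (simp add: u w_def[symmetric] assoc)
  also have "\<dots> = (evd V ?N \<cdot> \<one> ?N \<boxtimes> t) \<cdot> u \<boxtimes> \<one> z \<cdot> \<a>' ?M y z" by simp
  also have "evd V ?N \<cdot> \<one> ?N \<boxtimes> t = q" unfolding t_def by (rule evd_transpose[OF N]) simp_all
  finally have Ewt: "E \<cdot> \<one> ?M \<boxtimes> (w \<boxtimes> t) = q \<cdot> u \<boxtimes> \<one> z \<cdot> \<a>' ?M y z" .
  have da_simps [simp]: "dual_act V ?M ?N \<in> Ar V" "Dom V (dual_act V ?M ?N) = (?M \<Rrightarrow> ?N) \<otimes> ?N'"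
    "Cod V (dual_act V ?M ?N) = dual V ?M" by (simp_all add: da)
  have tr: "dual_act V ?M ?N \<cdot> w \<boxtimes> t = transpose ?M (y \<otimes> z) (q \<cdot> u \<boxtimes> \<one> z \<cdot> \<a>' ?M y z)"
    unfolding da Ewt[symmetric] by (rule transpose_natural[OF M]) simp_all
  have "act_con V A fst Wh m n \<cdot> j \<boxtimes> (\<one> ?M \<boxtimes> t)
    = \<one> ?M \<boxtimes> (dual_act V ?M ?N \<cdot> Wh m n \<boxtimes> \<one> ?N') \<cdot> \<a> ?M ?H ?N' \<cdot> \<s> ?H ?M \<boxtimes> \<one> ?N'
        \<cdot> (\<a>' ?H ?M ?N' \<cdot> j \<boxtimes> (\<one> ?M \<boxtimes> t))"
    by (simp add: act_con_def assoc)
  also have "\<dots> = \<one> ?M \<boxtimes> (dual_act V ?M ?N \<cdot> Wh m n \<boxtimes> \<one> ?N') \<cdot> \<a> ?M ?H ?N'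
        \<cdot> (\<s> ?H ?M \<cdot> j \<boxtimes> \<one> ?M) \<boxtimes> t \<cdot> \<a>' y ?M z"
    by (simp add: assc'_natural) (simp add: assoc)
  also have "\<dots> = \<one> ?M \<boxtimes> (dual_act V ?M ?N \<cdot> Wh m n \<boxtimes> \<one> ?N') \<cdot> (\<a> ?M ?H ?N'
        \<cdot> \<one> ?M \<boxtimes> j \<boxtimes> t) \<cdot> \<s> y ?M \<boxtimes> \<one> z \<cdot> \<a>' y ?M z"
    by (simp add: symm_natural) (simp add: assoc)
  also have "\<dots> = \<one> ?M \<boxtimes> (dual_act V ?M ?N \<cdot> w \<boxtimes> t) \<cdot> \<a> ?M y z \<cdot> (\<s> y ?M \<boxtimes> \<one> z \<cdot> \<a>' y ?M z)"
    by (simp add: assc_natural) (simp add: assoc w_def)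
  finally show ?thesis unfolding tr unfolding t_def .
qed

text \<open>
  In terms of elements, with \<open>\<langle>v, f\<rangle>\<close> for the value of \<open>\<kappa>\<close> at a vector \<open>v\<close> and a functional \<open>f\<close>:
  \<open>\<langle>u(v, y), q(-, z)\<rangle> = \<langle>v, q(u(-, y), z)\<rangle>\<close>. No symmetry and no hom-object occurs.
\<close>

definition dinatural_at :: "('o \<times> 'a \<Rightarrow> 'a) \<Rightarrow> 'o \<times> 'a \<Rightarrow> 'o \<times> 'a \<Rightarrow> 'o \<Rightarrow> 'a \<Rightarrow> 'o \<Rightarrow> 'a \<Rightarrow> bool" where
  "dinatural_at \<kappa> m n y u z q \<longleftrightarrow>
    \<kappa> n \<cdot> \<one> (fst n) \<boxtimes> transpose (fst n) z q \<cdot> u \<boxtimes> \<one> z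
    = \<kappa> m \<cdot> \<one> (fst m) \<boxtimes> transpose (fst m) (y \<otimes> z) (q \<cdot> u \<boxtimes> \<one> z \<cdot> \<a>' (fst m) y z) \<cdot> \<a> (fst m) y z"

definition tannaka_wedge :: "'o \<Rightarrow> ('o \<times> 'a \<Rightarrow> 'a) \<Rightarrow> bool" where
  "tannaka_wedge = is_wedge V A (\<lambda>b a. fst a \<otimes> dual V (fst b)) (act_cov V A fst Wh) (act_con V A fst Wh)"

lemma act_simps:
  assumes m: "m \<in> S" and n: "n \<in> S"
  shows "act_cov V A fst Wh m n \<in> hom V (vHom A m n \<otimes> (fst m \<otimes> dual V (fst n))) (fst n \<otimes> dual V (fst n))"
    "act_con V A fst Wh m n \<in> hom V (vHom A m n \<otimes> (fst m \<otimes> dual V (fst n))) (fst m \<otimes> dual V (fst m))"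
proof -
  note [simp] = hom_object_simps[OF m n]
    comodule_simps[OF S_simps(1)[OF m]] comodule_simps[OF S_simps(1)[OF n]]
    dual_data_simps[OF S_simps(2)[OF n]] dual_data_simps[OF S_simps(2)[OF m]]
    dual_act_eq_transpose[OF S_simps(2)[OF m] S_simps(2)[OF n]] transpose_simps[OF S_simps(2)[OF m]]
  show "act_cov V A fst Wh m n \<in> hom V (vHom A m n \<otimes> (fst m \<otimes> dual V (fst n))) (fst n \<otimes> dual V (fst n))"
    "act_con V A fst Wh m n \<in> hom V (vHom A m n \<otimes> (fst m \<otimes> dual V (fst n))) (fst m \<otimes> dual V (fst m))"
    by (simp_all add: act_cov_def act_con_def hom_iff)
qed

lemma wedge_eq_iff_dinatural_at:
  assumes m: "m \<in> S" and n: "n \<in> S" and j: "j \<in> hom V y (vHom A m n)"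
    and q: "q \<in> hom V (fst n \<otimes> z) \<I>" and z [simp]: "z \<in> Ob V"
    and u: "u = \<e> (fst m) (fst n) \<cdot> (Wh m n \<cdot> j) \<boxtimes> \<one> (fst m) \<cdot> \<s> (fst m) y"
    and \<kappa>: "\<kappa> m \<in> hom V (fst m \<otimes> dual V (fst m)) Z" "\<kappa> n \<in> hom V (fst n \<otimes> dual V (fst n)) Z"
  shows "\<kappa> n \<cdot> act_cov V A fst Wh m n \<cdot> j \<boxtimes> (\<one> (fst m) \<boxtimes> transpose (fst n) z q)
      = \<kappa> m \<cdot> act_con V A fst Wh m n \<cdot> j \<boxtimes> (\<one> (fst m) \<boxtimes> transpose (fst n) z q)
    \<longleftrightarrow> dinatural_at \<kappa> m n y u z q"
proof -
  let ?M = "fst m" and ?N = "fst n" and ?t = "transpose (fst n) z q"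
  note M = S_simps(2)[OF m] and N = S_simps(2)[OF n]
  note [simp] = hom_object_simps[OF m n]
    comodule_simps[OF S_simps(1)[OF m]] comodule_simps[OF S_simps(1)[OF n]]
    dual_data_simps[OF M] dual_data_simps[OF N] j[unfolded hom_iff] q[unfolded hom_iff]
    transpose_simps[OF M] transpose_simps[OF N] act_simps[OF m n, unfolded hom_iff] \<kappa>[unfolded hom_iff]
  have y [simp]: "y \<in> Ob V" using Ob_simps(1)[of j] by simp
  have u' [simp]: "u \<in> Ar V" "Dom V u = ?M \<otimes> y" "Cod V u = ?N" by (simp_all add: u)
  have t: "?t \<in> hom V z (dual V ?N)" by (simp add: hom_iff)
  let ?\<theta> = "\<s> y ?M \<boxtimes> \<one> z \<cdot> \<a>' y ?M z"
  let ?l = "\<kappa> n \<cdot> \<one> ?N \<boxtimes> ?t \<cdot> u \<boxtimes> \<one> z"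
    and ?r = "\<kappa> m \<cdot> \<one> ?M \<boxtimes> transpose ?M (y \<otimes> z) (q \<cdot> u \<boxtimes> \<one> z \<cdot> \<a>' ?M y z) \<cdot> \<a> ?M y z"
  \<comment> \<open>The reordering left behind by both actions, which cancels.\<close>
  have \<theta>: "is_iso V ?\<theta>"
    unfolding is_iso_def inverse_arrows_def
    by (rule exI[of _ "\<a> y ?M z \<cdot> \<s> ?M y \<boxtimes> \<one> z"]) (simp add: hom_iff assoc)
  have "\<kappa> n \<cdot> act_cov V A fst Wh m n \<cdot> j \<boxtimes> (\<one> ?M \<boxtimes> ?t)
      = \<kappa> n \<cdot> (act_cov V A fst Wh m n \<cdot> j \<boxtimes> (\<one> ?M \<boxtimes> ?t))" by (simp add: assoc)
  also have "\<dots> = ?l \<cdot> ?\<theta>"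
    by (subst act_cov_apply[OF m n j t u]) (simp_all add: assoc)
  finally have 1: "\<kappa> n \<cdot> act_cov V A fst Wh m n \<cdot> j \<boxtimes> (\<one> ?M \<boxtimes> ?t) = ?l \<cdot> ?\<theta>" .
  have "\<kappa> m \<cdot> act_con V A fst Wh m n \<cdot> j \<boxtimes> (\<one> ?M \<boxtimes> ?t)
      = \<kappa> m \<cdot> (act_con V A fst Wh m n \<cdot> j \<boxtimes> (\<one> ?M \<boxtimes> ?t))" by (simp add: assoc)
  also have "\<dots> = ?r \<cdot> ?\<theta>"
    by (subst act_con_apply[OF m n j q z u]) (simp_all add: assoc)
  finally have 2: "\<kappa> m \<cdot> act_con V A fst Wh m n \<cdot> j \<boxtimes> (\<one> ?M \<boxtimes> ?t) = ?r \<cdot> ?\<theta>" .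
  have "?l \<cdot> ?\<theta> = ?r \<cdot> ?\<theta> \<longleftrightarrow> ?l = ?r"
  proof
    assume "?l \<cdot> ?\<theta> = ?r \<cdot> ?\<theta>"
    then show "?l = ?r" by (rule iso_epi[OF \<theta>, rotated -1]) simp_all
  qed simp
  then show ?thesis unfolding 1 2 dinatural_at_def .
qed

lemma wedge_simps:
  assumes "tannaka_wedge Z \<kappa>"
  shows "Z \<in> Ob V" "m \<in> S \<Longrightarrow> \<kappa> m \<in> hom V (fst m \<otimes> dual V (fst m)) Z"
    "m \<in> S \<Longrightarrow> n \<in> S \<Longrightarrow> \<kappa> n \<cdot> act_cov V A fst Wh m n = \<kappa> m \<cdot> act_con V A fst Wh m n"
  using assms unfolding tannaka_wedge_def is_wedge_def vOb_A by blast+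

lemma wedge_dinatural:
  assumes \<kappa>: "tannaka_wedge Z \<kappa>" and m: "m \<in> S" and n: "n \<in> S"
    and y: "y \<in> Ob V" and z: "z \<in> Ob V"
    and u: "comodule_morphism V T (comod_tns T m y) n u" and q: "q \<in> hom V (fst n \<otimes> z) \<I>"
  shows "dinatural_at \<kappa> m n y u z q"
proof -
  obtain j where j: "j \<in> hom V y (vHom A m n)"
    and u': "\<e> (fst m) (fst n) \<cdot> (Wh m n \<cdot> j) \<boxtimes> \<one> (fst m) \<cdot> \<s> (fst m) y = u"
    by (rule hom_object_lift[OF m n y u])
  show ?thesis
    using wedge_eq_iff_dinatural_at[where \<kappa>=\<kappa>, OF m n j q z u'[symmetric] wedge_simps(2)[OF \<kappa> m] wedge_simps(2)[OF \<kappa> n]]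
      wedge_simps(3)[OF \<kappa> m n]
    by simp
qed

text \<open>
  It is enough to test dinaturality on parameters from a dense subcategory, because their images
  jointly cover \<open>A(M, N) \<otimes> (M \<otimes> N\<^sup>\<or>)\<close>.
\<close>

lemma dinatural_wedge:
  assumes X: "Set_dense V X"
    and \<kappa>: "Z \<in> Ob V" "\<And>m. m \<in> S \<Longrightarrow> \<kappa> m \<in> hom V (fst m \<otimes> dual V (fst m)) Z"
    and din: "\<And>m n y z u q. m \<in> S \<Longrightarrow> n \<in> S \<Longrightarrow> y \<in> X \<Longrightarrow> z \<in> X \<Longrightarrow>
      comodule_morphism V T (comod_tns T m y) n u \<Longrightarrow> q \<in> hom V (fst n \<otimes> z) \<I> \<Longrightarrow>
      dinatural_at \<kappa> m n y u z q"
  shows "tannaka_wedge Z \<kappa>"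
  unfolding tannaka_wedge_def is_wedge_def vOb_A
proof (intro conjI ballI)
  fix m n assume m: "m \<in> S" and n: "n \<in> S"
  let ?M = "fst m" and ?N = "fst n" and ?H = "vHom A m n" and ?N' = "dual V (fst n)"
  note M = S_simps(2)[OF m] and N = S_simps(2)[OF n]
  note [simp] = hom_object_simps[OF m n]
    comodule_simps[OF S_simps(1)[OF m]] comodule_simps[OF S_simps(1)[OF n]]
    dual_data_simps[OF M] dual_data_simps[OF N] act_simps[OF m n, unfolded hom_iff]
    \<kappa>(2)[OF m, unfolded hom_iff] \<kappa>(2)[OF n, unfolded hom_iff]
  let ?f = "\<kappa> n \<cdot> act_cov V A fst Wh m n" and ?g = "\<kappa> m \<cdot> act_con V A fst Wh m n"
  show "?f = ?g"
  proof (rule dense_unique_right[OF X])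
    show "?f \<in> hom V (?H \<otimes> (?M \<otimes> ?N')) Z" "?g \<in> hom V (?H \<otimes> (?M \<otimes> ?N')) Z"
      by (simp_all add: hom_iff)
    fix j assume j [simp]: "j \<in> Ar V" "Cod V j = ?H" and yX: "Dom V j \<in> X"
    let ?y = "Dom V j"
    \<comment> \<open>The associator brings the second parameter \<open>N\<^sup>\<or>\<close> into the rightmost position, where density applies.\<close>
    have "?f \<cdot> j \<boxtimes> \<one> (?M \<otimes> ?N') \<cdot> \<a> ?y ?M ?N' = ?g \<cdot> j \<boxtimes> \<one> (?M \<otimes> ?N') \<cdot> \<a> ?y ?M ?N'"
    proof (rule dense_unique_left[OF X, where M = "?y \<otimes> ?M" and c = ?N' and d = Z])
      fix p assume p [simp]: "p \<in> Ar V" "Cod V p = ?N'" and zX: "Dom V p \<in> X"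
      let ?z = "Dom V p"
      have split: "k \<cdot> j \<boxtimes> \<one> (?M \<otimes> ?N') \<cdot> \<a> ?y ?M ?N' \<cdot> \<one> (?y \<otimes> ?M) \<boxtimes> p
          = k \<cdot> j \<boxtimes> (\<one> ?M \<boxtimes> p) \<cdot> \<a> ?y ?M ?z"
        if [simp]: "k \<in> Ar V" "Dom V k = ?H \<otimes> (?M \<otimes> ?N')" for k
      proof -
        have "k \<cdot> j \<boxtimes> \<one> (?M \<otimes> ?N') \<cdot> \<a> ?y ?M ?N' \<cdot> \<one> (?y \<otimes> ?M) \<boxtimes> p
          = k \<cdot> j \<boxtimes> \<one> (?M \<otimes> ?N') \<cdot> (\<a> ?y ?M ?N' \<cdot> \<one> (?y \<otimes> ?M) \<boxtimes> p)" by (simp add: assoc)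
        also have "\<dots> = k \<cdot> j \<boxtimes> (\<one> ?M \<boxtimes> p) \<cdot> \<a> ?y ?M ?z"
          by (subst assc_at[of "\<one> ?y" "\<one> ?M" p, simplified]) (simp_all add: assoc)
        finally show ?thesis .
      qed
      let ?q = "evd V ?N \<cdot> \<one> ?N \<boxtimes> p"
      let ?u = "\<e> ?M ?N \<cdot> (Wh m n \<cdot> j) \<boxtimes> \<one> ?M \<cdot> \<s> ?M ?y"
      have q: "?q \<in> hom V (?N \<otimes> ?z) \<I>" by (simp add: hom_iff)
      have pq: "transpose ?N ?z ?q = p" by (rule transpose_evd[OF N]) simp_all
      have jh: "j \<in> hom V ?y ?H" by (simp add: hom_iff)
      have "dinatural_at \<kappa> m n ?y ?u ?z ?q"
        by (rule din[OF m n yX zX hom_object_morphism[OF m n jh] q])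
      then have "?f \<cdot> j \<boxtimes> (\<one> ?M \<boxtimes> p) = ?g \<cdot> j \<boxtimes> (\<one> ?M \<boxtimes> p)"
        using wedge_eq_iff_dinatural_at[where \<kappa>=\<kappa>, OF m n jh q _ refl \<kappa>(2)[OF m] \<kappa>(2)[OF n]]
        unfolding pq by simp
      then show "?f \<cdot> j \<boxtimes> \<one> (?M \<otimes> ?N') \<cdot> \<a> ?y ?M ?N' \<cdot> \<one> (?y \<otimes> ?M) \<boxtimes> p
        = ?g \<cdot> j \<boxtimes> \<one> (?M \<otimes> ?N') \<cdot> \<a> ?y ?M ?N' \<cdot> \<one> (?y \<otimes> ?M) \<boxtimes> p"
        by (subst (1 2) split) simp_all
    qed (simp_all add: hom_iff)
    then show "?f \<cdot> j \<boxtimes> \<one> (?M \<otimes> ?N') = ?g \<cdot> j \<boxtimes> \<one> (?M \<otimes> ?N')"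
      by (rule iso_epi[rotated -1]) simp_all
  qed simp_all
qed (use \<kappa> in simp_all)

end

section \<open>Wedges and cocones\<close>

text \<open>
  Objects of \<open>X\<close> have duals so that \<open>M \<otimes> x\<close> is a Cauchy comodule whenever \<open>M\<close> is one. Closure of \<open>X\<close>
  under the tensor product serves to check dinaturality of a wedge that is only known on \<open>X\<close>: with
  parameters \<open>y\<close> and \<open>z\<close>, one side of the equation involves \<open>y \<otimes> z\<close>.
\<close>

locale tannakian_setting = comodule_enrichment V T S A Wh
  for V :: "('o, 'a, 'z) smc_scheme" (structure)
    and T :: "('o, 'a) comon" and S :: "('o \<times> 'a) set" and A :: "('o \<times> 'a, 'o, 'a) vcat"
    and Wh :: "'o \<times> 'a \<Rightarrow> 'o \<times> 'a \<Rightarrow> 'a" +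
  fixes X :: "'o set"
  assumes replacement: "m \<in> cauchy_comodules V T \<Longrightarrow> \<exists>n \<in> S. isomorphic (Comod V T) m n"
    and X_dense: "Set_dense V X"
    and X_dualizable: "X \<subseteq> dualizable V"
    and X_tns: "x \<in> X \<Longrightarrow> y \<in> X \<Longrightarrow> x \<otimes> y \<in> X"
begin

abbreviation self :: "'o \<times> 'a" where "self \<equiv> (cob T, comult T)"

lemma self_comodule: "comodule V T self" by (rule comodule_self[OF T])

lemmas T_simps [simp] = comonoid_simps[OF T]

lemma X_Ob: "x \<in> X \<Longrightarrow> x \<in> Ob V"
  using X_dense by (auto simp: Set_dense_def)

lemma cauchy_comodule: "m \<in> cauchy_comodules V T \<Longrightarrow> comodule V T m"
  by (simp add: cauchy_comodules_def)

lemma S_cauchy: "m \<in> S \<Longrightarrow> m \<in> cauchy_comodules V T"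
  using S by blast

lemma cauchy_tns:
  assumes "m \<in> cauchy_comodules V T" "z \<in> dualizable V"
  shows "comod_tns T m z \<in> cauchy_comodules V T"
proof -
  have "z \<in> Ob V" using assms(2) by (auto simp: dualizable_def is_dual_def)
  then show ?thesis
    using assms comodule_tns[OF T] dualizable_tns by (auto simp: cauchy_comodules_def comod_tns_def)
qed

lemma obtain_replacement:
  assumes m: "m \<in> cauchy_comodules V T"
  obtains n u v where "n \<in> S" "comodule_morphism V T m n u" "comodule_morphism V T n m v"
    "v \<cdot> u = \<one> (fst m)" "u \<cdot> v = \<one> (fst n)"
proof -
  obtain n t where "n \<in> S" and t: "t \<in> hom (Comod V T) m n" "is_iso (Comod V T) t"
    using replacement[OF m] by (auto simp: isomorphic_def)
  from t(2) obtain r where r: "inverse_arrows (Comod V T) t r" by (auto simp: is_iso_def)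
  show thesis
  proof (rule that[OF \<open>n \<in> S\<close>, of "snd (snd t)" "snd (snd r)"])
    show "comodule_morphism V T m n (snd (snd t))" using t(1) by (auto simp: hom_def)
    show "comodule_morphism V T n m (snd (snd r))" using t(1) r by (auto simp: hom_def inverse_arrows_def)
    show "snd (snd r) \<cdot> snd (snd t) = \<one> (fst m)" "snd (snd t) \<cdot> snd (snd r) = \<one> (fst n)"
      using t(1) r by (auto simp: hom_def inverse_arrows_def)
  qed
qed

text \<open>
  The comodule morphism \<open>M \<rightarrow> T\<close> that corresponds to a functional \<open>g\<close> on \<open>M\<close>: the map from vectors
  \<open>v\<close> to the matrix coefficient of \<open>v\<close> and \<open>g\<close>. Up to the right unit it is the extension of \<open>g\<close> to the
  cofree comodule \<open>T \<otimes> \<I>\<close>; the lemmas below make \<open>M \<rightarrow> T\<close> and \<open>M \<rightarrow> \<I>\<close> interchangeable.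
\<close>

definition coefficient_map :: "'o \<times> 'a \<Rightarrow> 'a \<Rightarrow> 'a" where
  "coefficient_map m g = \<r> (cob T) \<cdot> \<one> (cob T) \<boxtimes> g \<cdot> snd m"

lemma coefficient_map_morphism:
  assumes m: "comodule V T m" and g: "g \<in> hom V (fst m) \<I>"
  shows "comodule_morphism V T m self (coefficient_map m g)"
proof -
  note [simp] = comodule_simps[OF m] g[unfolded hom_iff]
  have "comodule_morphism V T m self (\<r> (fst self) \<cdot> (\<one> (cob T) \<boxtimes> g \<cdot> snd m))"
    by (rule comodule_morphism_Cmp[OF T m _ self_comodule cofree_morphism[OF T m g]
          comodule_morphism_runit[OF T self_comodule]])
       (rule comodule_tns[OF T self_comodule unt_Ob])
  then show ?thesis by (simp add: coefficient_map_def assoc)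
qed

lemma coefficient_map_natural:
  assumes m: "comodule V T m" and n: "comodule V T n"
    and f: "comodule_morphism V T m n f" and g: "g \<in> hom V (fst n) \<I>"
  shows "coefficient_map n g \<cdot> f = coefficient_map m (g \<cdot> f)"
proof -
  note [simp] = comodule_simps[OF m] comodule_simps[OF n] g[unfolded hom_iff]
    comodule_morphism_simps(1-3)[OF f]
  have "coefficient_map n g \<cdot> f = \<r> (cob T) \<cdot> \<one> (cob T) \<boxtimes> g \<cdot> (snd n \<cdot> f)" by (simp add: coefficient_map_def assoc)
  also have "\<dots> = coefficient_map m (g \<cdot> f)"
    by (subst comodule_morphism_simps(4)[OF f]) (simp add: coefficient_map_def assoc)
  finally show ?thesis .
qed

lemma coefficient_map_counit:
  assumes m: "comodule V T m" and f: "comodule_morphism V T m self f"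
  shows "coefficient_map m (counit T \<cdot> f) = f"
proof -
  note [simp] = comodule_morphism_simps(1-3)[OF f]
  have "coefficient_map m (counit T \<cdot> f) = coefficient_map self (counit T) \<cdot> f"
    by (rule coefficient_map_natural[OF m self_comodule f, symmetric]) (simp add: hom_iff)
  also have "coefficient_map self (counit T) = \<one> (cob T)"
    using T by (simp add: coefficient_map_def comonoid_def)
  finally show ?thesis by simp
qed

lemma counit_coefficient_map:
  assumes m: "comodule V T m" and g: "g \<in> hom V (fst m) \<I>"
  shows "counit T \<cdot> coefficient_map m g = g"
proof -
  note [simp] = comodule_simps[OF m] g[unfolded hom_iff]
  have "counit T \<cdot> coefficient_map m g = (counit T \<cdot> \<r> (cob T)) \<cdot> (\<one> (cob T) \<boxtimes> g \<cdot> snd m)"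
    by (simp add: coefficient_map_def assoc)
  also have "\<dots> = \<l> \<I> \<cdot> counit T \<boxtimes> \<one> \<I> \<cdot> (\<one> (cob T) \<boxtimes> g \<cdot> snd m)"
    using runit_natural[of "counit T" \<I>] by (simp add: lunit_unit)
  also have "\<dots> = g" by (rule counit_cofree[OF T m g])
  finally show ?thesis .
qed

text \<open>
  The component \<open>M \<otimes> M\<^sup>\<or> \<rightarrow> Z\<close> of a wedge with the functional \<open>h : M \<rightarrow> \<I>\<close>, regarded as \<open>\<I> \<rightarrow> M\<^sup>\<or>\<close>,
  inserted into the second factor.
\<close>

definition wedge_at :: "('o \<times> 'a \<Rightarrow> 'a) \<Rightarrow> 'o \<times> 'a \<Rightarrow> 'a \<Rightarrow> 'a" where
  "wedge_at \<kappa> m h = \<kappa> m \<cdot> \<one> (fst m) \<boxtimes> transpose (fst m) \<I> (h \<cdot> \<r> (fst m)) \<cdot> \<r>' (fst m)"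

lemma wedge_at_hom:
  assumes m: "m \<in> S" and \<kappa>: "\<kappa> m \<in> hom V (fst m \<otimes> dual V (fst m)) Z" and h: "h \<in> hom V (fst m) \<I>"
  shows "wedge_at \<kappa> m h \<in> hom V (fst m) Z"
  using comodule_simps[OF S_simps(1)[OF m]] dual_data_simps[OF S_simps(2)[OF m]] \<kappa> h
    transpose_simps[OF S_simps(2)[OF m]]
  by (simp add: wedge_at_def hom_iff)

lemma wedge_at_Cmp:
  assumes m: "m \<in> S" and \<kappa>: "\<kappa> m \<in> hom V (fst m \<otimes> dual V (fst m)) Z" and h: "h \<in> hom V (fst m) \<I>"
    and k: "k \<in> hom V Z Z'"
  shows "wedge_at (\<lambda>m. k \<cdot> \<kappa> m) m h = k \<cdot> wedge_at \<kappa> m h"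
  using comodule_simps[OF S_simps(1)[OF m]] dual_data_simps[OF S_simps(2)[OF m]] \<kappa> h k
    transpose_simps[OF S_simps(2)[OF m]]
  by (simp add: wedge_at_def hom_iff assoc)

text \<open>
  This is dinaturality with \<open>z = \<I>\<close>, and it is the heart of the matter: a comodule
  morphism from \<open>M \<otimes> y\<close> to \<open>N\<close> pulls an honest functional on \<open>N\<close> back to a generalized element
  \<open>y \<rightarrow> M\<^sup>\<or>\<close>, and inserting the latter into the component at \<open>M\<close> amounts to inserting the functional
  into the component at \<open>N\<close>.
\<close>

lemma wedge_at_tns:
  assumes \<kappa>: "tannaka_wedge Z \<kappa>" and m: "m \<in> S" and n: "n \<in> S" and y [simp]: "y \<in> Ob V"
    and u: "comodule_morphism V T (comod_tns T m y) n u" and h: "h \<in> hom V (fst n) \<I>"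
  shows "wedge_at \<kappa> n h \<cdot> u = \<kappa> m \<cdot> \<one> (fst m) \<boxtimes> transpose (fst m) y (h \<cdot> u)"
proof -
  let ?M = "fst m" and ?N = "fst n"
  note M = S_simps(2)[OF m] and N = S_simps(2)[OF n]
  note [simp] = comodule_simps[OF S_simps(1)[OF m]] comodule_simps[OF S_simps(1)[OF n]]
    dual_data_simps[OF M] dual_data_simps[OF N] h[unfolded hom_iff]
    transpose_simps[OF M] transpose_simps[OF N]
    wedge_simps(2)[OF \<kappa> m, unfolded hom_iff] wedge_simps(2)[OF \<kappa> n, unfolded hom_iff]
  have [simp]: "u \<in> Ar V" "Dom V u = ?M \<otimes> y" "Cod V u = ?N"
    using comodule_morphism_simps[OF u] by (simp_all add: comod_tns_def)
  let ?t = "transpose ?N \<I> (h \<cdot> \<r> ?N)"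
  have din: "\<kappa> n \<cdot> \<one> ?N \<boxtimes> ?t \<cdot> u \<boxtimes> \<one> \<I>
    = \<kappa> m \<cdot> \<one> ?M \<boxtimes> transpose ?M (y \<otimes> \<I>) (h \<cdot> \<r> ?N \<cdot> u \<boxtimes> \<one> \<I> \<cdot> \<a>' ?M y \<I>) \<cdot> \<a> ?M y \<I>"
    using wedge_dinatural[OF \<kappa> m n y unt_Ob u, of "h \<cdot> \<r> ?N"] by (simp add: dinatural_at_def hom_iff)
  have "h \<cdot> \<r> ?N \<cdot> u \<boxtimes> \<one> \<I> \<cdot> \<a>' ?M y \<I> = h \<cdot> (\<r> ?N \<cdot> u \<boxtimes> \<one> \<I>) \<cdot> \<a>' ?M y \<I>" by (simp add: assoc)
  also have "\<dots> = h \<cdot> u \<cdot> (\<r> (?M \<otimes> y) \<cdot> \<a>' ?M y \<I>)" by (simp add: runit_natural assoc)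
  also have "\<dots> = h \<cdot> u \<cdot> \<one> ?M \<boxtimes> \<r> y" by (simp add: runit_tns_inv)
  finally have "transpose ?M (y \<otimes> \<I>) (h \<cdot> \<r> ?N \<cdot> u \<boxtimes> \<one> \<I> \<cdot> \<a>' ?M y \<I>) = transpose ?M y (h \<cdot> u) \<cdot> \<r> y"
    by (simp add: transpose_natural[OF M])
  note din = din[unfolded this]
  have "wedge_at \<kappa> n h \<cdot> u = \<kappa> n \<cdot> \<one> ?N \<boxtimes> ?t \<cdot> (\<r>' ?N \<cdot> u)" by (simp add: wedge_at_def assoc)
  also have "\<dots> = \<kappa> n \<cdot> \<one> ?N \<boxtimes> ?t \<cdot> u \<boxtimes> \<one> \<I> \<cdot> \<r>' (?M \<otimes> y)" by (simp add: runit'_natural assoc)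
  also have "\<dots> = \<kappa> m \<cdot> \<one> ?M \<boxtimes> transpose ?M y (h \<cdot> u) \<cdot> (\<one> ?M \<boxtimes> \<r> y \<cdot> \<a> ?M y \<I>) \<cdot> \<r>' (?M \<otimes> y)"
    unfolding din by (simp add: assoc)
  also have "\<dots> = \<kappa> m \<cdot> \<one> ?M \<boxtimes> transpose ?M y (h \<cdot> u)"
    by (subst runit_tns) (simp_all add: assoc[symmetric])
  finally show ?thesis .
qed

text \<open>
  The previous lemma for \<open>y = \<I>\<close>.
\<close>

lemma wedge_at_natural:
  assumes \<kappa>: "tannaka_wedge Z \<kappa>" and m: "m \<in> S" and n: "n \<in> S"
    and f: "comodule_morphism V T m n f" and h: "h \<in> hom V (fst n) \<I>"
  shows "wedge_at \<kappa> n h \<cdot> f = wedge_at \<kappa> m (h \<cdot> f)"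
proof -
  let ?M = "fst m" and ?N = "fst n"
  note mC = S_simps(1)[OF m] and nC = S_simps(1)[OF n]
  note [simp] = comodule_simps[OF mC] comodule_simps[OF nC] h[unfolded hom_iff]
    comodule_morphism_simps(1-3)[OF f]
  have hf: "h \<cdot> f \<in> hom V ?M \<I>" by (simp add: hom_iff)
  note [simp] = wedge_at_hom[where \<kappa> = \<kappa>, OF n wedge_simps(2)[OF \<kappa> n] h, unfolded hom_iff]
    wedge_at_hom[where \<kappa> = \<kappa>, OF m wedge_simps(2)[OF \<kappa> m] hf, unfolded hom_iff]
  have r: "comodule_morphism V T (comod_tns T m \<I>) m (\<r> ?M)" by (rule comodule_morphism_runit[OF T mC])
  have fr: "comodule_morphism V T (comod_tns T m \<I>) n (f \<cdot> \<r> ?M)"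
    by (rule comodule_morphism_Cmp[OF T comodule_tns[OF T mC unt_Ob] mC nC r f])
  have "wedge_at \<kappa> n h \<cdot> (f \<cdot> \<r> ?M) = wedge_at \<kappa> m (h \<cdot> f) \<cdot> \<r> ?M"
    unfolding wedge_at_tns[OF \<kappa> m n unt_Ob fr h] wedge_at_tns[OF \<kappa> m m unt_Ob r hf] by (simp add: assoc)
  then have "wedge_at \<kappa> n h \<cdot> f \<cdot> \<r> ?M = wedge_at \<kappa> m (h \<cdot> f) \<cdot> \<r> ?M" by (simp add: assoc)
  then show ?thesis by (rule iso_epi[rotated -1]) simp_all
qed

text \<open>
  By density \<open>\<kappa>\<^sub>M\<close> is determined by its composites with \<open>M \<otimes> p\<close> for \<open>p : x \<rightarrow> M\<^sup>\<or>\<close> with \<open>x\<close> in \<open>X\<close>. As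
  \<open>M \<otimes> x\<close> is a Cauchy comodule, it is isomorphic to one in \<open>S\<close>, and \<open>wedge_at_tns\<close> expresses the
  composite by a functional on the latter.
\<close>

lemma wedge_determined_by_functionals:
  assumes \<kappa>: "tannaka_wedge Z \<kappa>" and \<mu>: "tannaka_wedge Z \<mu>"
    and eq: "\<And>n h. n \<in> S \<Longrightarrow> h \<in> hom V (fst n) \<I> \<Longrightarrow> wedge_at \<kappa> n h = wedge_at \<mu> n h"
    and m: "m \<in> S"
  shows "\<kappa> m = \<mu> m"
proof (rule dense_unique_left[OF X_dense wedge_simps(2)[OF \<kappa> m] wedge_simps(2)[OF \<mu> m]])
  let ?M = "fst m" and ?M' = "dual V (fst m)"
  note M = S_simps(2)[OF m]
  note [simp] = comodule_simps[OF S_simps(1)[OF m]] dual_data_simps[OF M]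
  show "?M' \<in> Ob V" "?M \<in> Ob V" by simp_all
  fix p assume p [simp]: "p \<in> Ar V" "Cod V p = ?M'" and xX: "Dom V p \<in> X"
  let ?x = "Dom V p" and ?q = "evd V ?M \<cdot> \<one> ?M \<boxtimes> p"
  have "comod_tns T m ?x \<in> cauchy_comodules V T"
    using cauchy_tns[OF S_cauchy[OF m]] X_dualizable xX by blast
  then obtain n u v where n: "n \<in> S" and u: "comodule_morphism V T (comod_tns T m ?x) n u"
    and v: "comodule_morphism V T n (comod_tns T m ?x) v" and vu: "v \<cdot> u = \<one> (fst (comod_tns T m ?x))"
    by (rule obtain_replacement)
  note [simp] = comodule_morphism_simps(1-3)[OF u] comodule_morphism_simps(1-3)[OF v]
  have fst_tns [simp]: "fst (comod_tns T m ?x) = ?M \<otimes> ?x" by (simp add: comod_tns_def)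
  have h: "?q \<cdot> v \<in> hom V (fst n) \<I>" by (simp add: hom_iff)
  have "?q \<cdot> v \<cdot> u = ?q" using vu by (simp add: assoc[symmetric])
  then have "transpose ?M ?x (?q \<cdot> v \<cdot> u) = p" using transpose_evd[OF M, of p] by simp
  then show "\<kappa> m \<cdot> \<one> ?M \<boxtimes> p = \<mu> m \<cdot> \<one> ?M \<boxtimes> p"
    using wedge_at_tns[OF \<kappa> m n _ u h] wedge_at_tns[OF \<mu> m n _ u h] eq[OF n h] by simp
qed

lemma wedge_Cmp:
  assumes \<kappa>: "tannaka_wedge Z \<kappa>" and k: "k \<in> hom V Z Z'"
  shows "tannaka_wedge Z' (\<lambda>m. k \<cdot> \<kappa> m)"
  unfolding tannaka_wedge_def is_wedge_def vOb_A
proof (intro conjI ballI)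
  note [simp] = k[unfolded hom_iff]
  show "Z' \<in> Ob V" using Ob_simps(2)[of k] by simp
  fix m assume m: "m \<in> S"
  note [simp] = wedge_simps(2)[OF \<kappa> m, unfolded hom_iff]
  show "k \<cdot> \<kappa> m \<in> hom V (fst m \<otimes> dual V (fst m)) Z'" by (simp add: hom_iff)
  fix n assume n: "n \<in> S"
  note [simp] = wedge_simps(2)[OF \<kappa> n, unfolded hom_iff] act_simps[OF m n, unfolded hom_iff]
  have "k \<cdot> (\<kappa> n \<cdot> act_cov V A fst Wh m n) = k \<cdot> (\<kappa> m \<cdot> act_con V A fst Wh m n)"
    using wedge_simps(3)[OF \<kappa> m n] by simp
  then show "k \<cdot> \<kappa> n \<cdot> act_cov V A fst Wh m n = k \<cdot> \<kappa> m \<cdot> act_con V A fst Wh m n"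
    by (simp add: assoc)
qed

text \<open>
  The component \<open>\<kappa>\<^sub>M\<close> is glued from the values of the cocone at the comodules \<open>M \<otimes> x\<close> over all
  \<open>p : x \<rightarrow> M\<^sup>\<or>\<close> with \<open>x\<close> in \<open>X\<close>. Dinaturality on parameters from \<open>X\<close> then holds because \<open>u \<otimes> z\<close> and the
  associator \<open>(M \<otimes> y) \<otimes> z \<rightarrow> M \<otimes> (y \<otimes> z)\<close> are comodule morphisms.
\<close>

lemma wedge_of_cocone:
  assumes co: "cauchy_cocone T Z \<gamma>"
  obtains \<kappa> where "tannaka_wedge Z \<kappa>"
    "\<And>m g. m \<in> S \<Longrightarrow> g \<in> hom V (fst m) \<I> \<Longrightarrow> wedge_at \<kappa> m g = \<gamma> m (coefficient_map m g)"
proof -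
  have Z [simp]: "Z \<in> Ob V" by (rule cauchy_coconeD(1)[OF co])
  \<comment> \<open>The cocone, indexed by functionals instead of comodule morphisms into \<open>T\<close>.\<close>
  define \<Gamma> where "\<Gamma> = (\<lambda>m g. \<gamma> m (coefficient_map m g))"
  have \<Gamma>: "\<Gamma> m g \<in> hom V (fst m) Z" if "m \<in> cauchy_comodules V T" "g \<in> hom V (fst m) \<I>" for m g
    unfolding \<Gamma>_def using cauchy_coconeD(2)[OF co] coefficient_map_morphism that cauchy_comodule by blast
  have \<Gamma>_nat: "\<Gamma> m (g \<cdot> f) = \<Gamma> n g \<cdot> f"
    if "m \<in> cauchy_comodules V T" "n \<in> cauchy_comodules V T" "comodule_morphism V T m n f" "g \<in> hom V (fst n) \<I>"
    for m n f g
    unfolding \<Gamma>_def using cauchy_coconeD(3)[OF co that(1,2) coefficient_map_morphism that(3), of g] that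
      coefficient_map_natural[of m n f g] cauchy_comodule by (metis (no_types))
  have fst_tns [simp]: "fst (comod_tns T m z) = fst m \<otimes> z" for m z by (simp add: comod_tns_def)
  have X': "x \<in> X \<Longrightarrow> m \<in> cauchy_comodules V T \<Longrightarrow> comod_tns T m x \<in> cauchy_comodules V T" for m x
    using cauchy_tns X_dualizable by blast
  have "\<exists>k. k \<in> hom V (fst m \<otimes> dual V (fst m)) Z \<and>
    (\<forall>p. p \<in> Ar V \<longrightarrow> Dom V p \<in> X \<longrightarrow> Cod V p = dual V (fst m) \<longrightarrow>
      k \<cdot> \<one> (fst m) \<boxtimes> p = \<Gamma> (comod_tns T m (Dom V p)) (evd V (fst m) \<cdot> \<one> (fst m) \<boxtimes> p))" if m: "m \<in> S" for m
  proof -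
    let ?M = "fst m" and ?M' = "dual V (fst m)"
    note [simp] = comodule_simps[OF S_simps(1)[OF m]] dual_data_simps[OF S_simps(2)[OF m]]
    let ?\<Gamma> = "\<lambda>p. \<Gamma> (comod_tns T m (Dom V p)) (evd V ?M \<cdot> \<one> ?M \<boxtimes> p)"
    have "\<exists>k. k \<in> hom V (?M \<otimes> ?M') Z \<and> (\<forall>p. p \<in> Ar V \<longrightarrow> Dom V p \<in> X \<longrightarrow> Cod V p = ?M' \<longrightarrow>
      k \<cdot> \<one> ?M \<boxtimes> p = ?\<Gamma> p)"
    proof (rule dense_extend_left[OF X_dense, of ?M' ?M Z ?\<Gamma>])
      show "?M' \<in> Ob V" "?M \<in> Ob V" "Z \<in> Ob V" by simp_all
    next
      fix p assume [simp]: "p \<in> Ar V" "Dom V p \<in> X" "Cod V p = ?M'"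
      show "?\<Gamma> p \<in> hom V (?M \<otimes> Dom V p) Z"
        using \<Gamma>[OF X'[of "Dom V p" m]] S_cauchy[OF m] by (simp add: hom_iff)
    next
      fix p f assume [simp]: "p \<in> Ar V" "Dom V p \<in> X" "Cod V p = ?M'" "f \<in> Ar V" "Dom V f \<in> X" "Cod V f = Dom V p"
      have "comodule_morphism V T (comod_tns T m (Dom V f)) (comod_tns T m (Dom V p)) (\<one> ?M \<boxtimes> f)"
        by (rule comodule_morphism_tns[OF T _ _ comodule_morphism_Idt[OF T]])
           (simp_all add: S_simps(1)[OF m] hom_iff)
      from \<Gamma>_nat[OF X' X' this, of "evd V ?M \<cdot> \<one> ?M \<boxtimes> p"]
      show "?\<Gamma> (p \<cdot> f) = ?\<Gamma> p \<cdot> \<one> ?M \<boxtimes> f"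
        using S_cauchy[OF m] by (simp add: hom_iff assoc[symmetric])
    qed blast
    then show ?thesis .
  qed
  then have "\<exists>\<kappa>. \<forall>m\<in>S. \<kappa> m \<in> hom V (fst m \<otimes> dual V (fst m)) Z \<and>
    (\<forall>p. p \<in> Ar V \<longrightarrow> Dom V p \<in> X \<longrightarrow> Cod V p = dual V (fst m) \<longrightarrow>
      \<kappa> m \<cdot> \<one> (fst m) \<boxtimes> p = \<Gamma> (comod_tns T m (Dom V p)) (evd V (fst m) \<cdot> \<one> (fst m) \<boxtimes> p))"
    by (intro bchoice) blast
  then obtain \<kappa> where \<kappa>: "\<And>m. m \<in> S \<Longrightarrow> \<kappa> m \<in> hom V (fst m \<otimes> dual V (fst m)) Z"
    and \<kappa>p: "\<And>m p. m \<in> S \<Longrightarrow> p \<in> Ar V \<Longrightarrow> Dom V p \<in> X \<Longrightarrow> Cod V p = dual V (fst m) \<Longrightarrow>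
      \<kappa> m \<cdot> \<one> (fst m) \<boxtimes> p = \<Gamma> (comod_tns T m (Dom V p)) (evd V (fst m) \<cdot> \<one> (fst m) \<boxtimes> p)"
    by blast
  have \<kappa>t: "\<kappa> m \<cdot> \<one> (fst m) \<boxtimes> transpose (fst m) x q = \<Gamma> (comod_tns T m x) q"
    if m: "m \<in> S" and x: "x \<in> X" and q: "q \<in> hom V (fst m \<otimes> x) \<I>" for m x q
    using \<kappa>p[OF m, of "transpose (fst m) x q"] transpose_simps[OF S_simps(2)[OF m], of q x]
      evd_transpose[OF S_simps(2)[OF m], of q x] x X_Ob[OF x] q by (simp add: hom_iff)
  have wedge: "tannaka_wedge Z \<kappa>"
  proof (rule dinatural_wedge[OF X_dense Z \<kappa>])
    fix m n y z u q assume m: "m \<in> S" and n: "n \<in> S" and y: "y \<in> X" and z: "z \<in> X"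
      and u: "comodule_morphism V T (comod_tns T m y) n u" and q: "q \<in> hom V (fst n \<otimes> z) \<I>"
    let ?M = "fst m" and ?N = "fst n"
    note [simp] = comodule_simps[OF S_simps(1)[OF m]] comodule_simps[OF S_simps(1)[OF n]]
      X_Ob[OF y] X_Ob[OF z] q[unfolded hom_iff]
    note mC = S_cauchy[OF m] and nC = S_cauchy[OF n]
    have [simp]: "u \<in> Ar V" "Dom V u = ?M \<otimes> y" "Cod V u = ?N"
      using comodule_morphism_simps[OF u] by simp_all
    have uz: "comodule_morphism V T (comod_tns T (comod_tns T m y) z) (comod_tns T n z) (u \<boxtimes> \<one> z)"
      by (rule comodule_morphism_tns[OF T _ _ u])
         (simp_all add: hom_iff comodule_tns[OF T] S_simps(1)[OF m] S_simps(1)[OF n])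
    have a: "comodule_morphism V T (comod_tns T (comod_tns T m y) z) (comod_tns T m (y \<otimes> z)) (\<a> ?M y z)"
      by (rule comodule_morphism_assc[OF T S_simps(1)[OF m]]) simp_all
    let ?q = "q \<cdot> u \<boxtimes> \<one> z \<cdot> \<a>' ?M y z"
    have q': "?q \<in> hom V (?M \<otimes> (y \<otimes> z)) \<I>" by (simp add: hom_iff)
    have "\<kappa> n \<cdot> \<one> ?N \<boxtimes> transpose ?N z q \<cdot> u \<boxtimes> \<one> z = \<Gamma> (comod_tns T (comod_tns T m y) z) (q \<cdot> u \<boxtimes> \<one> z)"
      unfolding \<kappa>t[OF n z q]
      by (rule \<Gamma>_nat[OF X'[OF z X'[OF y mC]] X'[OF z nC] uz, symmetric]) (simp add: hom_iff)
    also have "\<dots> = \<Gamma> (comod_tns T (comod_tns T m y) z) (?q \<cdot> \<a> ?M y z)"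
      by simp
    also have "\<dots> = \<Gamma> (comod_tns T m (y \<otimes> z)) ?q \<cdot> \<a> ?M y z"
      by (rule \<Gamma>_nat[OF X'[OF z X'[OF y mC]] X'[OF X_tns[OF y z] mC] a]) (simp add: hom_iff)
    also have "\<dots> = \<kappa> m \<cdot> \<one> ?M \<boxtimes> transpose ?M (y \<otimes> z) ?q \<cdot> \<a> ?M y z"
      unfolding \<kappa>t[OF m X_tns[OF y z] q'] ..
    finally show "dinatural_at \<kappa> m n y u z q" unfolding dinatural_at_def .
  qed
  have wedge_at: "wedge_at \<kappa> m g = \<Gamma> m g" if m: "m \<in> S" and g: "g \<in> hom V (fst m) \<I>" for m g
  proof -
    let ?M = "fst m"
    note M = S_simps(2)[OF m] and mC = S_cauchy[OF m] and mc = S_simps(1)[OF m]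
    note [simp] = comodule_simps[OF mc] g[unfolded hom_iff] \<Gamma>[OF mC g, unfolded hom_iff]
      wedge_at_hom[where \<kappa> = \<kappa>, OF m \<kappa>[OF m] g, unfolded hom_iff] transpose_simps[OF M] \<kappa>[OF m, unfolded hom_iff]
      dual_data_simps[OF M]
    \<comment> \<open>The unit object need not lie in \<open>X\<close>, so the component at a global element is reached by
      covering \<open>\<I>\<close> with arrows \<open>x \<rightarrow> \<I>\<close>.\<close>
    have "wedge_at \<kappa> m g \<cdot> \<r> ?M = \<Gamma> m g \<cdot> \<r> ?M"
    proof (rule dense_unique_left[OF X_dense, where M = ?M and c = \<I> and d = Z])
      fix p assume p [simp]: "p \<in> Ar V" "Cod V p = \<I>" and xX: "Dom V p \<in> X"
      let ?x = "Dom V p"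
      have e: "comodule_morphism V T (comod_tns T m ?x) (comod_tns T m \<I>) (\<one> ?M \<boxtimes> p)"
        by (rule comodule_morphism_tns[OF T mc mc comodule_morphism_Idt[OF T mc]]) (simp add: hom_iff)
      have rp: "comodule_morphism V T (comod_tns T m ?x) m (\<r> ?M \<cdot> \<one> ?M \<boxtimes> p)"
        by (rule comodule_morphism_Cmp[OF T _ _ mc e comodule_morphism_runit[OF T mc]])
           (simp_all add: comodule_tns[OF T mc])
      have "wedge_at \<kappa> m g \<cdot> \<r> ?M \<cdot> \<one> ?M \<boxtimes> p
        = \<kappa> m \<cdot> \<one> ?M \<boxtimes> (transpose ?M \<I> (g \<cdot> \<r> ?M) \<cdot> p)"
        by (simp add: wedge_at_def)
      also have "\<dots> = \<kappa> m \<cdot> \<one> ?M \<boxtimes> transpose ?M ?x (g \<cdot> \<r> ?M \<cdot> \<one> ?M \<boxtimes> p)"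
        by (subst transpose_natural[OF M]) simp_all
      also have "\<dots> = \<Gamma> (comod_tns T m ?x) (g \<cdot> (\<r> ?M \<cdot> \<one> ?M \<boxtimes> p))"
        by (subst \<kappa>t[OF m xX]) (simp_all add: hom_iff assoc)
      also have "\<dots> = \<Gamma> m g \<cdot> (\<r> ?M \<cdot> \<one> ?M \<boxtimes> p)"
        by (rule \<Gamma>_nat[OF X'[OF xX mC] mC rp g])
      also have "\<dots> = \<Gamma> m g \<cdot> \<r> ?M \<cdot> \<one> ?M \<boxtimes> p" by (simp add: assoc)
      finally show "wedge_at \<kappa> m g \<cdot> \<r> ?M \<cdot> \<one> ?M \<boxtimes> p = \<Gamma> m g \<cdot> \<r> ?M \<cdot> \<one> ?M \<boxtimes> p" .
    qed (simp_all add: hom_iff)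
    then show ?thesis by (rule iso_epi[rotated -1]) simp_all
  qed
  show thesis by (rule that[OF wedge]) (simp add: wedge_at \<Gamma>_def)
qed

text \<open>
  A wedge has components at \<open>S\<close> only, so every Cauchy comodule is replaced by a chosen isomorphic
  one in \<open>S\<close>; the result does not depend on the choice, because \<open>wedge_at\<close> is natural.
\<close>

lemma cocone_of_wedge:
  assumes \<kappa>: "tannaka_wedge Z \<kappa>"
  obtains \<gamma> where "cauchy_cocone T Z \<gamma>"
    "\<And>m g. m \<in> S \<Longrightarrow> g \<in> hom V (fst m) \<I> \<Longrightarrow> \<gamma> m (coefficient_map m g) = wedge_at \<kappa> m g"
proof -
  have "\<exists>t. fst t \<in> S \<and> comodule_morphism V T m (fst t) (fst (snd t)) \<and>
      comodule_morphism V T (fst t) m (snd (snd t)) \<and> snd (snd t) \<cdot> fst (snd t) = \<one> (fst m)"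
    if m: "m \<in> cauchy_comodules V T" for m
  proof -
    obtain n u v where "n \<in> S" "comodule_morphism V T m n u" "comodule_morphism V T n m v"
      "v \<cdot> u = \<one> (fst m)" by (rule obtain_replacement[OF m])
    then show ?thesis by (intro exI[of _ "(n, u, v)"]) simp
  qed
  then have "\<forall>m\<in>cauchy_comodules V T. \<exists>t. fst t \<in> S \<and> comodule_morphism V T m (fst t) (fst (snd t)) \<and>
      comodule_morphism V T (fst t) m (snd (snd t)) \<and> snd (snd t) \<cdot> fst (snd t) = \<one> (fst m)"
    by blast
  from bchoice[OF this] obtain \<sigma> where \<sigma>: "\<forall>m\<in>cauchy_comodules V T. fst (\<sigma> m) \<in> S \<and>
      comodule_morphism V T m (fst (\<sigma> m)) (fst (snd (\<sigma> m))) \<and>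
      comodule_morphism V T (fst (\<sigma> m)) m (snd (snd (\<sigma> m))) \<and>
      snd (snd (\<sigma> m)) \<cdot> fst (snd (\<sigma> m)) = \<one> (fst m)" ..
  define R I J where "R = (\<lambda>m. fst (\<sigma> m))" and "I = (\<lambda>m. fst (snd (\<sigma> m)))" and "J = (\<lambda>m. snd (snd (\<sigma> m)))"
  have R: "R m \<in> S" and I: "comodule_morphism V T m (R m) (I m)" and J: "comodule_morphism V T (R m) m (J m)"
    and JI: "J m \<cdot> I m = \<one> (fst m)" if "m \<in> cauchy_comodules V T" for m
    using bspec[OF \<sigma> that] by (simp_all add: R_def I_def J_def)
  define \<gamma> where "\<gamma> = (\<lambda>m \<phi>. wedge_at \<kappa> (R m) (counit T \<cdot> \<phi> \<cdot> J m) \<cdot> I m)"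
  \<comment> \<open>A comodule morphism into a comodule in \<open>S\<close> may be routed through the representative of its source.\<close>
  have step: "wedge_at \<kappa> n h \<cdot> f = wedge_at \<kappa> (R m) (h \<cdot> f \<cdot> J m) \<cdot> I m"
    if n: "n \<in> S" and m: "m \<in> cauchy_comodules V T" and f: "comodule_morphism V T m n f"
      and h: "h \<in> hom V (fst n) \<I>" for m n h f
  proof -
    note c = cauchy_comodule[OF m] and nc = S_simps(1)[OF n] and rc = S_simps(1)[OF R[OF m]]
    note [simp] = comodule_morphism_simps(1-3)[OF f] comodule_morphism_simps(1-3)[OF I[OF m]]
      comodule_morphism_simps(1-3)[OF J[OF m]] h[unfolded hom_iff]
      wedge_at_hom[where \<kappa> = \<kappa>, OF n wedge_simps(2)[OF \<kappa> n] h, unfolded hom_iff]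
    have fJ: "comodule_morphism V T (R m) n (f \<cdot> J m)"
      by (rule comodule_morphism_Cmp[OF T rc c nc J[OF m] f])
    have "wedge_at \<kappa> n h \<cdot> f = wedge_at \<kappa> n h \<cdot> (f \<cdot> J m) \<cdot> I m"
      using JI[OF m] by (simp add: assoc[symmetric])
    also have "wedge_at \<kappa> n h \<cdot> (f \<cdot> J m) = wedge_at \<kappa> (R m) (h \<cdot> (f \<cdot> J m))"
      by (rule wedge_at_natural[OF \<kappa> R[OF m] n fJ h])
    finally show ?thesis by (simp add: assoc)
  qed
  have co: "cauchy_cocone T Z \<gamma>"
  proof (rule cauchy_coconeI)
    show "Z \<in> Ob V" by (rule wedge_simps(1)[OF \<kappa>])
  next
    fix m \<phi> assume m: "m \<in> cauchy_comodules V T" and \<phi>: "comodule_morphism V T m self \<phi>"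
    note [simp] = comodule_morphism_simps(1-3)[OF \<phi>] comodule_morphism_simps(1-3)[OF I[OF m]]
      comodule_morphism_simps(1-3)[OF J[OF m]]
    have "wedge_at \<kappa> (R m) (counit T \<cdot> \<phi> \<cdot> J m) \<in> hom V (fst (R m)) Z"
      by (rule wedge_at_hom[where \<kappa> = \<kappa>, OF R[OF m] wedge_simps(2)[OF \<kappa> R[OF m]]]) (simp add: hom_iff)
    then show "\<gamma> m \<phi> \<in> hom V (fst m) Z" by (simp add: \<gamma>_def hom_iff)
  next
    fix m n \<phi> f assume m: "m \<in> cauchy_comodules V T" and n: "n \<in> cauchy_comodules V T"
      and \<phi>: "comodule_morphism V T n self \<phi>" and f: "comodule_morphism V T m n f"
    note [simp] = comodule_morphism_simps(1-3)[OF \<phi>] comodule_morphism_simps(1-3)[OF f]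
      comodule_morphism_simps(1-3)[OF I[OF m]] comodule_morphism_simps(1-3)[OF J[OF m]]
      comodule_morphism_simps(1-3)[OF I[OF n]] comodule_morphism_simps(1-3)[OF J[OF n]]
    let ?h = "counit T \<cdot> \<phi> \<cdot> J n"
    have h: "?h \<in> hom V (fst (R n)) \<I>" by (simp add: hom_iff)
    note [simp] = wedge_at_hom[where \<kappa> = \<kappa>, OF R[OF n] wedge_simps(2)[OF \<kappa> R[OF n]] h, unfolded hom_iff]
    have If: "comodule_morphism V T m (R n) (I n \<cdot> f)"
      by (rule comodule_morphism_Cmp[OF T cauchy_comodule[OF m] cauchy_comodule[OF n] S_simps(1)[OF R[OF n]] f I[OF n]])
    have "?h \<cdot> (I n \<cdot> f) = counit T \<cdot> \<phi> \<cdot> (J n \<cdot> I n) \<cdot> f" by (simp add: assoc)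
    also have "\<dots> = counit T \<cdot> (\<phi> \<cdot> f)" by (simp add: JI[OF n] assoc)
    finally have "wedge_at \<kappa> (R n) ?h \<cdot> (I n \<cdot> f) = \<gamma> m (\<phi> \<cdot> f)"
      using step[OF R[OF n] m If h] by (simp add: \<gamma>_def)
    then show "\<gamma> m (\<phi> \<cdot> f) = \<gamma> n \<phi> \<cdot> f" by (simp add: \<gamma>_def assoc)
  qed
  have "\<gamma> m (coefficient_map m g) = wedge_at \<kappa> m g" if m: "m \<in> S" and g: "g \<in> hom V (fst m) \<I>" for m g
  proof -
    note mc = S_simps(1)[OF m]
    note [simp] = comodule_simps[OF mc] wedge_at_hom[where \<kappa> = \<kappa>, OF m wedge_simps(2)[OF \<kappa> m] g, unfolded hom_iff]
      g[unfolded hom_iff] comodule_morphism_simps(1-3)[OF J[OF S_cauchy[OF m]]]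
    show ?thesis
      using step[OF m S_cauchy[OF m] comodule_morphism_Idt[OF T mc] g] counit_coefficient_map[OF mc g]
      by (simp add: \<gamma>_def)
  qed
  with co show thesis by (rule that)
qed

text \<open>
  Every Cauchy comodule over \<open>T\<close> is isomorphic to one that lies in \<open>S\<close> and whose structure arrow is
  a coefficient map.
\<close>

lemma factors_coconeI_functionals:
  assumes co: "cauchy_cocone T Z \<gamma>" and h: "h \<in> hom V (cob T) Z"
    and eq: "\<And>m g. m \<in> S \<Longrightarrow> g \<in> hom V (fst m) \<I> \<Longrightarrow> h \<cdot> coefficient_map m g = \<gamma> m (coefficient_map m g)"
  shows "factors_cocone T Z \<gamma> h"
proof (rule factors_coconeI[OF h])
  fix m \<phi> assume m: "m \<in> cauchy_comodules V T" and \<phi>: "comodule_morphism V T m self \<phi>"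
  obtain n u v where n: "n \<in> S" and u: "comodule_morphism V T m n u" and v: "comodule_morphism V T n m v"
    and vu: "v \<cdot> u = \<one> (fst m)" by (rule obtain_replacement[OF m])
  note [simp] = comodule_morphism_simps(1-3)[OF \<phi>] comodule_morphism_simps(1-3)[OF u]
    comodule_morphism_simps(1-3)[OF v] h[unfolded hom_iff]
  note mc = cauchy_comodule[OF m] and nc = S_simps(1)[OF n]
  have \<phi>v: "comodule_morphism V T n self (\<phi> \<cdot> v)"
    by (rule comodule_morphism_Cmp[OF T nc mc self_comodule v \<phi>])
  have "\<phi> \<cdot> v \<cdot> u = \<phi> \<cdot> (v \<cdot> u)" by (simp only: assoc Cmp_simps comodule_morphism_simps(1-3)[OF \<phi>] comodule_morphism_simps(1-3)[OF u] comodule_morphism_simps(1-3)[OF v])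
  then have \<phi>vu: "\<phi> \<cdot> v \<cdot> u = \<phi>" by (simp add: vu)
  have "h \<cdot> (\<phi> \<cdot> v) = \<gamma> n (\<phi> \<cdot> v)"
    using eq[OF n, of "counit T \<cdot> (\<phi> \<cdot> v)"] coefficient_map_counit[OF nc \<phi>v] by (simp add: hom_iff)
  then have "h \<cdot> (\<phi> \<cdot> v \<cdot> u) = \<gamma> n (\<phi> \<cdot> v) \<cdot> u" by (simp add: assoc)
  also have "\<dots> = \<gamma> m (\<phi> \<cdot> v \<cdot> u)"
    by (rule cauchy_coconeD(3)[OF co m S_cauchy[OF n] \<phi>v u, symmetric])
  finally show "h \<cdot> \<phi> = \<gamma> m \<phi>" by (simp only: \<phi>vu)
qed

section \<open>The counit of the Tannakian adjunction\<close>

text \<open>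
  If \<open>\<mu>\<close> is inverse to \<open>\<nu>\<close>, a cocone is turned into a wedge, which factors through \<open>L\<close>, and
  precomposing with \<open>\<mu>\<close> gives the factorization through \<open>T\<close>. Conversely, if \<open>T\<close> is the colimit, the
  universal wedge \<open>\<iota>\<close> gives a cocone with vertex \<open>L\<close>, and the induced \<open>\<mu> : T \<rightarrow> L\<close> is inverse to \<open>\<nu>\<close>
  by the uniqueness clauses of both universal properties.
\<close>

theorem counit_iso_iff_colimit:
  assumes L: "is_tannaka_comonoid V A fst Wh L \<iota>" and \<nu>: "is_tannaka_counit V T S L \<iota> \<nu>"
  shows "(\<exists>\<mu>. \<mu> \<in> hom V (cob T) (cob L) \<and> \<mu> \<cdot> \<nu> = \<one> (cob L) \<and> \<nu> \<cdot> \<mu> = \<one> (cob T)) \<longleftrightarrow>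
    (\<forall>Z \<gamma>. cauchy_cocone T Z \<gamma> \<longrightarrow> (\<exists>!h. factors_cocone T Z \<gamma> h))"
proof -
  have coend: "is_coend V A (\<lambda>b a. fst a \<otimes> dual V (fst b)) (act_cov V A fst Wh) (act_con V A fst Wh) (cob L) \<iota>"
    using L by (simp add: is_tannaka_comonoid_def is_tannaka_coend_def)
  have \<iota>: "tannaka_wedge (cob L) \<iota>" using coend by (simp add: is_coend_def tannaka_wedge_def)
  have coend_ex1: "\<exists>!h. h \<in> hom V (cob L) Z \<and> (\<forall>m\<in>S. h \<cdot> \<iota> m = \<kappa> m)" if "tannaka_wedge Z \<kappa>" for Z \<kappa>
    using coend that unfolding is_coend_def tannaka_wedge_def vOb_A by blast
  have coend_unique: "h = h'" if "h \<in> hom V (cob L) Z" "h' \<in> hom V (cob L) Z"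
      "\<And>m. m \<in> S \<Longrightarrow> h \<cdot> \<iota> m = h' \<cdot> \<iota> m" for h h' Z
  proof -
    have "\<exists>!k. k \<in> hom V (cob L) Z \<and> (\<forall>m\<in>S. k \<cdot> \<iota> m = h \<cdot> \<iota> m)"
      by (rule coend_ex1[OF wedge_Cmp[OF \<iota> that(1)]])
    moreover have "\<forall>m\<in>S. h' \<cdot> \<iota> m = h \<cdot> \<iota> m" using that(3) by simp
    ultimately show ?thesis using that(1,2) by blast
  qed
  have \<nu>': "\<nu> \<in> hom V (cob L) (cob T)" using \<nu> by (simp add: is_tannaka_counit_def comonoid_morphism_def)
  note [simp] = \<nu>'[unfolded hom_iff]
  have LOb [simp]: "cob L \<in> Ob V" by (rule wedge_simps(1)[OF \<iota>])
  have \<nu>_coaction: "\<nu> \<boxtimes> \<one> (fst m) \<cdot> tannaka_coaction V fst \<iota> m = snd m" if "m \<in> S" for m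
    using \<nu> that by (cases m) (auto simp: is_tannaka_counit_def)
  have \<nu>\<iota>: "tannaka_wedge (cob T) (\<lambda>m. \<nu> \<cdot> \<iota> m)" by (rule wedge_Cmp[OF \<iota> \<nu>'])
  \<comment> \<open>The wedge \<open>\<nu> \<cdot> \<iota>\<close> corresponds to the tautological cocone. This is where the equation enters
    that characterizes \<open>\<nu>\<close>: transposing it gives \<open>\<nu> \<cdot> \<iota> m\<close> as the matrix coefficients of \<open>m\<close>.\<close>
  have wedge_at_\<nu>\<iota>: "wedge_at (\<lambda>m. \<nu> \<cdot> \<iota> m) m g = coefficient_map m g" if m: "m \<in> S" and g: "g \<in> hom V (fst m) \<I>" for m g
  proof -
    let ?M = "fst m" and ?M' = "dual V (fst m)" and ?C = "cob T"
    note M = S_simps(2)[OF m]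
    note [simp] = comodule_simps[OF S_simps(1)[OF m]] dual_data_simps[OF M] g[unfolded hom_iff]
      wedge_simps(2)[OF \<iota> m, unfolded hom_iff]
    let ?k = "\<nu> \<cdot> \<iota> m"
    have "transpose ?M \<I> (g \<cdot> \<r> ?M)
      = \<r> ?M' \<cdot> \<one> ?M' \<boxtimes> g \<cdot> (\<one> ?M' \<boxtimes> \<r> ?M \<cdot> \<a> ?M' ?M \<I>) \<cdot> coev V ?M \<boxtimes> \<one> \<I> \<cdot> \<r>' \<I>"
      by (simp add: transpose_def unbend_def lunit_unit assoc)
    also have "\<dots> = \<r> ?M' \<cdot> \<one> ?M' \<boxtimes> g \<cdot> (\<r> (?M' \<otimes> ?M) \<cdot> coev V ?M \<boxtimes> \<one> \<I>) \<cdot> \<r>' \<I>"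
      by (subst runit_tns) (simp_all add: assoc)
    also have "\<dots> = \<r> ?M' \<cdot> \<one> ?M' \<boxtimes> g \<cdot> coev V ?M"
      by (simp add: runit_natural) (simp add: assoc)
    finally have tr: "transpose ?M \<I> (g \<cdot> \<r> ?M) = \<r> ?M' \<cdot> \<one> ?M' \<boxtimes> g \<cdot> coev V ?M" .
    have "coefficient_map m g = \<r> ?C \<cdot> \<one> ?C \<boxtimes> g \<cdot> (\<nu> \<boxtimes> \<one> ?M \<cdot> tannaka_coaction V fst \<iota> m)"
      by (simp add: coefficient_map_def \<nu>_coaction[OF m])
    also have "\<dots> = (\<r> ?C \<cdot> ?k \<boxtimes> \<one> \<I>) \<cdot> (\<one> (?M \<otimes> ?M') \<boxtimes> g \<cdot> \<a>' ?M ?M' ?M) \<cdot> \<one> ?M \<boxtimes> coev V ?M \<cdot> \<r>' ?M"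
      by (simp add: tannaka_coaction_def assoc)
    also have "\<dots> = ?k \<cdot> (\<r> (?M \<otimes> ?M') \<cdot> \<a>' ?M ?M' \<I>) \<cdot> \<one> ?M \<boxtimes> (\<one> ?M' \<boxtimes> g) \<cdot> \<one> ?M \<boxtimes> coev V ?M \<cdot> \<r>' ?M"
      by (subst assc'_at[of "\<one> ?M" "\<one> ?M'" g, simplified, symmetric]) (simp_all add: runit_natural assoc)
    also have "\<dots> = wedge_at (\<lambda>m. \<nu> \<cdot> \<iota> m) m g"
      by (subst runit_tns_inv) (simp_all add: wedge_at_def tr assoc)
    finally show ?thesis by simp
  qed
  have wedge_at_comp: "wedge_at (\<lambda>m. h \<cdot> (\<nu> \<cdot> \<iota> m)) m g = h \<cdot> coefficient_map m g"
    if "m \<in> S" "g \<in> hom V (fst m) \<I>" "h \<in> hom V (cob T) Z" for m g h Z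
    using wedge_at_Cmp[where \<kappa> = "\<lambda>m. \<nu> \<cdot> \<iota> m", OF that(1) wedge_simps(2)[OF \<nu>\<iota> that(1)] that(2,3)]
      wedge_at_\<nu>\<iota>[OF that(1,2)] by simp
  have coefficient_map_hom: "coefficient_map m g \<in> hom V (fst m) (cob T)" if "m \<in> S" "g \<in> hom V (fst m) \<I>" for m g
    using comodule_morphism_simps[OF coefficient_map_morphism[OF S_simps(1)[OF that(1)] that(2)]] by (simp add: hom_iff)
  show ?thesis
  proof (intro iffI allI impI)
    fix Z \<gamma> assume "\<exists>\<mu>. \<mu> \<in> hom V (cob T) (cob L) \<and> \<mu> \<cdot> \<nu> = \<one> (cob L) \<and> \<nu> \<cdot> \<mu> = \<one> (cob T)"
      and co: "cauchy_cocone T Z \<gamma>"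
    then obtain \<mu> where \<mu>: "\<mu> \<in> hom V (cob T) (cob L)" and inv: "\<mu> \<cdot> \<nu> = \<one> (cob L)" "\<nu> \<cdot> \<mu> = \<one> (cob T)" by blast
    note [simp] = \<mu>[unfolded hom_iff] inv
    obtain \<kappa> where \<kappa>: "tannaka_wedge Z \<kappa>"
      and pt: "\<And>m g. m \<in> S \<Longrightarrow> g \<in> hom V (fst m) \<I> \<Longrightarrow> wedge_at \<kappa> m g = \<gamma> m (coefficient_map m g)"
      by (rule wedge_of_cocone[OF co]) (rule that)
    obtain k where k: "k \<in> hom V (cob L) Z" and k\<iota>: "\<And>m. m \<in> S \<Longrightarrow> k \<cdot> \<iota> m = \<kappa> m"
      using coend_ex1[OF \<kappa>] by blast
    note [simp] = k[unfolded hom_iff]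
    have h: "k \<cdot> \<mu> \<in> hom V (cob T) Z" by (simp add: hom_iff)
    have fac: "factors_cocone T Z \<gamma> (k \<cdot> \<mu>)"
    proof (rule factors_coconeI_functionals[OF co h])
      fix m g assume m: "m \<in> S" and g: "g \<in> hom V (fst m) \<I>"
      note [simp] = wedge_simps(2)[OF \<iota> m, unfolded hom_iff]
      have "k \<cdot> \<mu> \<cdot> (\<nu> \<cdot> \<iota> m) = k \<cdot> (\<mu> \<cdot> \<nu>) \<cdot> \<iota> m" by (simp add: assoc del: inv)
      also have "\<dots> = \<kappa> m" using k\<iota>[OF m] by simp
      finally have "k \<cdot> \<mu> \<cdot> (\<nu> \<cdot> \<iota> m) = \<kappa> m" .
      then have "wedge_at (\<lambda>m. k \<cdot> \<mu> \<cdot> (\<nu> \<cdot> \<iota> m)) m g = wedge_at \<kappa> m g" by (simp add: wedge_at_def)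
      then show "k \<cdot> \<mu> \<cdot> coefficient_map m g = \<gamma> m (coefficient_map m g)"
        using wedge_at_comp[OF m g h] pt[OF m g] by simp
    qed
    have uniq: "h = h'" if h: "factors_cocone T Z \<gamma> h" and h': "factors_cocone T Z \<gamma> h'" for h h'
    proof -
      note H = factors_coconeD(1)[OF h] and H' = factors_coconeD(1)[OF h']
      note [simp] = H[unfolded hom_iff] H'[unfolded hom_iff]
      have "h \<cdot> \<nu> = h' \<cdot> \<nu>"
      proof (rule coend_unique)
        show "h \<cdot> \<nu> \<in> hom V (cob L) Z" "h' \<cdot> \<nu> \<in> hom V (cob L) Z" by (simp_all add: hom_iff)
        fix m assume m: "m \<in> S"
        have "h \<cdot> (\<nu> \<cdot> \<iota> m) = h' \<cdot> (\<nu> \<cdot> \<iota> m)"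
        proof (rule wedge_determined_by_functionals[OF wedge_Cmp[OF \<nu>\<iota> H] wedge_Cmp[OF \<nu>\<iota> H'] _ m])
          fix n g assume n: "n \<in> S" and g: "g \<in> hom V (fst n) \<I>"
          have "comodule_morphism V T n self (coefficient_map n g)" by (rule coefficient_map_morphism[OF S_simps(1)[OF n] g])
          then have "h \<cdot> coefficient_map n g = h' \<cdot> coefficient_map n g"
            using factors_coconeD(2)[OF h S_cauchy[OF n]] factors_coconeD(2)[OF h' S_cauchy[OF n]] by simp
          then show "wedge_at (\<lambda>m. h \<cdot> (\<nu> \<cdot> \<iota> m)) n g = wedge_at (\<lambda>m. h' \<cdot> (\<nu> \<cdot> \<iota> m)) n g"
            unfolding wedge_at_comp[OF n g H] wedge_at_comp[OF n g H'] .
        qed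
        then show "h \<cdot> \<nu> \<cdot> \<iota> m = h' \<cdot> \<nu> \<cdot> \<iota> m"
          using wedge_simps(2)[OF \<iota> m, unfolded hom_iff] by (simp add: assoc)
      qed
      then have "h \<cdot> \<nu> \<cdot> \<mu> = h' \<cdot> \<nu> \<cdot> \<mu>" by simp
      then show "h = h'" by (simp add: assoc[symmetric])
    qed
    show "\<exists>!h. factors_cocone T Z \<gamma> h" using fac uniq by blast
  next
    assume colim: "\<forall>Z \<gamma>. cauchy_cocone T Z \<gamma> \<longrightarrow> (\<exists>!h. factors_cocone T Z \<gamma> h)"
    obtain \<gamma> where co: "cauchy_cocone T (cob L) \<gamma>"
      and pt: "\<And>m g. m \<in> S \<Longrightarrow> g \<in> hom V (fst m) \<I> \<Longrightarrow> \<gamma> m (coefficient_map m g) = wedge_at \<iota> m g"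
      by (rule cocone_of_wedge[OF \<iota>]) (rule that)
    obtain \<mu> where \<mu>: "factors_cocone T (cob L) \<gamma> \<mu>" using colim co by blast
    note M = factors_coconeD(1)[OF \<mu>]
    note [simp] = M[unfolded hom_iff]
    have \<mu>cog: "\<mu> \<cdot> coefficient_map m g = wedge_at \<iota> m g" if "m \<in> S" "g \<in> hom V (fst m) \<I>" for m g
      using factors_coconeD(2)[OF \<mu> S_cauchy[OF that(1)] coefficient_map_morphism[OF S_simps(1)[OF that(1)] that(2)]]
        pt[OF that] by simp
    have \<mu>\<nu>: "\<mu> \<cdot> \<nu> = \<one> (cob L)"
    proof (rule coend_unique)
      show "\<mu> \<cdot> \<nu> \<in> hom V (cob L) (cob L)" "\<one> (cob L) \<in> hom V (cob L) (cob L)" by (simp_all add: hom_iff)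
      fix m assume m: "m \<in> S"
      note [simp] = wedge_simps(2)[OF \<iota> m, unfolded hom_iff]
      have "\<mu> \<cdot> (\<nu> \<cdot> \<iota> m) = \<iota> m"
        by (rule wedge_determined_by_functionals[OF wedge_Cmp[OF \<nu>\<iota> M] \<iota> _ m]) (simp add: wedge_at_comp[OF _ _ M] \<mu>cog)
      then show "\<mu> \<cdot> \<nu> \<cdot> \<iota> m = \<one> (cob L) \<cdot> \<iota> m" by (simp add: assoc)
    qed
    have taut: "cauchy_cocone T (cob T) (\<lambda>m \<phi>. \<phi>)"
      by (rule cauchy_coconeI) (auto simp: comodule_morphism_iff)
    have "factors_cocone T (cob T) (\<lambda>m \<phi>. \<phi>) (\<nu> \<cdot> \<mu>)"
    proof (rule factors_coconeI_functionals[OF taut])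
      show "\<nu> \<cdot> \<mu> \<in> hom V (cob T) (cob T)" by (simp add: hom_iff)
      fix m g assume m: "m \<in> S" and g: "g \<in> hom V (fst m) \<I>"
      note [simp] = coefficient_map_hom[OF m g, unfolded hom_iff]
      have "\<nu> \<cdot> \<mu> \<cdot> coefficient_map m g = \<nu> \<cdot> (\<mu> \<cdot> coefficient_map m g)" by (simp add: assoc)
      also have "\<dots> = wedge_at (\<lambda>m. \<nu> \<cdot> \<iota> m) m g"
        using \<mu>cog[OF m g] wedge_at_Cmp[where \<kappa> = \<iota>, OF m wedge_simps(2)[OF \<iota> m] g \<nu>'] by simp
      also have "\<dots> = coefficient_map m g" by (rule wedge_at_\<nu>\<iota>[OF m g])
      finally show "\<nu> \<cdot> \<mu> \<cdot> coefficient_map m g = coefficient_map m g" .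
    qed
    moreover have "factors_cocone T (cob T) (\<lambda>m \<phi>. \<phi>) (\<one> (cob T))"
      by (rule factors_coconeI) (auto simp: hom_iff comodule_morphism_iff)
    ultimately have "\<nu> \<cdot> \<mu> = \<one> (cob T)" using colim taut by blast
    with \<mu>\<nu> M show "\<exists>\<mu>. \<mu> \<in> hom V (cob T) (cob L) \<and> \<mu> \<cdot> \<nu> = \<one> (cob L) \<and> \<nu> \<cdot> \<mu> = \<one> (cob T)" by blast
  qed
qed

end

theorem theorem1p6:
  fixes V :: "('o, 'a) smc"
    and U :: "'u itself"
    and T L :: "('o, 'a) comon"
    and S :: "('o \<times> 'a) set"
    and A :: "('o \<times> 'a, 'o, 'a) vcat"
    and Wh :: "'o \<times> 'a \<Rightarrow> 'o \<times> 'a \<Rightarrow> 'a"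
    and \<iota> :: "'o \<times> 'a \<Rightarrow> 'a"
    and \<nu> :: 'a
  assumes "smallness_type U"
    and "cosmos U V"
    and "\<exists>X. dense_autonomous_generator V U X"
    and "essentially_small U V (dualizable V)"
    and "comonoid V T"
    and "small_replacement U (Comod V T) (cauchy_comodules V T) S"
    and "is_comodule_vcat V T S A Wh"
    and "is_tannaka_comonoid V A fst Wh L \<iota>"
    and "is_tannaka_counit V T S L \<iota> \<nu>"
  shows "is_iso (Comon V) (L, T, \<nu>) \<longleftrightarrow>
         tautological_colimit (Comod V T) (cauchy_comodules V T) (cob T, comult T)"
proof -
  obtain X where X: "dense_autonomous_generator V U X" using assms(3) by blast
  interpret symmetric_monoidal_closed V using assms(2) by (simp add: cosmos_def)
  interpret tannakian_setting V T S A Wh X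
    by unfold_locales
      (use assms(5-7) X in \<open>auto simp: small_replacement_def dense_autonomous_generator_def\<close>)
  show ?thesis
    using is_iso_Comon_iff[of L T \<nu>] counit_iso_iff_colimit[OF assms(8,9)]
      tautological_colimit_Comod_iff[OF assms(5)] assms(5,8,9)
    by (simp add: is_tannaka_comonoid_def is_tannaka_counit_def)
qed

end
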